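(* Let $k$ be an infinite field and $S=k[x_1,\dots,x_n]$ the standard graded polynomial ring with homogeneous maximal ideal $\mathfrak m=(x_1,\dots,x_n)$. Let $\mathcal L$ be a full set of non-unit squarefree monomials in $S$. To each $f\in\mathcal L$ assign a componentwise linear monomial ideal $I_f\subseteq S$ such that: (1) for every $f\in\mathcal L$, the minimal monomial generators of $I_f$ involve only variables dividing $f$; (2) for any $f\in\mathcal L$ and any variable $z$ such that $zf\in\mathcal L$, we have $I_f\subseteq \mathfrak m I_{zf}$. Then the ideal $\sum_{f\in\mathcal L} fI_f$ is componentwise linear.
   Context: For a homogeneous ideal $I\subseteq S$, $I_{\langle j\rangle}$ denotes the ideal generated by all forms of degree $j$ in $I$. A homogeneous ideal generated in a single degree $d$ has a linear resolution if its Castelnuovo-Mumford regularity is $d$ (the zero ideal is regarded as having a linear resolution). $I$ is componentwise linear if $I_{\langle j\rangle}$ has a linear resolution for all $j\ge 0$. A set $\mathcal L$ of non-unit squarefree monomials is lcm-closed if $\operatorname{lcm}(f,g)\in\mathcal L$ for all $f,g\in\mathcal L$. If $f,g\in\mathcal L$ and $f\mid g$, a full path in $\mathcal L$ from $f$ to $g$ is a sequence $g_1,\dots,g_l$ of elements of $\mathcal L$ with $g_1=f$, $g_l=g$ and $g_j=z_jg_{j-1}$ for all $2\le j\le l$, where each $z_j$ is some variable of $S$. The set $\mathcal L$ is full if it is lcm-closed and a full path exists in $\mathcal L$ from $f$ to $g$ for any $f,g\in\mathcal L$ with $f\mid g$. *)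

theory Defs
  imports "HOL-Library.Poly_Mapping" "Jordan_Normal_Form.Matrix"
begin

section \<open>Monomials and the polynomial ring\<close>

text \<open>
  Monomials in the variables \<open>'x\<close> are exponent vectors, written additively. The polynomial ring
  over \<open>'k\<close> in the \<open>n = CARD('x)\<close> variables \<open>'x :: finite\<close> is the type of finitely supported
  functions from monomials to \<open>'k\<close>, whose product is the convolution product.
\<close>

type_synonym 'x mon = "'x \<Rightarrow>\<^sub>0 nat"
type_synonym ('x, 'k) polyring = "('x \<Rightarrow>\<^sub>0 nat) \<Rightarrow>\<^sub>0 'k"

definition var :: "'x \<Rightarrow> 'x mon" where
  "var x = Poly_Mapping.single x 1"

definition poly_of_mon :: "'x mon \<Rightarrow> ('x, 'k::comm_ring_1) polyring" where
  "poly_of_mon m = Poly_Mapping.single m 1"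

definition mon_dvd :: "'x mon \<Rightarrow> 'x mon \<Rightarrow> bool" where
  "mon_dvd s t \<longleftrightarrow> (\<exists>u. t = s + u)"

lift_definition mon_lcm :: "'x mon \<Rightarrow> 'x mon \<Rightarrow> 'x mon"
  is "\<lambda>s t x. max (s x) (t x)"
proof -
  fix s t :: "'x \<Rightarrow> nat"
  assume "finite {x. s x \<noteq> 0}" and "finite {x. t x \<noteq> 0}"
  then have "finite ({x. s x \<noteq> 0} \<union> {x. t x \<noteq> 0})"
    by simp
  then show "finite {x. max (s x) (t x) \<noteq> 0}"
    by (rule rev_finite_subset) auto
qed

definition squarefree_mon :: "'x mon \<Rightarrow> bool" where
  "squarefree_mon m \<longleftrightarrow> (\<forall>x. Poly_Mapping.lookup m x \<le> 1)"

definition mon_degree :: "'x::finite mon \<Rightarrow> nat" where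
  "mon_degree m = (\<Sum>x\<in>UNIV. Poly_Mapping.lookup m x)"

text \<open>The forms of degree \<open>d\<close>; the zero polynomial is a form of every degree.\<close>

definition form :: "nat \<Rightarrow> ('x::finite, 'k::comm_ring_1) polyring \<Rightarrow> bool" where
  "form d p \<longleftrightarrow> (\<forall>m\<in>Poly_Mapping.keys p. mon_degree m = d)"

section \<open>Ideals\<close>

text \<open>
  Ideals of a commutative ring are its submodules as a module over itself. The name
  \<^term>\<open>Modules.module\<close> is qualified because of the locale of the same name in HOL-Algebra.
\<close>

global_interpretation ring_module: Modules.module "(*) :: 'a::comm_ring_1 \<Rightarrow> 'a \<Rightarrow> 'a"
  by unfold_locales (simp_all add: algebra_simps)

abbreviation ideal_gen :: "'a::comm_ring_1 set \<Rightarrow> 'a set" where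
  "ideal_gen \<equiv> ring_module.span"

definition ideal_mult :: "'a::comm_ring_1 set \<Rightarrow> 'a set \<Rightarrow> 'a set" where
  "ideal_mult A B = ideal_gen {a * b |a b. a \<in> A \<and> b \<in> B}"

definition max_ideal :: "('x, 'k::comm_ring_1) polyring set" where
  "max_ideal = ideal_gen (range (\<lambda>x. poly_of_mon (var x)))"

definition homogeneous_ideal :: "('x::finite, 'k::comm_ring_1) polyring set \<Rightarrow> bool" where
  "homogeneous_ideal I \<longleftrightarrow> (\<exists>H. (\<forall>p\<in>H. \<exists>d. form d p) \<and> I = ideal_gen H)"

definition monomial_ideal :: "('x, 'k::comm_ring_1) polyring set \<Rightarrow> bool" where
  "monomial_ideal I \<longleftrightarrow> (\<exists>M. I = ideal_gen (poly_of_mon ` M))"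

definition min_mon_gens :: "('x, 'k::comm_ring_1) polyring set \<Rightarrow> 'x mon set" where
  "min_mon_gens I = {m. poly_of_mon m \<in> I \<and>
     (\<forall>m'. poly_of_mon m' \<in> I \<and> mon_dvd m' m \<longrightarrow> m' = m)}"

definition component ::
  "('x::finite, 'k::comm_ring_1) polyring set \<Rightarrow> nat \<Rightarrow> ('x, 'k) polyring set" where
  "component I j = ideal_gen {p \<in> I. form j p}"

definition generated_in_degree ::
  "nat \<Rightarrow> ('x::finite, 'k::comm_ring_1) polyring set \<Rightarrow> bool" where
  "generated_in_degree d I \<longleftrightarrow> (\<exists>H. (\<forall>p\<in>H. form d p) \<and> I = ideal_gen H)"

section \<open>Minimal graded free resolutions and regularity\<close>

text \<open>
  A minimal graded free resolution
  \<open>\<dots> \<rightarrow> F\<^sub>2 \<rightarrow> F\<^sub>1 \<rightarrow> F\<^sub>0 \<rightarrow> I \<rightarrow> 0\<close>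
  of an ideal \<open>I\<close> of the polynomial ring \<open>S\<close>, in coordinates: \<open>F\<^sub>i\<close> is the direct sum of the
  \<open>S(- a i p)\<close> for \<open>p < r i\<close>, the map \<open>F\<^sub>0 \<rightarrow> I\<close> sends the basis to the entries of \<open>g\<close>, and
  \<open>F\<^bsub>i+1\<^esub> \<rightarrow> F\<^sub>i\<close> is the matrix \<open>D i\<close>.
  Minimality says that the differentials have entries in the maximal ideal, that is, that the
  image of \<open>F\<^bsub>i+1\<^esub>\<close> lies in the maximal ideal times \<open>F\<^sub>i\<close>. Shifts can be taken in \<open>nat\<close>,
  since the basis elements of a minimal resolution of an ideal of \<open>S\<close> have degree at least 0.
\<close>

definition minimal_graded_free_resolution ::
  "('x::finite, 'k::field) polyring set \<Rightarrow> (nat \<Rightarrow> nat) \<Rightarrow> (nat \<Rightarrow> nat \<Rightarrow> nat) \<Rightarrow>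
   ('x, 'k) polyring vec \<Rightarrow> (nat \<Rightarrow> ('x, 'k) polyring mat) \<Rightarrow> bool" where
  "minimal_graded_free_resolution I r a g D \<longleftrightarrow>
     g \<in> carrier_vec (r 0) \<and>
     (\<forall>i. D i \<in> carrier_mat (r i) (r (Suc i))) \<and>
     \<comment> \<open>the maps are homogeneous of degree 0\<close>
     (\<forall>p<r 0. form (a 0 p) (g $ p)) \<and>
     (\<forall>i. \<forall>p<r i. \<forall>q<r (Suc i). \<forall>m\<in>Poly_Mapping.keys (D i $$ (p, q)).
        a i p + mon_degree m = a (Suc i) q) \<and>
     \<comment> \<open>exactness\<close>
     I = {scalar_prod g v |v. v \<in> carrier_vec (r 0)} \<and>
     {v \<in> carrier_vec (r 0). scalar_prod g v = 0} =
       {D 0 *\<^sub>v w |w. w \<in> carrier_vec (r 1)} \<and>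
     (\<forall>i. {v \<in> carrier_vec (r (Suc i)). D i *\<^sub>v v = 0\<^sub>v (r i)} =
       {D (Suc i) *\<^sub>v w |w. w \<in> carrier_vec (r (Suc (Suc i)))}) \<and>
     \<comment> \<open>minimality\<close>
     (\<forall>i. \<forall>p<r i. \<forall>q<r (Suc i). D i $$ (p, q) \<in> max_ideal)"

text \<open>
  The Castelnuovo-Mumford regularity of a nonzero homogeneous ideal is the maximum of the numbers
  \<open>a i p - i\<close>, where \<open>a i p\<close> are the shifts in homological degree \<open>i\<close> of a minimal graded free
  resolution. Such a resolution is unique up to isomorphism, so the maximum is determined by the
  ideal; it is rendered as a relation. The zero ideal has no regularity in this sense.
\<close>

definition has_regularity :: "('x::finite, 'k::field) polyring set \<Rightarrow> int \<Rightarrow> bool" where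
  "has_regularity I d \<longleftrightarrow>
     (\<exists>r a g D. minimal_graded_free_resolution I r a g D \<and>
        (\<exists>i p. p < r i \<and> d = int (a i p) - int i) \<and>
        (\<forall>i p. p < r i \<longrightarrow> int (a i p) - int i \<le> d))"

definition linear_resolution :: "('x::finite, 'k::field) polyring set \<Rightarrow> bool" where
  "linear_resolution I \<longleftrightarrow>
     I = {0} \<or> (\<exists>d. generated_in_degree d I \<and> has_regularity I (int d))"

definition componentwise_linear :: "('x::finite, 'k::field) polyring set \<Rightarrow> bool" where
  "componentwise_linear I \<longleftrightarrow>
     homogeneous_ideal I \<and> (\<forall>j. linear_resolution (component I j))"

section \<open>Full sets of squarefree monomials\<close>

definition lcm_closed :: "'x mon set \<Rightarrow> bool" where
  "lcm_closed L \<longleftrightarrow> (\<forall>f\<in>L. \<forall>g\<in>L. mon_lcm f g \<in> L)"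

definition full_path :: "'x mon set \<Rightarrow> 'x mon \<Rightarrow> 'x mon \<Rightarrow> 'x mon list \<Rightarrow> bool" where
  "full_path L f g gs \<longleftrightarrow>
     gs \<noteq> [] \<and> set gs \<subseteq> L \<and> hd gs = f \<and> last gs = g \<and>
     (\<forall>j. Suc j < length gs \<longrightarrow> (\<exists>z. gs ! Suc j = var z + gs ! j))"

text \<open>The unit monomial is \<open>0\<close> in additive notation.\<close>

definition full_set :: "'x mon set \<Rightarrow> bool" where
  "full_set L \<longleftrightarrow>
     (\<forall>f\<in>L. squarefree_mon f \<and> f \<noteq> 0) \<and>
     lcm_closed L \<and>
     (\<forall>f\<in>L. \<forall>g\<in>L. mon_dvd f g \<longrightarrow> (\<exists>gs. full_path L f g gs))"

section \<open>Sums of ideals\<close>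

definition ideal_sum :: "'i set \<Rightarrow> ('i \<Rightarrow> 'a::comm_ring_1 set) \<Rightarrow> 'a set" where
  "ideal_sum A J = ideal_gen (\<Union>i\<in>A. J i)"

definition scale_ideal :: "'a::comm_ring_1 \<Rightarrow> 'a set \<Rightarrow> 'a set" where
  "scale_ideal c I = (\<lambda>p. c * p) ` I"

end

theory Submission
  imports Defs "HOL-Library.Countable" "HOL-Library.Function_Algebras"
begin

text \<open>
  By computing \<open>Tor(A, k)\<close> from the Koszul complex, a monomial ideal \<open>A\<close> generated in degree \<open>d\<close>
  has a linear resolution iff in every multidegree \<open>b\<close> the upper Koszul complex
  \<open>{\<sigma>. x\<^sup>b / x\<^sup>\<sigma> \<in> A}\<close> has homology only in the degree \<open>i\<close> with \<open>\<bar>b\<bar> = i + d\<close> (faces of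
  cardinality \<open>i\<close> having homological degree \<open>i\<close>).

  The degree \<open>j\<close> component of the sum is \<open>\<Sum>\<^sub>f f A\<^sub>f\<close>, where \<open>A\<^sub>f\<close> is generated by the forms of degree
  \<open>j - deg f\<close> in \<open>I\<^sub>f\<close>. Build it up by adding the \<open>f A\<^sub>f\<close> one at a time, larger \<open>f\<close> first. Fullness and
  the two conditions on the \<open>I\<^sub>f\<close> imply that the quotient at the step \<open>g\<close> is spanned by the monomials
  \<open>g v\<close> with \<open>v \<in> A\<^sub>g\<close> not divisible by any variable \<open>z\<close> with \<open>z g \<in> L\<close>. In a fixed multidegree its
  Koszul complex is a translate of the one of \<open>A\<^sub>g\<close>, so the degree condition passes to the quotient,
  and by the long exact sequence to the sum.
\<close>

section \<open>Simplicial and relative homology\<close>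

text \<open>As a rewrite rule this is associativity from right to left, against \<open>mult.assoc\<close>.\<close>

declare ring_module.scale_scale [simp del]

text \<open>The shape of the quotient at \<open>g\<close> comes from a degree count. Passing from
  \<open>g\<close> to \<open>z g\<close> lowers the degree required of the cofactor by one, and
  condition (2) pays for it: every monomial of the ideal at \<open>g\<close> is a variable times a
  monomial of the ideal at \<open>z g\<close>. If \<open>z\<close> divides the cofactor's generator
  itself, condition (1) allows dividing by \<open>z\<close> instead. So all cofactors divisible by
  \<open>z\<close> are already present. Conversely, a monomial shared with an earlier
  \<open>f\<close> is a multiple of the lcm of \<open>f\<close> and \<open>g\<close>, and the first
  step of a full path from \<open>g\<close> to that lcm exhibits such a \<open>z\<close>. Since
  \<open>linear_resolution\<close> asks for an actual minimal resolution, the Koszul criterion has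
  to be proved in both directions. Both pass through syzygy modules, which are not ideals; hence
  \<open>koszul_linear\<close> is stated for submodules of free modules, and the combinatorial form
  is derived only for monomial ideals.\<close>

definition incidence_sign :: "'x::finite \<Rightarrow> 'x set \<Rightarrow> 'a::comm_ring_1" where
  "incidence_sign x \<tau> = (- 1) ^ card {y \<in> \<tau>. to_nat y < to_nat x}"

text \<open>The weights cover two complexes at once: constant weight 1 gives the augmented
  simplicial boundary, weight \<open>x\<close> at the vertex \<open>x\<close> the Koszul
  differential. The value is read off at the target face \<open>\<tau>\<close>, so chains are plain
  functions on all subsets.\<close>

definition koszul_bd ::
  "('x::finite \<Rightarrow> 'a::comm_ring_1) \<Rightarrow> ('x set \<Rightarrow> 'a) \<Rightarrow> 'x set \<Rightarrow> 'a" where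
  "koszul_bd w c \<tau> = (\<Sum>x\<in>- \<tau>. incidence_sign x \<tau> * w x * c (insert x \<tau>))"

definition chain :: "'x::finite set set \<Rightarrow> nat \<Rightarrow> ('x set \<Rightarrow> 'a::zero) \<Rightarrow> bool" where
  "chain X i c \<longleftrightarrow> (\<forall>\<sigma>. c \<sigma> \<noteq> 0 \<longrightarrow> \<sigma> \<in> X \<and> card \<sigma> = i)"

lemma chainD: "chain X i c \<Longrightarrow> c \<sigma> \<noteq> 0 \<Longrightarrow> \<sigma> \<in> X \<and> card \<sigma> = i"
  by (simp add: chain_def)

lemma chain_zero: "chain X i c \<Longrightarrow> \<sigma> \<notin> X \<Longrightarrow> c \<sigma> = 0"
  by (auto simp: chain_def)

lemma chain_zero_card: "chain X i c \<Longrightarrow> card \<sigma> \<noteq> i \<Longrightarrow> c \<sigma> = 0"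
  by (auto simp: chain_def)

lemma incidence_sign_square: "incidence_sign x \<tau> * incidence_sign x \<tau> = 1"
  by (simp add: incidence_sign_def flip: power_mult_distrib)

lemma incidence_sign_insert:
  assumes "y \<notin> \<tau>"
  shows "incidence_sign x (insert y \<tau>) =
    (if to_nat y < to_nat x then - incidence_sign x \<tau> else incidence_sign x \<tau>)"
proof -
  have "{z \<in> insert y \<tau>. to_nat z < to_nat x} =
    (if to_nat y < to_nat x then insert y {z \<in> \<tau>. to_nat z < to_nat x}
     else {z \<in> \<tau>. to_nat z < to_nat x})"
    by auto
  then show ?thesis
    using assms by (simp add: incidence_sign_def)
qed

lemma incidence_sign_Un:
  assumes "\<tau> \<inter> \<zeta> = {}"
  shows "incidence_sign x (\<tau> \<union> \<zeta>) = incidence_sign x \<tau> * incidence_sign x \<zeta>"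
proof -
  have "{z \<in> \<tau> \<union> \<zeta>. to_nat z < to_nat x} =
      {z \<in> \<tau>. to_nat z < to_nat x} \<union> {z \<in> \<zeta>. to_nat z < to_nat x}"
    by auto
  moreover have "card ({z \<in> \<tau>. to_nat z < to_nat x} \<union> {z \<in> \<zeta>. to_nat z < to_nat x})
      = card {z \<in> \<tau>. to_nat z < to_nat x} + card {z \<in> \<zeta>. to_nat z < to_nat x}"
    using assms by (intro card_Un_disjoint) auto
  ultimately show ?thesis
    by (simp add: incidence_sign_def power_add)
qed

text \<open>Of two vertices exactly one precedes the other under \<open>to_nat\<close>, so exactly
  one of the two insertions flips a sign. This is the sign behind the vanishing of the squared
  boundary.\<close>

lemma incidence_sign_swap:
  assumes "x \<noteq> y" "x \<notin> \<tau>" "y \<notin> \<tau>"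
  shows "incidence_sign x \<tau> * incidence_sign y (insert x \<tau>) =
    - (incidence_sign y \<tau> * incidence_sign x (insert y \<tau>))"
proof -
  have "to_nat x \<noteq> to_nat y"
    using assms by simp
  then consider "to_nat x < to_nat y" | "to_nat y < to_nat x"
    by linarith
  then show ?thesis
    by cases (simp_all add: incidence_sign_insert assms)
qed

lemma koszul_bd_add: "koszul_bd w (\<lambda>\<sigma>. c \<sigma> + e \<sigma>) \<tau> = koszul_bd w c \<tau> + koszul_bd w e \<tau>"
  by (simp add: koszul_bd_def algebra_simps sum.distrib)

lemma koszul_bd_diff: "koszul_bd w (\<lambda>\<sigma>. c \<sigma> - e \<sigma>) \<tau> = koszul_bd w c \<tau> - koszul_bd w e \<tau>"
  by (simp add: koszul_bd_def algebra_simps sum_subtractf)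

lemma koszul_bd_scale: "koszul_bd w (\<lambda>\<sigma>. a * c \<sigma>) \<tau> = a * koszul_bd w c \<tau>"
  by (simp add: koszul_bd_def algebra_simps sum_distrib_left)

lemma koszul_bd_sum: "koszul_bd w (\<lambda>\<sigma>. \<Sum>q\<in>Q. c q \<sigma>) \<tau> = (\<Sum>q\<in>Q. koszul_bd w (c q) \<tau>)"
  unfolding koszul_bd_def sum_distrib_left by (rule sum.swap)

lemma koszul_bd_zero:
  "(\<And>x. x \<notin> \<tau> \<Longrightarrow> c (insert x \<tau>) = 0) \<Longrightarrow> koszul_bd w c \<tau> = 0"
  by (simp add: koszul_bd_def)

lemma koszul_bd_bd: "koszul_bd w (koszul_bd w c) \<tau> = 0"
proof -
  define g where "g x y = incidence_sign x \<tau> * w x * (incidence_sign y (insert x \<tau>) * w y *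
    c (insert y (insert x \<tau>)))" for x y
  \<comment> \<open>Antisymmetry alone shows only that the double sum equals its negative, which
    says nothing in characteristic 2. Splitting the pairs by order cancels the terms one against
    one.\<close>
  define P where "P = {(x, y). x \<notin> \<tau> \<and> y \<notin> \<tau> \<and> to_nat x < to_nat y}"
  have anti: "g y x = - g x y" if "x \<noteq> y" "x \<notin> \<tau>" "y \<notin> \<tau>" for x y
  proof -
    have "g x y = (incidence_sign x \<tau> * incidence_sign y (insert x \<tau>)) * (w x * w y * c (insert y (insert x \<tau>)))"
      by (simp add: g_def algebra_simps)
    moreover have "g y x = (incidence_sign y \<tau> * incidence_sign x (insert y \<tau>)) * (w x * w y * c (insert y (insert x \<tau>)))"
      by (simp add: g_def algebra_simps insert_commute)
    moreover have "incidence_sign x \<tau> * incidence_sign y (insert x \<tau>) =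
        - (incidence_sign y \<tau> * incidence_sign x (insert y \<tau>) :: 'a)"
      by (rule incidence_sign_swap[OF that])
    ultimately show ?thesis
      by simp
  qed
  have fin: "finite A" for A :: "('b \<times> 'b) set"
    by (rule finite_subset[OF subset_UNIV]) (simp add: finite_prod)
  have "koszul_bd w (koszul_bd w c) \<tau> = (\<Sum>x\<in>- \<tau>. \<Sum>y\<in>- insert x \<tau>. g x y)"
    by (simp add: koszul_bd_def g_def sum_distrib_left)
  also have "\<dots> = (\<Sum>(x, y)\<in>(SIGMA x:- \<tau>. - insert x \<tau>). g x y)"
    by (simp add: sum.Sigma)
  also have "(SIGMA x:- \<tau>. - insert x \<tau>) = P \<union> prod.swap ` P"
  proof -
    have "to_nat a < to_nat b \<or> to_nat b < to_nat a" if "b \<noteq> a" for a b :: 'b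
      using that by (metis linorder_neqE_nat to_nat_split)
    then show ?thesis
      by (fastforce simp: P_def image_iff)
  qed
  also have "(\<Sum>(x, y)\<in>P \<union> prod.swap ` P. g x y) =
      (\<Sum>(x, y)\<in>P. g x y) + (\<Sum>(x, y)\<in>prod.swap ` P. g x y)"
    by (rule sum.union_disjoint[OF fin fin]) (auto simp: P_def)
  also have "(\<Sum>(x, y)\<in>prod.swap ` P. g x y) = (\<Sum>(x, y)\<in>P. g y x)"
    by (subst sum.reindex) (auto simp: case_prod_unfold)
  also have "\<dots> = (\<Sum>(x, y)\<in>P. - g x y)"
    by (rule sum.cong) (auto simp: P_def intro!: anti)
  finally show ?thesis
    by (simp add: case_prod_unfold sum_negf)
qed

definition down_closed :: "'x set set \<Rightarrow> bool" where
  "down_closed X \<longleftrightarrow> (\<forall>\<sigma>\<in>X. \<forall>\<tau>. \<tau> \<subseteq> \<sigma> \<longrightarrow> \<tau> \<in> X)"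

lemma chain_bd:
  assumes "chain X (Suc i) c" "down_closed X"
  shows "chain X i (koszul_bd w c)"
  unfolding chain_def
proof (intro allI impI)
  fix \<tau> assume "koszul_bd w c \<tau> \<noteq> 0"
  then obtain x where x: "x \<notin> \<tau>" "c (insert x \<tau>) \<noteq> 0"
    using koszul_bd_zero by metis
  with chainD[OF assms(1)] have "insert x \<tau> \<in> X" "card (insert x \<tau>) = Suc i"
    by auto
  with x assms(2) show "\<tau> \<in> X \<and> card \<tau> = i"
    by (auto simp: down_closed_def)
qed

lemma bd_chain_0:
  assumes "chain X 0 c"
  shows "koszul_bd w c \<tau> = 0"
proof (rule koszul_bd_zero)
  fix x
  show "c (insert x \<tau>) = 0"
    using chain_zero_card[OF assms] by simp
qed

text \<open>For a difference of simplicial complexes this is vanishing of relative homology.\<close>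

definition acyclic_at :: "'k::field itself \<Rightarrow> 'x::finite set set \<Rightarrow> nat \<Rightarrow> bool" where
  "acyclic_at _ X i \<longleftrightarrow> (\<forall>c :: 'x set \<Rightarrow> 'k. chain X i c \<longrightarrow> (\<forall>\<tau>\<in>X. koszul_bd (\<lambda>_. 1) c \<tau> = 0) \<longrightarrow>
     (\<exists>e. chain X (Suc i) e \<and> (\<forall>\<sigma>\<in>X. koszul_bd (\<lambda>_. 1) e \<sigma> = c \<sigma>)))"

lemma acyclic_atD:
  fixes c :: "'x::finite set \<Rightarrow> 'k::field"
  assumes "acyclic_at TYPE('k) X i" "chain X i c" "\<And>\<tau>. \<tau> \<in> X \<Longrightarrow> koszul_bd (\<lambda>_. 1) c \<tau> = 0"
  obtains e where "chain X (Suc i) e" "\<And>\<sigma>. \<sigma> \<in> X \<Longrightarrow> koszul_bd (\<lambda>_. 1) e \<sigma> = c \<sigma>"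
  using assms unfolding acyclic_at_def by blast

lemma acyclic_at_empty: "acyclic_at TYPE('k::field) {} i"
  by (auto simp: acyclic_at_def chain_def intro!: exI[of _ "\<lambda>_. 0"])

text \<open>Exactness of the long homology sequence at its middle term. The part of \<open>c\<close>
  outside \<open>Y\<close> is bounded relatively by \<open>e\<close>; what remains of
  \<open>c\<close> after subtracting the boundary of \<open>e\<close> is supported in
  \<open>Y\<close> and bounded there.\<close>

lemma acyclic_at_extension:
  assumes X: "down_closed X" and Y: "down_closed Y" "Y \<subseteq> X"
    and sub: "acyclic_at TYPE('k::field) Y i" and quot: "acyclic_at TYPE('k) (X - Y) i"
  shows "acyclic_at TYPE('k) X i"
  unfolding acyclic_at_def
proof (intro allI impI)
  let ?bd = "koszul_bd (\<lambda>_. 1 :: 'k)"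
  fix c :: "'a set \<Rightarrow> 'k"
  assume c: "chain X i c" and cyc: "\<forall>\<tau>\<in>X. ?bd c \<tau> = 0"
  define c' where "c' \<sigma> = (if \<sigma> \<in> Y then 0 else c \<sigma>)" for \<sigma>
  \<comment> \<open>Adding vertices never leads back into \<open>Y\<close>, so at a face outside
    \<open>Y\<close> the boundary sees only the part of a chain outside \<open>Y\<close>.\<close>
  have out: "insert x \<tau> \<notin> Y" if "\<tau> \<notin> Y" for x \<tau>
    using Y(1) that by (auto simp: down_closed_def)
  have "chain (X - Y) i c'"
    using c by (auto simp: chain_def c'_def)
  moreover have "?bd c' \<tau> = 0" if "\<tau> \<in> X - Y" for \<tau>
  proof -
    have "?bd c' \<tau> = ?bd c \<tau>"
      using out that by (simp add: koszul_bd_def c'_def)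
    with cyc that show ?thesis
      by simp
  qed
  ultimately obtain e where e: "chain (X - Y) (Suc i) e"
    and bd_e: "\<And>\<sigma>. \<sigma> \<in> X - Y \<Longrightarrow> ?bd e \<sigma> = c' \<sigma>"
    using acyclic_atD[OF quot] by blast
  have eX: "chain X (Suc i) e"
    using e by (auto simp: chain_def)
  define r where "r = (\<lambda>\<sigma>. c \<sigma> - ?bd e \<sigma>)"
  have "chain Y i r"
    using c chain_bd[OF eX X, of "\<lambda>_. 1"] bd_e by (force simp: chain_def r_def c'_def)
  moreover have "?bd r \<tau> = 0" if "\<tau> \<in> Y" for \<tau>
    using cyc that Y(2) by (auto simp: r_def koszul_bd_diff koszul_bd_bd)
  ultimately obtain f where f: "chain Y (Suc i) f" and bd_f: "\<And>\<sigma>. \<sigma> \<in> Y \<Longrightarrow> ?bd f \<sigma> = r \<sigma>"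
    using acyclic_atD[OF sub] by blast
  have "chain X (Suc i) (\<lambda>\<sigma>. e \<sigma> + f \<sigma>)"
    unfolding chain_def
  proof (intro allI impI)
    fix \<sigma> assume "e \<sigma> + f \<sigma> \<noteq> 0"
    then have "e \<sigma> \<noteq> 0 \<or> f \<sigma> \<noteq> 0"
      by auto
    then show "\<sigma> \<in> X \<and> card \<sigma> = Suc i"
      using chainD[OF eX] chainD[OF f] Y(2) by blast
  qed
  moreover have "?bd (\<lambda>\<sigma>. e \<sigma> + f \<sigma>) \<sigma> = c \<sigma>" if "\<sigma> \<in> X" for \<sigma>
  proof (cases "\<sigma> \<in> Y")
    case True
    then show ?thesis
      by (simp add: koszul_bd_add bd_f r_def)
  next
    case False
    have "?bd f \<sigma> = 0"
      using chain_zero[OF f out[OF False]] by (intro koszul_bd_zero) auto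
    with False that show ?thesis
      by (simp add: koszul_bd_add bd_e c'_def)
  qed
  ultimately show "\<exists>e. chain X (Suc i) e \<and> (\<forall>\<sigma>\<in>X. ?bd e \<sigma> = c \<sigma>)"
    by blast
qed

text \<open>Joining a fixed disjoint set to every face shifts cardinalities by
  \<open>card \<zeta>\<close> and changes only signs. The premise is guarded because
  \<open>i - card \<zeta>\<close> is truncated; for smaller \<open>i\<close> there are no faces at
  all.\<close>

lemma acyclic_at_translate:
  assumes disj: "\<And>\<sigma>. \<sigma> \<in> X \<Longrightarrow> \<sigma> \<inter> \<zeta> = {}"
    and X: "card \<zeta> \<le> i \<Longrightarrow> acyclic_at TYPE('k::field) X (i - card \<zeta>)"
  shows "acyclic_at TYPE('k) ((\<lambda>\<sigma>. \<sigma> \<union> \<zeta>) ` X) i"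
  unfolding acyclic_at_def
proof (intro allI impI)
  let ?bd = "koszul_bd (\<lambda>_. 1 :: 'k)" and ?X = "(\<lambda>\<sigma>. \<sigma> \<union> \<zeta>) ` X"
  fix c :: "'a set \<Rightarrow> 'k"
  assume c: "chain ?X i c" and cyc: "\<forall>\<tau>\<in>?X. ?bd c \<tau> = 0"
  \<comment> \<open>Joining \<open>\<zeta>\<close> multiplies the incidence sign of \<open>x\<close>
    by \<open>incidence_sign x \<zeta>\<close>. The product of these factors over a face is the
    change of basis that makes \<open>transl\<close> commute with the boundaries.\<close>
  define \<epsilon> :: "'a set \<Rightarrow> 'k" where "\<epsilon> \<sigma> = (\<Prod>x\<in>\<sigma>. incidence_sign x \<zeta>)" for \<sigma>
  have eps_square: "\<epsilon> \<sigma> * \<epsilon> \<sigma> = 1" for \<sigma>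
    by (simp add: \<epsilon>_def incidence_sign_square flip: prod.distrib)
  have eps_insert: "\<epsilon> (insert x \<tau>) = incidence_sign x \<zeta> * \<epsilon> \<tau>" if "x \<notin> \<tau>" for x \<tau>
    using that by (simp add: \<epsilon>_def)
  have card_Un: "card (\<sigma> \<union> \<zeta>) = card \<sigma> + card \<zeta>" if "\<sigma> \<inter> \<zeta> = {}" for \<sigma>
    using that by (simp add: card_Un_disjoint)
  define transl where "transl c \<tau> = (if \<tau> \<inter> \<zeta> = {} then \<epsilon> \<tau> * c (\<tau> \<union> \<zeta>) else 0)"
    for c :: "'a set \<Rightarrow> 'k" and \<tau>
  have bd_transl: "?bd (transl c) \<tau> = transl (?bd c) \<tau>" if "\<tau> \<inter> \<zeta> = {}" for c \<tau>
  proof -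
    have "?bd (transl c) \<tau> = (\<Sum>x\<in>- (\<tau> \<union> \<zeta>). incidence_sign x \<tau> * transl c (insert x \<tau>))"
      unfolding koszul_bd_def by (rule sum.mono_neutral_cong_right) (auto simp: transl_def)
    also have "\<dots> = (\<Sum>x\<in>- (\<tau> \<union> \<zeta>). \<epsilon> \<tau> * (incidence_sign x (\<tau> \<union> \<zeta>) * 1 * c (insert x (\<tau> \<union> \<zeta>))))"
      using that by (intro sum.cong) (auto simp: transl_def eps_insert incidence_sign_Un)
    finally show ?thesis
      using that by (simp add: transl_def koszul_bd_def sum_distrib_left)
  qed
  show "\<exists>e. chain ?X (Suc i) e \<and> (\<forall>\<sigma>\<in>?X. ?bd e \<sigma> = c \<sigma>)"
  proof (cases "card \<zeta> \<le> i")
    case False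
    then have "c \<sigma> = 0" for \<sigma>
      using c disj card_Un by (force simp: chain_def)
    then show ?thesis
      by (intro exI[of _ "\<lambda>_. 0"]) (auto simp: chain_def koszul_bd_def)
  next
    case True
    have inX: "\<sigma> \<in> X" if "\<sigma> \<inter> \<zeta> = {}" "\<sigma> \<union> \<zeta> \<in> ?X" for \<sigma>
    proof -
      from that(2) obtain \<sigma>' where "\<sigma>' \<in> X" "\<sigma> \<union> \<zeta> = \<sigma>' \<union> \<zeta>"
        by auto
      with disj[of \<sigma>'] that(1) have "\<sigma> = \<sigma>'"
        by blast
      with \<open>\<sigma>' \<in> X\<close> show ?thesis
        by simp
    qed
    have "chain X (i - card \<zeta>) (transl c)"
      unfolding chain_def
    proof (intro allI impI)
      fix \<sigma> assume "transl c \<sigma> \<noteq> 0"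
      then have d: "\<sigma> \<inter> \<zeta> = {}" and "c (\<sigma> \<union> \<zeta>) \<noteq> 0"
        by (auto simp: transl_def split: if_splits)
      with chainD[OF c] have "\<sigma> \<union> \<zeta> \<in> ?X" "card (\<sigma> \<union> \<zeta>) = i"
        by blast+
      with inX[OF d] card_Un[OF d] show "\<sigma> \<in> X \<and> card \<sigma> = i - card \<zeta>"
        by simp
    qed
    moreover have "?bd (transl c) \<tau> = 0" if "\<tau> \<in> X" for \<tau>
      using cyc that disj[OF that] by (simp add: bd_transl) (simp add: transl_def)
    ultimately obtain e where e: "chain X (Suc (i - card \<zeta>)) e"
      and bd_e: "\<And>\<sigma>. \<sigma> \<in> X \<Longrightarrow> ?bd e \<sigma> = transl c \<sigma>"
      using acyclic_atD[OF X[OF True]] by blast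
    \<comment> \<open>The inverse of \<open>transl\<close>; the same sign serves again because
      \<open>\<epsilon>\<close> squares to 1.\<close>
    define f where "f \<sigma> = (if \<zeta> \<subseteq> \<sigma> then \<epsilon> (\<sigma> - \<zeta>) * e (\<sigma> - \<zeta>) else 0)" for \<sigma>
    have e0: "e \<sigma> = 0" if "\<sigma> \<inter> \<zeta> \<noteq> {}" for \<sigma>
      using e disj that by (auto simp: chain_def)
    have transl_f: "transl f \<sigma> = e \<sigma>" for \<sigma>
    proof (cases "\<sigma> \<inter> \<zeta> = {}")
      case True
      then have "(\<sigma> \<union> \<zeta>) - \<zeta> = \<sigma>"
        by blast
      with True show ?thesis
        by (simp add: transl_def f_def eps_square flip: mult.assoc)
    qed (simp add: transl_def e0)
    have "chain ?X (Suc i) f"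
      unfolding chain_def
    proof (intro allI impI)
      fix \<sigma> assume "f \<sigma> \<noteq> 0"
      then have *: "\<zeta> \<subseteq> \<sigma>" "e (\<sigma> - \<zeta>) \<noteq> 0"
        by (auto simp: f_def split: if_splits)
      with chainD[OF e] have "\<sigma> - \<zeta> \<in> X" "card (\<sigma> - \<zeta>) = Suc (i - card \<zeta>)"
        by auto
      moreover have "\<sigma> = (\<sigma> - \<zeta>) \<union> \<zeta>"
        using * by blast
      moreover have "card \<sigma> = card (\<sigma> - \<zeta>) + card \<zeta>"
        using * by (simp add: card_Diff_subset card_mono)
      ultimately show "\<sigma> \<in> ?X \<and> card \<sigma> = Suc i"
        using True by (simp add: image_eqI[where x = "\<sigma> - \<zeta>"])
    qed
    moreover have "?bd f (\<sigma> \<union> \<zeta>) = c (\<sigma> \<union> \<zeta>)" if "\<sigma> \<in> X" for \<sigma>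
    proof -
      have d: "\<sigma> \<inter> \<zeta> = {}"
        using disj[OF that] .
      have "\<epsilon> \<sigma> * ?bd f (\<sigma> \<union> \<zeta>) = ?bd (transl f) \<sigma>"
        using d by (simp add: bd_transl) (simp add: transl_def)
      also have "transl f = e"
        using transl_f by (rule ext)
      also have "?bd e \<sigma> = \<epsilon> \<sigma> * c (\<sigma> \<union> \<zeta>)"
        using d by (simp add: bd_e[OF that] transl_def)
      finally show ?thesis
        using eps_square[of \<sigma>] by (metis mult_cancel_left mult_zero_left zero_neq_one)
    qed
    ultimately show ?thesis
      by (intro exI[of _ f]) auto
  qed
qed

text \<open>A full simplex is a cone with apex \<open>x\<close>, and coning off a cycle bounds it.
  The vertex is essential: in \<open>Pow {}\<close> the empty face is a cycle of degree 0 and no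
  boundary.\<close>

lemma acyclic_at_Pow:
  assumes "x \<in> A"
  shows "acyclic_at TYPE('k::field) (Pow A) i"
  unfolding acyclic_at_def
proof (intro allI impI)
  let ?bd = "koszul_bd (\<lambda>_. 1 :: 'k)"
  fix c :: "'a set \<Rightarrow> 'k"
  assume c: "chain (Pow A) i c" and cyc: "\<forall>\<tau>\<in>Pow A. ?bd c \<tau> = 0"
  define e where "e \<sigma> = (if x \<in> \<sigma> then incidence_sign x (\<sigma> - {x}) * c (\<sigma> - {x}) else 0)" for \<sigma>
  have "chain (Pow A) (Suc i) e"
    unfolding chain_def
  proof (intro allI impI)
    fix \<sigma> assume "e \<sigma> \<noteq> 0"
    then have x: "x \<in> \<sigma>" and "c (\<sigma> - {x}) \<noteq> 0"
      by (auto simp: e_def split: if_splits)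
    with chainD[OF c] have "\<sigma> - {x} \<in> Pow A" "card (\<sigma> - {x}) = i"
      by blast+
    with x assms show "\<sigma> \<in> Pow A \<and> card \<sigma> = Suc i"
      using card_Suc_Diff1[of \<sigma> x] by auto
  qed
  moreover have "?bd e \<sigma> = c \<sigma>" if "\<sigma> \<in> Pow A" for \<sigma>
  proof (cases "x \<in> \<sigma>")
    case False
    have "?bd e \<sigma> = (\<Sum>y\<in>{x}. incidence_sign y \<sigma> * 1 * e (insert y \<sigma>))"
      unfolding koszul_bd_def using False
      by (intro sum.mono_neutral_right) (auto simp: e_def)
    with False show ?thesis
      by (simp add: e_def incidence_sign_square flip: mult.assoc)
  next
    case True
    define \<rho> where "\<rho> = \<sigma> - {x}"
    have \<sigma>: "\<sigma> = insert x \<rho>" "x \<notin> \<rho>"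
      using True by (auto simp: \<rho>_def)
    \<comment> \<open>For a face through the apex, the cycle condition at \<open>\<rho>\<close>
      isolates \<open>c \<sigma>\<close>; its other terms are, up to sign, those of the boundary of
      the cone.\<close>
    have "0 = ?bd c \<rho>"
      using cyc that by (auto simp: \<rho>_def)
    also have "\<dots> = incidence_sign x \<rho> * c \<sigma> + (\<Sum>y\<in>- \<sigma>. incidence_sign y \<rho> * c (insert y \<rho>))"
    proof -
      have "- \<rho> = insert x (- \<sigma>)" "x \<notin> - \<sigma>"
        using \<sigma> by auto
      then show ?thesis
        using \<sigma> by (simp add: koszul_bd_def)
    qed
    finally have *: "(\<Sum>y\<in>- \<sigma>. incidence_sign y \<rho> * c (insert y \<rho>)) = - (incidence_sign x \<rho> * c \<sigma>)"
      by (simp add: eq_neg_iff_add_eq_0 add.commute)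
    have "?bd e \<sigma> = (\<Sum>y\<in>- \<sigma>. - incidence_sign x \<rho> * (incidence_sign y \<rho> * c (insert y \<rho>)))"
      unfolding koszul_bd_def
    proof (rule sum.cong[OF refl])
      fix y assume "y \<in> - \<sigma>"
      then have y: "y \<noteq> x" "y \<notin> \<rho>"
        using \<sigma> by auto
      then have "insert y \<sigma> - {x} = insert y \<rho>"
        using \<sigma> by auto
      moreover have "incidence_sign y \<sigma> * incidence_sign x (insert y \<rho>) =
          - incidence_sign x \<rho> * (incidence_sign y \<rho> :: 'k)"
      proof -
        have "incidence_sign y \<rho> * incidence_sign x (insert y \<rho>) =
            - (incidence_sign x \<rho> * incidence_sign y (insert x \<rho>) :: 'k)"
          using y \<sigma> by (intro incidence_sign_swap) auto
        then have "incidence_sign y \<rho> * (incidence_sign y \<rho> * incidence_sign x (insert y \<rho>)) * incidence_sign y (insert x \<rho>)  =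
            - (incidence_sign y \<rho> * incidence_sign x \<rho> * (incidence_sign y (insert x \<rho>) * incidence_sign y (insert x \<rho>)) :: 'k)"
          by (simp add: algebra_simps)
        then show ?thesis
          by (simp add: incidence_sign_square \<sigma>(1) algebra_simps flip: mult.assoc)
      qed
      ultimately show "incidence_sign y \<sigma> * 1 * e (insert y \<sigma>) =
          - incidence_sign x \<rho> * (incidence_sign y \<rho> * c (insert y \<rho>))"
        using True by (simp add: e_def flip: mult.assoc)
    qed
    also have "\<dots> = - incidence_sign x \<rho> * - (incidence_sign x \<rho> * c \<sigma>)"
      by (simp only: * flip: sum_distrib_left)
    also have "\<dots> = c \<sigma>"
      by (simp add: incidence_sign_square flip: mult.assoc)
    finally show ?thesis .
  qed
  ultimately show "\<exists>e. chain (Pow A) (Suc i) e \<and> (\<forall>\<sigma>\<in>Pow A. ?bd e \<sigma> = c \<sigma>)"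
    by blast
qed

section \<open>The Koszul complex of the polynomial ring\<close>

abbreviation koszul_diff ::
  "('x::finite set \<Rightarrow> ('x, 'k::comm_ring_1) polyring) \<Rightarrow> 'x set \<Rightarrow> ('x, 'k) polyring" where
  "koszul_diff \<equiv> koszul_bd (\<lambda>x. poly_of_mon (var x))"

abbreviation simplicial_bd :: "('x::finite set \<Rightarrow> 'k::comm_ring_1) \<Rightarrow> 'x set \<Rightarrow> 'k" where
  "simplicial_bd \<equiv> koszul_bd (\<lambda>_. 1)"

section \<open>Divisibility, degrees and coefficients of monomials\<close>

lemma mon_dvd_iff: "mon_dvd s t \<longleftrightarrow> (\<forall>x. Poly_Mapping.lookup s x \<le> Poly_Mapping.lookup t x)"
proof
  assume le: "\<forall>x. Poly_Mapping.lookup s x \<le> Poly_Mapping.lookup t x"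
  then have "t = s + (t - s)"
    by (intro poly_mapping_eqI) (simp add: lookup_add lookup_minus)
  then show "mon_dvd s t"
    unfolding mon_dvd_def by blast
qed (auto simp: mon_dvd_def lookup_add)

lemma mon_dvd_add_diff: "mon_dvd s t \<Longrightarrow> s + (t - s) = t"
  by (intro poly_mapping_eqI) (simp add: mon_dvd_iff lookup_add lookup_minus)

lemma mon_dvd_diff_add: "mon_dvd s t \<Longrightarrow> (t - s) + s = t"
  using mon_dvd_add_diff by (simp add: add.commute)

lemma lookup_var: "Poly_Mapping.lookup (var x) y = (if x = y then 1 else 0)"
  by (simp add: var_def lookup_single when_def)

lemma mon_dvd_var_iff: "mon_dvd (var x) m \<longleftrightarrow> x \<in> Poly_Mapping.keys m"
  by (auto simp: mon_dvd_iff lookup_var in_keys_iff Suc_le_eq)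

lemma mon_degree_add: "mon_degree (s + t) = mon_degree s + mon_degree t"
  by (simp add: mon_degree_def lookup_add sum.distrib)

lemma mon_degree_zero [simp]: "mon_degree 0 = 0"
  by (simp add: mon_degree_def)

lemma mon_degree_var [simp]: "mon_degree (var x) = 1"
  by (simp add: mon_degree_def lookup_var)

lemma mon_degree_eq_0_iff: "mon_degree m = 0 \<longleftrightarrow> m = 0"
  by (auto simp: mon_degree_def intro: poly_mapping_eqI)

text \<open>The squarefree monomial with support \<open>\<sigma>\<close>, which is the multidegree
  of the Koszul basis element indexed by \<open>\<sigma>\<close>.\<close>

lift_definition indicator_mon :: "'x::finite set \<Rightarrow> 'x mon" is "\<lambda>\<sigma> x. if x \<in> \<sigma> then 1 else 0"
  by simp

lemma lookup_indicator_mon: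
  "Poly_Mapping.lookup (indicator_mon \<sigma>) x = (if x \<in> \<sigma> then 1 else 0)"
  by transfer simp

lemma indicator_mon_empty [simp]: "indicator_mon {} = 0"
  by (rule poly_mapping_eqI) (simp add: lookup_indicator_mon)

lemma indicator_mon_insert: "x \<notin> \<tau> \<Longrightarrow> indicator_mon (insert x \<tau>) = var x + indicator_mon \<tau>"
  by (rule poly_mapping_eqI) (auto simp: lookup_indicator_mon lookup_add lookup_var)

lemma mon_degree_indicator_mon: "mon_degree (indicator_mon \<sigma>) = card \<sigma>"
  by (simp add: mon_degree_def lookup_indicator_mon flip: sum.inter_filter)

lemma mon_dvd_indicator_mon_iff: "mon_dvd (indicator_mon \<sigma>) b \<longleftrightarrow> \<sigma> \<subseteq> Poly_Mapping.keys b"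
  by (auto simp: mon_dvd_iff lookup_indicator_mon in_keys_iff Suc_le_eq subset_iff)

lemma lookup_single_times_add:
  "Poly_Mapping.lookup (Poly_Mapping.single s c * p) (s + m) = c * Poly_Mapping.lookup p m"
  for s :: "'x mon"
  by (simp add: lookup_mult lookup_single when_mult)

lemma lookup_single_times_eq_0:
  assumes "\<not> mon_dvd s m"
  shows "Poly_Mapping.lookup (Poly_Mapping.single s c * p) m = 0"
proof -
  have "m \<noteq> s + q" for q
    using assms by (auto simp: mon_dvd_def)
  then show ?thesis
    by (simp add: lookup_mult lookup_single when_mult)
qed

lemma lookup_var_times:
  "Poly_Mapping.lookup (poly_of_mon (var x) * p) m =
    (if x \<in> Poly_Mapping.keys m then Poly_Mapping.lookup p (m - var x) else 0)"
proof (cases "x \<in> Poly_Mapping.keys m")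
  case True
  then have "m = var x + (m - var x)"
    by (simp add: mon_dvd_add_diff mon_dvd_var_iff)
  with True show ?thesis
    using lookup_single_times_add[of "var x" 1 p "m - var x"] by (simp add: poly_of_mon_def)
next
  case False
  then show ?thesis
    by (simp add: poly_of_mon_def lookup_single_times_eq_0 mon_dvd_var_iff)
qed

lemma lookup_incidence_sign_times:
  "Poly_Mapping.lookup (incidence_sign x \<tau> * p) m = incidence_sign x \<tau> * Poly_Mapping.lookup p m"
proof -
  have "Poly_Mapping.lookup ((- 1) ^ n * p) m = (- 1) ^ n * Poly_Mapping.lookup p m" for n
    by (induction n) (simp_all add: mult.assoc)
  then show ?thesis
    unfolding incidence_sign_def .
qed

text \<open>In multidegree \<open>b\<close> the coefficient at \<open>\<sigma>\<close> is a scalar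
  times the monomial \<open>b - indicator_mon \<sigma>\<close>. Keeping only the scalar removes the
  variables from the Koszul differential, which becomes the simplicial boundary.\<close>

definition mdeg_component ::
  "'x::finite mon \<Rightarrow> ('x set \<Rightarrow> ('x, 'k::comm_ring_1) polyring) \<Rightarrow> 'x set \<Rightarrow> 'k" where
  "mdeg_component b z \<sigma> = (if mon_dvd (indicator_mon \<sigma>) b
     then Poly_Mapping.lookup (z \<sigma>) (b - indicator_mon \<sigma>) else 0)"

lemma lookup_eq_mdeg_component:
  "Poly_Mapping.lookup (z \<sigma>) m = mdeg_component (m + indicator_mon \<sigma>) z \<sigma>"
  by (auto simp: mdeg_component_def mon_dvd_def add.commute)

lemma mdeg_component_koszul_diff:
  "mdeg_component b (koszul_diff z) \<tau> = simplicial_bd (mdeg_component b z) \<tau>"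
proof (cases "mon_dvd (indicator_mon \<tau>) b")
  case True
  have "Poly_Mapping.lookup (poly_of_mon (var x) * z (insert x \<tau>)) (b - indicator_mon \<tau>) =
    mdeg_component b z (insert x \<tau>)" if "x \<notin> \<tau>" for x
  proof -
    have "x \<in> Poly_Mapping.keys (b - indicator_mon \<tau>) \<longleftrightarrow> mon_dvd (indicator_mon (insert x \<tau>)) b"
      using that True
      by (auto simp: mon_dvd_indicator_mon_iff in_keys_iff lookup_minus lookup_indicator_mon)
    moreover have "b - indicator_mon \<tau> - var x = b - indicator_mon (insert x \<tau>)"
      using that by (simp add: indicator_mon_insert diff_diff_add add.commute)
    ultimately show ?thesis
      by (simp add: lookup_var_times mdeg_component_def)
  qed
  then show ?thesis
    using True
    by (simp add: koszul_bd_def lookup_sum lookup_incidence_sign_times mult.assoc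
        mdeg_component_def[of b "\<lambda>\<tau>. koszul_bd _ _ \<tau>"] mdeg_component_def[of b "koszul_bd _ _"])
next
  case False
  then have "\<not> mon_dvd (indicator_mon (insert x \<tau>)) b" for x
    by (simp add: mon_dvd_indicator_mon_iff)
  with False show ?thesis
    by (simp add: koszul_bd_def mdeg_component_def)
qed

definition koszul_complex :: "'x::finite mon set \<Rightarrow> 'x mon \<Rightarrow> 'x set set" where
  "koszul_complex M b = {\<sigma>. \<exists>m\<in>M. b = m + indicator_mon \<sigma>}"

lemma koszul_complexD: "\<sigma> \<in> koszul_complex M b \<Longrightarrow> mon_dvd (indicator_mon \<sigma>) b"
  by (auto simp: koszul_complex_def mon_dvd_def add.commute)

lemma koszul_complex_UNIV: "koszul_complex UNIV b = Pow (Poly_Mapping.keys b)"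
proof -
  have "(\<exists>m. b = m + indicator_mon \<sigma>) \<longleftrightarrow> mon_dvd (indicator_mon \<sigma>) b" for \<sigma>
    by (auto simp: mon_dvd_def add.commute)
  then show ?thesis
    by (auto simp: koszul_complex_def mon_dvd_indicator_mon_iff)
qed

text \<open>The differential preserves multidegrees, so preimages can be chosen in each multidegree
  separately and glued; lying in the complexes of \<open>M\<close> turns into the support condition
  on the coefficients.\<close>

lemma koszul_diff_lift:
  fixes z :: "'x::finite set \<Rightarrow> ('x, 'k::field) polyring"
  assumes "\<And>b. \<exists>e. chain (koszul_complex M b) (Suc i) e \<and>
    (\<forall>\<sigma>. simplicial_bd e \<sigma> = mdeg_component b z \<sigma>)"
  shows "\<exists>w. chain UNIV (Suc i) w \<and> (\<forall>\<sigma>. Poly_Mapping.keys (w \<sigma>) \<subseteq> M) \<and>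
    (\<forall>\<sigma>. koszul_diff w \<sigma> = z \<sigma>)"
proof -
  \<comment> \<open>The glued chain must have polynomial values. Choosing the zero preimage wherever
    the component of \<open>z\<close> vanishes leaves only finitely many multidegrees.\<close>
  have "\<exists>e. chain (koszul_complex M b) (Suc i) e \<and>
      (\<forall>\<sigma>. simplicial_bd e \<sigma> = mdeg_component b z \<sigma>) \<and>
      ((\<forall>\<sigma>. mdeg_component b z \<sigma> = 0) \<longrightarrow> e = (\<lambda>_. 0))" for b
  proof (cases "\<forall>\<sigma>. mdeg_component b z \<sigma> = 0")
    case True
    then show ?thesis
      by (intro exI[of _ "\<lambda>_. 0"]) (auto simp: chain_def koszul_bd_def)
  next
    case False
    then show ?thesis
      using assms[of b] by blast
  qed
  then obtain e where e: "\<And>b. chain (koszul_complex M b) (Suc i) (e b)"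
      "\<And>b \<sigma>. simplicial_bd (e b) \<sigma> = mdeg_component b z \<sigma>"
      "\<And>b. \<forall>\<sigma>. mdeg_component b z \<sigma> = 0 \<Longrightarrow> e b = (\<lambda>_. 0)"
    by metis
  define B where "B = (\<Union>\<sigma>. (\<lambda>m. m + indicator_mon \<sigma>) ` Poly_Mapping.keys (z \<sigma>))"
  have "finite B"
    by (simp add: B_def)
  have B: "b \<in> B" if "e b \<sigma> \<noteq> 0" for b \<sigma>
  proof -
    have "\<not> (\<forall>\<tau>. mdeg_component b z \<tau> = 0)"
    proof
      assume "\<forall>\<tau>. mdeg_component b z \<tau> = 0"
      from e(3)[OF this] that show False
        by simp
    qed
    then obtain \<tau> where "mdeg_component b z \<tau> \<noteq> 0"
      by blast
    then have "mon_dvd (indicator_mon \<tau>) b" "b - indicator_mon \<tau> \<in> Poly_Mapping.keys (z \<tau>)"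
      by (auto simp: mdeg_component_def in_keys_iff split: if_splits)
    then show ?thesis
      unfolding B_def by (auto simp: image_iff mon_dvd_diff_add intro!: exI[of _ \<tau>] bexI[of _ "b - indicator_mon \<tau>"])
  qed
  define w where "w \<sigma> = Abs_poly_mapping (\<lambda>m. e (m + indicator_mon \<sigma>) \<sigma>)" for \<sigma>
  have lookup_w: "Poly_Mapping.lookup (w \<sigma>) m = e (m + indicator_mon \<sigma>) \<sigma>" for \<sigma> m
  proof -
    have "{m. e (m + indicator_mon \<sigma>) \<sigma> \<noteq> 0} \<subseteq> (\<lambda>m. m + indicator_mon \<sigma>) -` B"
      using B by auto
    moreover have "finite ((\<lambda>m. m + indicator_mon \<sigma>) -` B)"
      using \<open>finite B\<close> by (rule finite_vimageI) (simp add: inj_def)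
    ultimately have "finite {m. e (m + indicator_mon \<sigma>) \<sigma> \<noteq> 0}"
      by (rule finite_subset)
    then show ?thesis
      by (simp add: w_def)
  qed
  have comp_w: "mdeg_component b w = e b" for b
  proof
    fix \<sigma>
    show "mdeg_component b w \<sigma> = e b \<sigma>"
      using chain_zero[OF e(1), of \<sigma> b] koszul_complexD[of \<sigma> M b]
      by (auto simp: mdeg_component_def lookup_w mon_dvd_diff_add)
  qed
  have "w \<sigma> = 0" if "card \<sigma> \<noteq> Suc i" for \<sigma>
    using chain_zero_card[OF e(1) that] by (intro poly_mapping_eqI) (simp add: lookup_w)
  then have "chain UNIV (Suc i) w"
    unfolding chain_def by blast
  moreover have "Poly_Mapping.keys (w \<sigma>) \<subseteq> M" for \<sigma>
  proof
    fix m assume "m \<in> Poly_Mapping.keys (w \<sigma>)"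
    then have "e (m + indicator_mon \<sigma>) \<sigma> \<noteq> 0"
      by (simp add: in_keys_iff lookup_w)
    with chainD[OF e(1)] have "\<sigma> \<in> koszul_complex M (m + indicator_mon \<sigma>)"
      by blast
    then show "m \<in> M"
      by (auto simp: koszul_complex_def)
  qed
  moreover have "koszul_diff w \<sigma> = z \<sigma>" for \<sigma>
    by (rule poly_mapping_eqI)
      (simp add: lookup_eq_mdeg_component[of z] lookup_eq_mdeg_component[of "koszul_diff w"]
        mdeg_component_koszul_diff comp_w e(2))
  ultimately show ?thesis
    by blast
qed

lemma chain_mdeg_component:
  assumes "chain UNIV i z" "\<And>\<sigma>. Poly_Mapping.keys (z \<sigma>) \<subseteq> M"
  shows "chain (koszul_complex M b) i (mdeg_component b z)"
  unfolding chain_def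
proof (intro allI impI)
  fix \<sigma> assume "mdeg_component b z \<sigma> \<noteq> 0"
  then have d: "mon_dvd (indicator_mon \<sigma>) b" "Poly_Mapping.lookup (z \<sigma>) (b - indicator_mon \<sigma>) \<noteq> 0"
    by (auto simp: mdeg_component_def split: if_splits)
  then have "z \<sigma> \<noteq> 0" "b - indicator_mon \<sigma> \<in> M"
    using assms(2)[of \<sigma>] by (auto simp: in_keys_iff)
  then show "\<sigma> \<in> koszul_complex M b \<and> card \<sigma> = i"
    using d chainD[OF assms(1)] by (auto simp: koszul_complex_def mon_dvd_diff_add
      intro!: bexI[of _ "b - indicator_mon \<sigma>"])
qed

text \<open>\<open>acyclic_at\<close> compares boundaries on \<open>X\<close> only, as relative
  homology requires. When \<open>X\<close> is down closed, boundaries of its chains stay in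
  \<open>X\<close>, so the equation holds on all sets.\<close>

lemma acyclic_at_boundary:
  fixes c :: "'x::finite set \<Rightarrow> 'k::field"
  assumes "acyclic_at TYPE('k) X i" "down_closed X" "chain X i c" "\<And>\<tau>. simplicial_bd c \<tau> = 0"
  shows "\<exists>e. chain X (Suc i) e \<and> (\<forall>\<sigma>. simplicial_bd e \<sigma> = c \<sigma>)"
proof -
  obtain e where e: "chain X (Suc i) e" "\<And>\<sigma>. \<sigma> \<in> X \<Longrightarrow> simplicial_bd e \<sigma> = c \<sigma>"
    using acyclic_atD[OF assms(1,3)] assms(4) by blast
  moreover have "simplicial_bd e \<sigma> = c \<sigma>" if "\<sigma> \<notin> X" for \<sigma>
    using that chain_zero[OF assms(3)] chain_zero[OF chain_bd[OF e(1) assms(2)]] by simp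
  ultimately show ?thesis
    by blast
qed

text \<open>The Koszul complex resolves the field. A multidegree \<open>b \<noteq> 0\<close>
  contributes the full simplex on the support of \<open>b\<close>, which is acyclic; multidegree 0
  has only the empty face, so the constant coefficient of \<open>z {}\<close> is the sole
  obstruction.\<close>

lemma koszul_exact:
  fixes z :: "'x::finite set \<Rightarrow> ('x, 'k::field) polyring"
  assumes z: "chain UNIV i z" "\<And>\<tau>. koszul_diff z \<tau> = 0"
    and const: "Poly_Mapping.lookup (z {}) 0 = 0"
  shows "\<exists>w. chain UNIV (Suc i) w \<and> (\<forall>\<sigma>. koszul_diff w \<sigma> = z \<sigma>)"
proof -
  have "\<exists>e. chain (koszul_complex UNIV b) (Suc i) e \<and>
      (\<forall>\<sigma>. simplicial_bd e \<sigma> = mdeg_component b z \<sigma>)" for b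
  proof (cases "b = 0")
    case True
    have "mdeg_component 0 z \<sigma> = 0" for \<sigma>
      using const by (cases "\<sigma> = {}") (simp_all add: mdeg_component_def mon_dvd_indicator_mon_iff)
    with True show ?thesis
      by (intro exI[of _ "\<lambda>_. 0"]) (simp add: chain_def koszul_bd_def)
  next
    case False
    then obtain x where "x \<in> Poly_Mapping.keys b"
      by (metis ex_in_conv keys_eq_empty)
    then have "acyclic_at TYPE('k) (koszul_complex UNIV b) i"
      unfolding koszul_complex_UNIV by (rule acyclic_at_Pow)
    moreover have "down_closed (koszul_complex UNIV b)"
      by (auto simp: koszul_complex_UNIV down_closed_def)
    moreover have "chain (koszul_complex UNIV b) i (mdeg_component b z)"
      by (rule chain_mdeg_component[OF z(1)]) simp
    moreover have "simplicial_bd (mdeg_component b z) \<tau> = 0" for \<tau>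
      using z(2) by (simp add: mdeg_component_def flip: mdeg_component_koszul_diff)
    ultimately show ?thesis
      by (rule acyclic_at_boundary)
  qed
  from koszul_diff_lift[OF this] show ?thesis
    by blast
qed

section \<open>Homogeneous components and forms\<close>

lift_definition hom_component ::
  "nat \<Rightarrow> ('x::finite, 'k::comm_ring_1) polyring \<Rightarrow> ('x, 'k) polyring"
  is "\<lambda>d p m. if mon_degree m = d then p m else 0"
  by (erule rev_finite_subset) auto

lemma lookup_hom_component:
  "Poly_Mapping.lookup (hom_component d p) m = (if mon_degree m = d then Poly_Mapping.lookup p m else 0)"
  by transfer simp

lemma form_hom_component: "form d (hom_component d p)"
  by (auto simp: form_def in_keys_iff lookup_hom_component split: if_splits)

lemma hom_component_form: "form d p \<Longrightarrow> hom_component e p = (if d = e then p else 0)"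
  by (intro poly_mapping_eqI) (auto simp: form_def in_keys_iff lookup_hom_component)

lemma hom_component_zero [simp]: "hom_component d 0 = 0"
  by (intro poly_mapping_eqI) (simp add: lookup_hom_component)

lemma hom_component_sum: "hom_component d (\<Sum>q\<in>Q. p q) = (\<Sum>q\<in>Q. hom_component d (p q))"
  by (intro poly_mapping_eqI) (simp add: lookup_hom_component lookup_sum)

lemma hom_component_decomp:
  assumes "finite E" "mon_degree ` Poly_Mapping.keys p \<subseteq> E"
  shows "p = (\<Sum>e\<in>E. hom_component e p)"
proof (rule poly_mapping_eqI)
  fix m
  show "Poly_Mapping.lookup p m = Poly_Mapping.lookup (\<Sum>e\<in>E. hom_component e p) m"
    using assms by (auto simp: lookup_sum lookup_hom_component in_keys_iff image_subset_iff sum.delta')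
qed

lemma form_zero [simp]: "form d 0"
  by (simp add: form_def)

lemma form_add: "form d p \<Longrightarrow> form d q \<Longrightarrow> form d (p + q)"
  using keys_add[of p q] by (auto simp: form_def)

lemma form_sum: "(\<And>q. q \<in> Q \<Longrightarrow> form d (p q)) \<Longrightarrow> form d (\<Sum>q\<in>Q. p q)"
  by (induction Q rule: infinite_finite_induct) (auto intro: form_add)

lemma form_mult:
  assumes "form d p" "form e q"
  shows "form (d + e) (p * q)"
  unfolding form_def
proof
  fix m assume "m \<in> Poly_Mapping.keys (p * q)"
  then obtain a b where "m = a + b" "a \<in> Poly_Mapping.keys p" "b \<in> Poly_Mapping.keys q"
    using keys_mult[of p q] by blast
  with assms show "mon_degree m = d + e"
    by (simp add: form_def mon_degree_add)
qed

lemma form_one [simp]: "form 0 1"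
  by (simp add: form_def)

lemma form_uminus: "form d p \<Longrightarrow> form d (- p)"
  by (simp add: form_def)

lemma form_incidence_sign: "form 0 (incidence_sign x \<tau>)"
proof -
  have "form 0 ((- 1) ^ n)" for n
    by (induction n) (use form_mult[of 0 "-1" 0] form_uminus[OF form_one] in auto)
  then show ?thesis
    by (simp add: incidence_sign_def)
qed

lemma form_poly_of_mon: "form (mon_degree m) (poly_of_mon m)"
  by (simp add: form_def poly_of_mon_def)

lemma form_var: "form 1 (poly_of_mon (var x))"
  using form_poly_of_mon[of "var x"] by simp

lemma hom_component_mult:
  assumes "form e q"
  shows "hom_component d (q * p) = (if e \<le> d then q * hom_component (d - e) p else 0)"
proof -
  let ?E = "mon_degree ` Poly_Mapping.keys p"
  have "hom_component d (q * p) = (\<Sum>a\<in>?E. hom_component d (q * hom_component a p))"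
    by (subst hom_component_decomp[of ?E p])
      (simp_all add: sum_distrib_left hom_component_sum)
  also have "\<dots> = (\<Sum>a\<in>?E. if e + a = d then q * hom_component a p else 0)"
    using hom_component_form[OF form_mult[OF assms form_hom_component]] by simp
  also have "\<dots> = (if e \<le> d then q * hom_component (d - e) p else 0)"
  proof (cases "e \<le> d \<and> d - e \<in> ?E")
    case True
    then have "(\<Sum>a\<in>?E. if e + a = d then q * hom_component a p else 0) =
        (\<Sum>a\<in>?E. if a = d - e then q * hom_component a p else 0)"
      by (intro sum.cong) auto
    with True show ?thesis
      by simp
  next
    case False
    have "hom_component a p = 0" if "a \<notin> ?E" for a
      using that by (intro poly_mapping_eqI) (auto simp: lookup_hom_component in_keys_iff)
    with False show ?thesis
      by (auto intro!: sum.neutral)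
  qed
  finally show ?thesis .
qed

lemma hom_component_koszul_diff:
  "hom_component (Suc d) (koszul_diff z \<tau>) = koszul_diff (\<lambda>\<sigma>. hom_component d (z \<sigma>)) \<tau>"
  by (simp add: koszul_bd_def hom_component_sum
      hom_component_mult[OF form_mult[OF form_incidence_sign form_var]])

lemma hom_component_0_koszul_diff: "hom_component 0 (koszul_diff z \<tau>) = 0"
  by (simp add: koszul_bd_def hom_component_sum
      hom_component_mult[OF form_mult[OF form_incidence_sign form_var]])

lemma form_koszul_diff:
  assumes "\<And>\<sigma>. form d (z \<sigma>)"
  shows "form (Suc d) (koszul_diff z \<tau>)"
  unfolding koszul_bd_def
  using form_mult[OF form_mult[OF form_incidence_sign form_var] assms]
  by (intro form_sum) simp

section \<open>From linear resolutions to Koszul homology\<close>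

abbreviation vec_form :: "nat \<Rightarrow> (nat \<Rightarrow> ('x::finite, 'k::comm_ring_1) polyring) \<Rightarrow> bool" where
  "vec_form d v \<equiv> \<forall>p. form d (v p)"

definition mat_apply :: "nat \<Rightarrow> (nat \<Rightarrow> nat \<Rightarrow> 'a::comm_ring_1) \<Rightarrow> (nat \<Rightarrow> 'a) \<Rightarrow> nat \<Rightarrow> 'a" where
  "mat_apply r M u p = (\<Sum>q<r. M p q * u q)"

abbreviation mat_image :: "nat \<Rightarrow> (nat \<Rightarrow> nat \<Rightarrow> 'a::comm_ring_1) \<Rightarrow> (nat \<Rightarrow> 'a) set" where
  "mat_image r M \<equiv> range (mat_apply r M)"

text \<open>Vectors are functions on all naturals, so that modules of every rank share one type.
  Entries from \<open>r\<close> on must be forced to vanish, because \<open>mat_apply\<close> does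
  not see them.\<close>

definition mat_kernel :: "nat \<Rightarrow> (nat \<Rightarrow> nat \<Rightarrow> 'a::comm_ring_1) \<Rightarrow> (nat \<Rightarrow> 'a) set" where
  "mat_kernel r M = {u. (\<forall>q\<ge>r. u q = 0) \<and> (\<forall>p. mat_apply r M u p = 0)}"

text \<open>
  For a graded submodule \<open>N\<close> of a free module with basis in degree 0 this says that
  \<open>Tor\<^sub>i(N, k)\<close>, computed from the Koszul complex, is concentrated in degree \<open>i + d\<close>.
\<close>

definition koszul_linear ::
  "nat \<Rightarrow> (nat \<Rightarrow> ('x::finite, 'k::field) polyring) set \<Rightarrow> bool" where
  "koszul_linear d N \<longleftrightarrow> (\<forall>i e z. e \<noteq> d \<longrightarrow> (\<forall>\<sigma>. z \<sigma> \<in> N \<and> vec_form e (z \<sigma>)) \<longrightarrow>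
     (\<forall>p. chain UNIV i (\<lambda>\<sigma>. z \<sigma> p)) \<longrightarrow> (\<forall>p \<tau>. koszul_diff (\<lambda>\<sigma>. z \<sigma> p) \<tau> = 0) \<longrightarrow>
     (\<exists>w. (\<forall>\<sigma>. w \<sigma> \<in> N) \<and> (\<forall>p. chain UNIV (Suc i) (\<lambda>\<sigma>. w \<sigma> p)) \<and>
        (\<forall>p \<sigma>. koszul_diff (\<lambda>\<sigma>. w \<sigma> p) \<sigma> = z \<sigma> p)))"

lemma koszul_linearD:
  assumes "koszul_linear d N" "e \<noteq> d" "\<And>\<sigma>. z \<sigma> \<in> N" "\<And>\<sigma> p. form e (z \<sigma> p)"
    "\<And>p. chain UNIV i (\<lambda>\<sigma>. z \<sigma> p)" "\<And>p \<tau>. koszul_diff (\<lambda>\<sigma>. z \<sigma> p) \<tau> = 0"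
  obtains w where "\<And>\<sigma>. w \<sigma> \<in> N" "\<And>p. chain UNIV (Suc i) (\<lambda>\<sigma>. w \<sigma> p)"
    "\<And>p \<sigma>. koszul_diff (\<lambda>\<sigma>. w \<sigma> p) \<sigma> = z \<sigma> p"
  using assms unfolding koszul_linear_def by metis

lemma mat_apply_cong: "(\<And>q. q < r \<Longrightarrow> u q = v q) \<Longrightarrow> mat_apply r M u p = mat_apply r M v p"
  by (simp add: mat_apply_def)

lemma mat_apply_add: "mat_apply r M (\<lambda>q. u q + v q) p = mat_apply r M u p + mat_apply r M v p"
  by (simp add: mat_apply_def distrib_left sum.distrib)

lemma mat_apply_diff: "mat_apply r M (\<lambda>q. u q - v q) p = mat_apply r M u p - mat_apply r M v p"
  by (simp add: mat_apply_def right_diff_distrib sum_subtractf)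

lemma mat_apply_scale: "mat_apply r M (\<lambda>q. a * u q) p = a * mat_apply r M u p"
  by (simp add: mat_apply_def sum_distrib_left mult.left_commute)

lemma mat_apply_zero [simp]: "mat_apply r M (\<lambda>_. 0) p = 0"
  by (simp add: mat_apply_def)

lemma mat_apply_koszul_diff:
  "mat_apply r M (\<lambda>q. koszul_diff (\<lambda>\<sigma>. y \<sigma> q) \<tau>) p = koszul_diff (\<lambda>\<sigma>. mat_apply r M (y \<sigma>) p) \<tau>"
  unfolding mat_apply_def by (simp add: koszul_bd_sum koszul_bd_scale)

lemma hom_component_mat_apply:
  assumes "\<And>p q. q < r \<Longrightarrow> form d (M p q)"
  shows "hom_component e (mat_apply r M u p) =
    (if d \<le> e then mat_apply r M (\<lambda>q. hom_component (e - d) (u q)) p else 0)"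
  using assms by (auto simp: mat_apply_def hom_component_sum hom_component_mult[of d])

lemma form_mat_apply:
  assumes "\<And>p q. q < r \<Longrightarrow> form d (M p q)" "\<And>q. q < r \<Longrightarrow> form e (u q)"
  shows "form (d + e) (mat_apply r M u p)"
  unfolding mat_apply_def by (intro form_sum form_mult) (use assms in auto)

text \<open>All entries of \<open>M\<close> in use have degree \<open>d\<close>, so one homogeneous
  component of any preimage is again a preimage. The last clause, that zero lifts to zero, makes the
  facewise lift of a chain a chain again.\<close>

lemma mat_image_lift_form:
  assumes M: "\<And>p q. q < r \<Longrightarrow> form d (M p q)" and v: "v \<in> mat_image r M" "vec_form e v"
  shows "e < d \<Longrightarrow> v p = 0"
    and "d \<le> e \<Longrightarrow> \<exists>u. v = mat_apply r M u \<and> vec_form (e - d) u \<and> (\<forall>q\<ge>r. u q = 0) \<and>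
      ((\<forall>p. v p = 0) \<longrightarrow> u = (\<lambda>_. 0))"
proof -
  obtain u where u: "v = mat_apply r M u"
    using v(1) by blast
  have *: "v p = (if d \<le> e then mat_apply r M (\<lambda>q. hom_component (e - d) (u q)) p else 0)" for p
    using hom_component_mat_apply[of r d M e u p, OF M] v(2)
    by (metis hom_component_form u)
  then show "e < d \<Longrightarrow> v p = 0"
    by simp
  assume de: "d \<le> e"
  show "\<exists>u. v = mat_apply r M u \<and> vec_form (e - d) u \<and> (\<forall>q\<ge>r. u q = 0) \<and>
      ((\<forall>p. v p = 0) \<longrightarrow> u = (\<lambda>_. 0))"
  proof (cases "\<forall>p. v p = 0")
    case True
    then show ?thesis
      by (intro exI[of _ "\<lambda>_. 0"]) auto
  next
    case False
    have "v = mat_apply r M (\<lambda>q. if q < r then hom_component (e - d) (u q) else 0)"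
    proof
      fix p
      have "v p = mat_apply r M (\<lambda>q. hom_component (e - d) (u q)) p"
        using * de by simp
      also have "\<dots> = mat_apply r M (\<lambda>q. if q < r then hom_component (e - d) (u q) else 0) p"
        by (rule mat_apply_cong) simp
      finally show "v p = \<dots>" .
    qed
    with False show ?thesis
      by (intro exI[of _ "\<lambda>q. if q < r then hom_component (e - d) (u q) else 0"])
        (auto simp: form_hom_component)
  qed
qed

lemma chain_vec_lift:
  assumes "\<And>p. chain UNIV i (\<lambda>\<sigma>. z \<sigma> p)" "\<And>\<sigma>. (\<forall>p. z \<sigma> p = 0) \<Longrightarrow> u \<sigma> = (\<lambda>_. 0)"
  shows "chain UNIV i (\<lambda>\<sigma>. u \<sigma> q)"
  unfolding chain_def
proof (intro allI impI)
  fix \<sigma> assume nz: "u \<sigma> q \<noteq> 0"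
  have "\<not> (\<forall>p. z \<sigma> p = 0)"
  proof
    assume "\<forall>p. z \<sigma> p = 0"
    from assms(2)[OF this] nz show False
      by simp
  qed
  then obtain p where "z \<sigma> p \<noteq> 0"
    by blast
  with chainD[OF assms(1)] show "\<sigma> \<in> UNIV \<and> card \<sigma> = i"
    by blast
qed

lemma chain_mat_apply:
  assumes "\<And>q. chain UNIV i (\<lambda>\<sigma>. y \<sigma> q)"
  shows "chain UNIV i (\<lambda>\<sigma>. mat_apply r M (y \<sigma>) p)"
  unfolding chain_def
proof (intro allI impI)
  fix \<sigma> assume "mat_apply r M (y \<sigma>) p \<noteq> 0"
  then obtain q where "y \<sigma> q \<noteq> 0"
    unfolding mat_apply_def by (metis (no_types, lifting) mult_zero_right sum.neutral)
  with chainD[OF assms] show "\<sigma> \<in> UNIV \<and> card \<sigma> = i"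
    by blast
qed

text \<open>The lift \<open>y\<close> of \<open>z\<close> need not be a cycle, but \<open>w\<close>
  has the same boundary and is killed by \<open>M\<close>. Hence \<open>y - w\<close> is a cycle in
  each coordinate, is bounded by \<open>koszul_exact\<close>, and applying \<open>M\<close> to what
  bounds it yields the claim.\<close>

lemma mat_image_boundary:
  fixes M :: "nat \<Rightarrow> nat \<Rightarrow> ('x::finite, 'k::field) polyring"
  assumes y: "\<And>\<sigma>. z \<sigma> = mat_apply r M (y \<sigma>)" "\<And>q. chain UNIV i (\<lambda>\<sigma>. y \<sigma> q)"
    and w: "\<And>\<sigma>. w \<sigma> \<in> mat_kernel r M" "\<And>q. chain UNIV i (\<lambda>\<sigma>. w \<sigma> q)"
      "\<And>q \<tau>. koszul_diff (\<lambda>\<sigma>. w \<sigma> q) \<tau> = koszul_diff (\<lambda>\<sigma>. y \<sigma> q) \<tau>"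
    and const: "\<And>q. Poly_Mapping.lookup (y {} q - w {} q) 0 = 0"
  shows "\<exists>v. (\<forall>\<sigma>. v \<sigma> \<in> mat_image r M) \<and> (\<forall>p. chain UNIV (Suc i) (\<lambda>\<sigma>. v \<sigma> p)) \<and>
        (\<forall>p \<sigma>. koszul_diff (\<lambda>\<sigma>. v \<sigma> p) \<sigma> = z \<sigma> p)"
proof -
  have "\<exists>v. chain UNIV (Suc i) v \<and> (\<forall>\<sigma>. koszul_diff v \<sigma> = y \<sigma> q - w \<sigma> q)" for q
  proof (rule koszul_exact)
    show "chain UNIV i (\<lambda>\<sigma>. y \<sigma> q - w \<sigma> q)"
      using y(2)[of q] w(2)[of q] unfolding chain_def by (metis diff_zero)
    show "koszul_diff (\<lambda>\<sigma>. y \<sigma> q - w \<sigma> q) \<tau> = 0" for \<tau>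
      by (simp add: koszul_bd_diff w(3))
    show "Poly_Mapping.lookup (y {} q - w {} q) 0 = 0"
      by (rule const)
  qed
  then obtain v where v: "\<And>q. chain UNIV (Suc i) (v q)"
    "\<And>q \<sigma>. koszul_diff (v q) \<sigma> = y \<sigma> q - w \<sigma> q"
    by metis
  define V where "V \<sigma> = mat_apply r M (\<lambda>q. v q \<sigma>)" for \<sigma>
  have "V \<sigma> \<in> mat_image r M" for \<sigma>
    by (simp add: V_def)
  moreover have "chain UNIV (Suc i) (\<lambda>\<sigma>. V \<sigma> p)" for p
    unfolding V_def by (rule chain_mat_apply) (simp add: v(1))
  moreover have "koszul_diff (\<lambda>\<sigma>. V \<sigma> p) \<tau> = z \<tau> p" for p \<tau>
  proof -
    have "koszul_diff (\<lambda>\<sigma>. V \<sigma> p) \<tau> = mat_apply r M (\<lambda>q. koszul_diff (v q) \<tau>) p"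
      using mat_apply_koszul_diff[of r M "\<lambda>\<sigma> q. v q \<sigma>" \<tau> p] by (simp add: V_def)
    also have "\<dots> = z \<tau> p - mat_apply r M (w \<tau>) p"
      by (simp add: v(2) mat_apply_diff y(1))
    finally show ?thesis
      using w(1)[of \<tau>] by (simp add: mat_kernel_def)
  qed
  ultimately show ?thesis
    by blast
qed

text \<open>
  A cycle is lifted to the free cover; the boundary of the lift is a cycle of the next syzygy
  module, of one homological degree less.
\<close>

lemma resolution_cycle_boundary:
  fixes M :: "nat \<Rightarrow> nat \<Rightarrow> nat \<Rightarrow> ('x::finite, 'k::field) polyring"
  assumes forms: "\<And>s p q. q < r s \<Longrightarrow> form (\<delta> s) (M s p q)"
    and delta: "\<And>s. \<delta> (Suc s) = 1"
    and exact: "\<And>s. mat_kernel (r s) (M s) = mat_image (r (Suc s)) (M (Suc s))"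
    and e: "e \<noteq> \<delta> s"
    and z: "\<And>\<sigma>. z \<sigma> \<in> mat_image (r s) (M s)" "\<And>\<sigma> p. form e (z \<sigma> p)"
      "\<And>p. chain UNIV i (\<lambda>\<sigma>. z \<sigma> p)" "\<And>p \<tau>. koszul_diff (\<lambda>\<sigma>. z \<sigma> p) \<tau> = 0"
  shows "\<exists>w. (\<forall>\<sigma>. w \<sigma> \<in> mat_image (r s) (M s)) \<and> (\<forall>p. chain UNIV (Suc i) (\<lambda>\<sigma>. w \<sigma> p)) \<and>
        (\<forall>p \<sigma>. koszul_diff (\<lambda>\<sigma>. w \<sigma> p) \<sigma> = z \<sigma> p)"
  using e z
proof (induction i arbitrary: e s z)
  case (0 e s z)
  show ?case
  proof (cases "e < \<delta> s")
    case True
    then have z0: "z \<sigma> p = 0" for \<sigma> p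
      using mat_image_lift_form(1)[OF forms "0.prems"(2)] "0.prems"(3) by blast
    \<comment> \<open>Below the degree of the columns the cycle vanishes, so it serves as its own
      preimage.\<close>
    show ?thesis
      by (intro exI[of _ z]) (use "0.prems" z0 in \<open>auto simp: chain_def\<close>)
  next
    case False
    then have de: "\<delta> s \<le> e"
      by simp
    have "\<exists>u. z \<sigma> = mat_apply (r s) (M s) u \<and> vec_form (e - \<delta> s) u \<and> (\<forall>q\<ge>r s. u q = 0) \<and>
      ((\<forall>p. z \<sigma> p = 0) \<longrightarrow> u = (\<lambda>_. 0))" for \<sigma>
      using mat_image_lift_form(2)[OF forms "0.prems"(2) _ de] "0.prems"(3) by blast
    then obtain y where y: "\<And>\<sigma>. z \<sigma> = mat_apply (r s) (M s) (y \<sigma>)"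
      "\<And>\<sigma>. vec_form (e - \<delta> s) (y \<sigma>)" "\<And>\<sigma>. (\<forall>p. z \<sigma> p = 0) \<Longrightarrow> y \<sigma> = (\<lambda>_. 0)"
      by metis
    have chain_y: "chain UNIV 0 (\<lambda>\<sigma>. y \<sigma> q)" for q
      by (rule chain_vec_lift[OF "0.prems"(4) y(3)])
    \<comment> \<open>Here \<open>e \<noteq> \<delta> s\<close> enters: the lift has positive degree
      \<open>e - \<delta> s\<close>, hence no constant term.\<close>
    have "Poly_Mapping.lookup (y {} q) 0 = 0" for q
      using y(2)[of "{}"] False "0.prems"(1) by (force simp: form_def in_keys_iff)
    with y(1) chain_y show ?thesis
      by (intro mat_image_boundary[where y = y and w = "\<lambda>_ _. 0"])
        (auto simp: mat_kernel_def chain_def bd_chain_0[OF chain_y] koszul_bd_zero)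
  qed
next
  case (Suc i e s z)
  show ?case
  proof (cases "e < \<delta> s")
    case True
    then have z0: "z \<sigma> p = 0" for \<sigma> p
      using mat_image_lift_form(1)[OF forms Suc.prems(2)] Suc.prems(3) by blast
    show ?thesis
      by (intro exI[of _ z]) (use Suc.prems z0 in \<open>auto simp: chain_def\<close>)
  next
    case False
    then have de: "\<delta> s \<le> e"
      by simp
    have "\<exists>u. z \<sigma> = mat_apply (r s) (M s) u \<and> vec_form (e - \<delta> s) u \<and> (\<forall>q\<ge>r s. u q = 0) \<and>
      ((\<forall>p. z \<sigma> p = 0) \<longrightarrow> u = (\<lambda>_. 0))" for \<sigma>
      using mat_image_lift_form(2)[OF forms Suc.prems(2) _ de] Suc.prems(3) by blast
    then obtain y where y: "\<And>\<sigma>. z \<sigma> = mat_apply (r s) (M s) (y \<sigma>)"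
      "\<And>\<sigma>. vec_form (e - \<delta> s) (y \<sigma>)" "\<And>\<sigma> q. q \<ge> r s \<Longrightarrow> y \<sigma> q = 0"
      "\<And>\<sigma>. (\<forall>p. z \<sigma> p = 0) \<Longrightarrow> y \<sigma> = (\<lambda>_. 0)"
      by metis
    have chain_y: "chain UNIV (Suc i) (\<lambda>\<sigma>. y \<sigma> q)" for q
      by (rule chain_vec_lift[OF Suc.prems(4) y(4)])
    define t where "t \<tau> q = koszul_diff (\<lambda>\<sigma>. y \<sigma> q) \<tau>" for \<tau> q
    have "t \<tau> \<in> mat_kernel (r s) (M s)" for \<tau>
    proof -
      have "mat_apply (r s) (M s) (t \<tau>) p = koszul_diff (\<lambda>\<sigma>. z \<sigma> p) \<tau>" for p
        unfolding y(1) using mat_apply_koszul_diff[of "r s" "M s" y \<tau> p]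
        by (simp add: t_def[abs_def])
      then show ?thesis
        using Suc.prems(5) by (auto simp: mat_kernel_def t_def y(3) koszul_bd_zero)
    qed
    then have "t \<tau> \<in> mat_image (r (Suc s)) (M (Suc s))" for \<tau>
      by (simp add: exact)
    \<comment> \<open>The Koszul differential gains one degree. As \<open>e\<close> exceeds
      \<open>\<delta> s\<close>, the degree of \<open>t\<close> again misses the generating degree,
      now 1, of the next syzygies.\<close>
    moreover have "Suc (e - \<delta> s) \<noteq> \<delta> (Suc s)"
      using Suc.prems(1) de by (simp add: delta)
    moreover have "form (Suc (e - \<delta> s)) (t \<tau> q)" for \<tau> q
      unfolding t_def by (rule form_koszul_diff) (simp add: y(2))
    moreover have "chain UNIV i (\<lambda>\<tau>. t \<tau> q)" for q
      unfolding t_def by (rule chain_bd[OF chain_y]) (simp add: down_closed_def)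
    moreover have "koszul_diff (\<lambda>\<tau>. t \<tau> q) \<tau> = 0" for q \<tau>
      unfolding t_def by (rule koszul_bd_bd)
    ultimately obtain w where w: "\<And>\<sigma>. w \<sigma> \<in> mat_image (r (Suc s)) (M (Suc s))"
      "\<And>q. chain UNIV (Suc i) (\<lambda>\<sigma>. w \<sigma> q)" "\<And>q \<sigma>. koszul_diff (\<lambda>\<sigma>. w \<sigma> q) \<sigma> = t \<sigma> q"
      using Suc.IH[of "Suc (e - \<delta> s)" "Suc s" t] by metis
    \<comment> \<open>In positive homological degree the empty face carries nothing, so the
      obstruction by constant terms is absent.\<close>
    have "y {} q = 0" "w {} q = 0" for q
      using chain_zero_card[OF chain_y, of "{}" q] chain_zero_card[OF w(2), of "{}" q] by simp_all
    with y(1) chain_y w show ?thesis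
      by (intro mat_image_boundary[where y = y and w = w]) (auto simp: t_def exact)
  qed
qed

lemma koszul_linear_of_resolution:
  fixes M :: "nat \<Rightarrow> nat \<Rightarrow> nat \<Rightarrow> ('x::finite, 'k::field) polyring"
  assumes "\<And>s p q. q < r s \<Longrightarrow> form (\<delta> s) (M s p q)" "\<And>s. \<delta> (Suc s) = 1"
    and "\<And>s. mat_kernel (r s) (M s) = mat_image (r (Suc s)) (M (Suc s))"
  shows "koszul_linear (\<delta> s) (mat_image (r s) (M s))"
  unfolding koszul_linear_def
proof (intro allI impI)
  fix i e and z :: "'x set \<Rightarrow> nat \<Rightarrow> ('x, 'k) polyring"
  assume "e \<noteq> \<delta> s" "\<forall>\<sigma>. z \<sigma> \<in> mat_image (r s) (M s) \<and> vec_form e (z \<sigma>)"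
    "\<forall>p. chain UNIV i (\<lambda>\<sigma>. z \<sigma> p)" "\<forall>p \<tau>. koszul_diff (\<lambda>\<sigma>. z \<sigma> p) \<tau> = 0"
  then show "\<exists>w. (\<forall>\<sigma>. w \<sigma> \<in> mat_image (r s) (M s)) \<and>
      (\<forall>p. chain UNIV (Suc i) (\<lambda>\<sigma>. w \<sigma> p)) \<and>
      (\<forall>p \<sigma>. koszul_diff (\<lambda>\<sigma>. w \<sigma> p) \<sigma> = z \<sigma> p)"
    by (intro resolution_cycle_boundary[where r = r and M = M and \<delta> = \<delta>, OF assms]) auto
qed

section \<open>From Koszul homology to linear resolutions\<close>

text \<open>The same \<open>e\<close> is used in all coordinates because the basis of each ambient
  free module is regarded as lying in degree 0; the twists of a resolution are carried by the
  degrees of the matrix entries.\<close>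

definition graded_submodule ::
  "nat \<Rightarrow> (nat \<Rightarrow> ('x::finite, 'k::comm_ring_1) polyring) set \<Rightarrow> bool" where
  "graded_submodule R N \<longleftrightarrow>
     (\<forall>u\<in>N. \<forall>v\<in>N. (\<lambda>p. u p + v p) \<in> N) \<and> (\<forall>a. \<forall>v\<in>N. (\<lambda>p. a * v p) \<in> N) \<and>
     (\<lambda>_. 0) \<in> N \<and> (\<forall>e. \<forall>v\<in>N. (\<lambda>p. hom_component e (v p)) \<in> N) \<and>
     (\<forall>v\<in>N. \<forall>p\<ge>R. v p = 0)"

lemma graded_submoduleD:
  assumes "graded_submodule R N"
  shows "u \<in> N \<Longrightarrow> v \<in> N \<Longrightarrow> (\<lambda>p. u p + v p) \<in> N" "v \<in> N \<Longrightarrow> (\<lambda>p. a * v p) \<in> N"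
    "(\<lambda>_. 0) \<in> N" "v \<in> N \<Longrightarrow> (\<lambda>p. hom_component e (v p)) \<in> N"
    "v \<in> N \<Longrightarrow> p \<ge> R \<Longrightarrow> v p = 0"
  using assms by (simp_all add: graded_submodule_def)

lemma graded_submodule_sum:
  assumes "graded_submodule R N" "\<And>x. x \<in> X \<Longrightarrow> v x \<in> N"
  shows "(\<lambda>p. \<Sum>x\<in>X. v x p) \<in> N"
  using assms(2)
proof (induction X rule: infinite_finite_induct)
  case (insert x X)
  then have "v x \<in> N" "(\<lambda>p. \<Sum>x\<in>X. v x p) \<in> N"
    by auto
  then have "(\<lambda>p. v x p + (\<Sum>x\<in>X. v x p)) \<in> N"
    by (rule graded_submoduleD(1)[OF assms(1)])
  with insert.hyps show ?case
    by simp
qed (use assms(1) in \<open>auto simp: graded_submodule_def\<close>)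

section \<open>Vectors of forms as finite-dimensional spaces over the field\<close>

lemma finite_mon_degree: "finite {m :: 'x::finite mon. mon_degree m = d}"
proof -
  have "Poly_Mapping.lookup ` {m :: 'x mon. mon_degree m = d} \<subseteq> (\<Pi>\<^sub>E x\<in>UNIV. {..d})"
  proof clarify
    fix m :: "'x mon" assume "d = mon_degree m"
    then show "Poly_Mapping.lookup m \<in> (\<Pi>\<^sub>E x\<in>UNIV. {..mon_degree m})"
      unfolding mon_degree_def by (auto intro: member_le_sum)
  qed
  then have "finite (Poly_Mapping.lookup ` {m :: 'x mon. mon_degree m = d})"
    by (rule finite_subset) (intro finite_PiE; simp)
  then show ?thesis
    by (rule finite_imageD) (auto simp: inj_on_def intro: poly_mapping_eqI)
qed

lemma sum_fun_apply: "(\<Sum>x\<in>X. f x) p = (\<Sum>x\<in>X. f x p)"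
  by (induction X rule: infinite_finite_induct) auto

lemma single_times_single_1:
  "Poly_Mapping.single 0 c * Poly_Mapping.single m 1 = Poly_Mapping.single m (c :: 'k::comm_ring_1)"
  for m :: "'x mon"
  by (simp add: mult_single)

lemma form_expansion:
  assumes "form d p"
  shows "p = (\<Sum>m | mon_degree m = d. Poly_Mapping.single 0 (Poly_Mapping.lookup p m) * Poly_Mapping.single m 1)"
proof (rule poly_mapping_eqI)
  fix k
  have "Poly_Mapping.lookup (\<Sum>m | mon_degree m = d. Poly_Mapping.single 0 (Poly_Mapping.lookup p m) * Poly_Mapping.single m 1) k
      = (\<Sum>m | mon_degree m = d. if m = k then Poly_Mapping.lookup p m else 0)"
    by (simp add: lookup_sum single_times_single_1 lookup_single when_def)
  also have "\<dots> = Poly_Mapping.lookup p k"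
    using assms by (auto simp: finite_mon_degree form_def in_keys_iff)
  finally show "Poly_Mapping.lookup p k = Poly_Mapping.lookup (\<Sum>m | mon_degree m = d. Poly_Mapping.single 0 (Poly_Mapping.lookup p m) * Poly_Mapping.single m 1) k"
    by simp
qed

text \<open>The constants \<open>Poly_Mapping.single 0 c\<close> act as scalars, and vectors of
  forms of degree \<open>d\<close> supported below \<open>R\<close> lie in a finite-dimensional
  space. A maximal independent subset of \<open>V\<close> gives the columns; their independence over
  the field later excludes constant syzygies.\<close>

lemma form_space_basis:
  fixes V :: "(nat \<Rightarrow> ('x::finite, 'k::field) polyring) set"
  assumes form: "\<And>v. v \<in> V \<Longrightarrow> vec_form d v" and bound: "\<And>v p. v \<in> V \<Longrightarrow> p \<ge> R \<Longrightarrow> v p = 0"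
  shows "\<exists>r M. (\<forall>q<r. (\<lambda>p. M p q) \<in> V) \<and>
    (\<forall>v\<in>V. \<exists>c. v = mat_apply r M (\<lambda>q. Poly_Mapping.single 0 (c q))) \<and>
    (\<forall>c. (\<forall>p. mat_apply r M (\<lambda>q. Poly_Mapping.single 0 (c q)) p = 0) \<longrightarrow> (\<forall>q<r. c q = 0))"
proof -
  interpret vs: vector_space "\<lambda>c (v :: nat \<Rightarrow> ('x, 'k) polyring) p. Poly_Mapping.single 0 c * v p"
    by unfold_locales
      (simp_all add: fun_eq_iff distrib_left distrib_right single_add mult_single flip: mult.assoc)
  define t where "t p m = (\<lambda>p'. if p' = p then Poly_Mapping.single m 1 else (0 :: ('x, 'k) polyring))"
    for p :: nat and m :: "'x mon"
  define T where "T = (\<lambda>(p, m). t p m) ` ({..<R} \<times> {m. mon_degree m = d})"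
  have "finite T"
    by (simp add: T_def finite_mon_degree)
  have "v \<in> vs.span T" if "v \<in> V" for v
  proof -
    have "v = (\<Sum>p<R. \<Sum>m | mon_degree m = d.
        (\<lambda>p'. Poly_Mapping.single 0 (Poly_Mapping.lookup (v p) m) * t p m p'))"
    proof
      fix p'
      have "v p' = (\<Sum>p<R. if p = p' then v p' else 0)"
        using bound[OF that, of p'] by (auto simp: not_less)
      also have "\<dots> = (\<Sum>p<R. \<Sum>m | mon_degree m = d.
          Poly_Mapping.single 0 (Poly_Mapping.lookup (v p) m) * t p m p')"
        using form_expansion[of d "v p'"] form[OF that] by (intro sum.cong) (auto simp: t_def)
      finally show "v p' = (\<Sum>p<R. \<Sum>m | mon_degree m = d.
          (\<lambda>p'. Poly_Mapping.single 0 (Poly_Mapping.lookup (v p) m) * t p m p')) p'"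
        by (simp add: sum_fun_apply)
    qed
    moreover have "\<dots> \<in> vs.span T"
      by (intro vs.span_sum vs.span_scale vs.span_base) (auto simp: T_def)
    ultimately show ?thesis
      by simp
  qed
  then have VT: "V \<subseteq> vs.span T"
    by blast
  obtain B where B: "B \<subseteq> V" "vs.independent B" "V \<subseteq> vs.span B"
    using vs.maximal_independent_subset by blast
  have "finite B"
    using vs.independent_span_bound[OF \<open>finite T\<close> B(2)] B(1) VT by blast
  then obtain b where b: "bij_betw b {0..<card B} B"
    using ex_bij_betw_nat_finite by blast
  define r where "r = card B"
  define M where "M p q = b q p" for p q
  have b': "bij_betw b {..<r} B"
    using b by (simp add: r_def lessThan_atLeast0)
  have comb: "mat_apply r M (\<lambda>q. Poly_Mapping.single 0 (u (b q))) =
      (\<Sum>v\<in>B. (\<lambda>p. Poly_Mapping.single 0 (u v) * v p))" for u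
    using sum.reindex_bij_betw[OF b', of "\<lambda>v. Poly_Mapping.single 0 (u v) * v _"]
    by (auto simp: fun_eq_iff mat_apply_def M_def sum_fun_apply mult.commute)
  have "(\<lambda>p. M p q) \<in> V" if "q < r" for q
    using that bij_betwE[OF b'] B(1) by (auto simp: M_def)
  moreover have "\<exists>c. v = mat_apply r M (\<lambda>q. Poly_Mapping.single 0 (c q))" if "v \<in> V" for v
  proof -
    have "v \<in> range (\<lambda>u. \<Sum>w\<in>B. (\<lambda>p. Poly_Mapping.single 0 (u w) * w p))"
      using that B(3) unfolding vs.span_finite[OF \<open>finite B\<close>] by (rule rev_subsetD)
    then obtain u where "v = (\<Sum>w\<in>B. (\<lambda>p. Poly_Mapping.single 0 (u w) * w p))"
      by (rule rangeE)
    then show ?thesis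
      by (intro exI[of _ "\<lambda>q. u (b q)"]) (simp only: comb)
  qed
  moreover have "\<forall>q<r. c q = 0"
    if c: "\<forall>p. mat_apply r M (\<lambda>q. Poly_Mapping.single 0 (c q)) p = 0" for c
  proof -
    define u where "u v = c (inv_into {..<r} b v)" for v
    have cu: "c q = u (b q)" if "q < r" for q
      using that b' by (simp add: u_def bij_betw_def inv_into_f_f)
    have "mat_apply r M (\<lambda>q. Poly_Mapping.single 0 (u (b q))) = 0"
      using c by (auto simp: mat_apply_def cu fun_eq_iff)
    then have "(\<Sum>v\<in>B. (\<lambda>p. Poly_Mapping.single 0 (u v) * v p)) = 0"
      by (simp add: comb)
    then have "\<forall>v\<in>B. u v = 0"
      using B(2) unfolding vs.dependent_finite[OF \<open>finite B\<close>] by blast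
    then show ?thesis
      using cu bij_betwE[OF b'] by auto
  qed
  ultimately show ?thesis
    by blast
qed

text \<open>\<open>Tor_0\<close> concentrated in degree \<open>d\<close> means generation in degree
  \<open>d\<close>. A homogeneous element of another degree, placed on the empty face, is a 0-cycle;
  being a boundary, it is a combination of variables with coefficients in \<open>N\<close> of degree
  one less, and induction on the degree applies.\<close>

lemma koszul_linear_generated:
  fixes N :: "(nat \<Rightarrow> ('x::finite, 'k::field) polyring) set"
  assumes N: "graded_submodule R N" "koszul_linear d N"
    and gen: "\<And>v. v \<in> N \<Longrightarrow> vec_form d v \<Longrightarrow> v \<in> mat_image r M"
    and v: "v \<in> N"
  shows "v \<in> mat_image r M"
proof -
  have im_sum: "(\<lambda>p. \<Sum>x\<in>X. u x p) \<in> mat_image r M" if "\<And>x. x \<in> X \<Longrightarrow> u x \<in> mat_image r M"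
    for X :: "'c set" and u
  proof -
    from that have "\<forall>x\<in>X. \<exists>y. u x = mat_apply r M y"
      by blast
    then obtain y where "\<And>x. x \<in> X \<Longrightarrow> u x = mat_apply r M (y x)"
      by metis
    then have "(\<lambda>p. \<Sum>x\<in>X. u x p) = mat_apply r M (\<lambda>q. \<Sum>x\<in>X. y x q)"
      by (auto simp: fun_eq_iff mat_apply_def sum_distrib_left intro: sum.swap)
    then show ?thesis
      by blast
  qed
  have im_scale: "(\<lambda>p. a * u p) \<in> mat_image r M" if "u \<in> mat_image r M" for a u
  proof -
    from that obtain y where "u = mat_apply r M y"
      by blast
    then have "(\<lambda>p. a * u p) = mat_apply r M (\<lambda>q. a * y q)"
      by (simp add: mat_apply_scale fun_eq_iff)
    then show ?thesis
      by blast
  qed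
  have homog: "u \<in> mat_image r M" if "u \<in> N" "vec_form e u" for e u
    using that
  proof (induction e arbitrary: u)
    case (0 u)
    show ?case
    proof (cases "d = 0")
      case False
      define z where "z \<sigma> = (if \<sigma> = {} then u else (\<lambda>_. 0))" for \<sigma> :: "'x set"
      have chain_z: "chain UNIV 0 (\<lambda>\<sigma>. z \<sigma> p)" for p
        by (auto simp: chain_def z_def)
      have "z \<sigma> \<in> N" "form 0 (z \<sigma> p)" for \<sigma> p
        using 0 N(1) by (auto simp: z_def graded_submodule_def)
      with False chain_z obtain w where w: "\<And>p \<sigma>. koszul_diff (\<lambda>\<sigma>. w \<sigma> p) \<sigma> = z \<sigma> p"
        using koszul_linearD[OF N(2), of 0 z 0] by (metis bd_chain_0)
      \<comment> \<open>A Koszul boundary has no component of degree 0, so an element of degree 0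
        that bounds is zero.\<close>
      have "u p = 0" for p
        using hom_component_0_koszul_diff[of "\<lambda>\<sigma>. w \<sigma> p" "{}"] 0(2)
          hom_component_form[of 0 "u p" 0]
        by (simp add: w z_def)
      then have "u = mat_apply r M (\<lambda>_. 0)"
        by (simp add: fun_eq_iff)
      then show ?thesis
        by blast
    qed (use 0 gen in auto)
  next
    case (Suc e u)
    show ?case
    proof (cases "d = Suc e")
      case False
      define z where "z \<sigma> = (if \<sigma> = {} then u else (\<lambda>_. 0))" for \<sigma> :: "'x set"
      have chain_z: "chain UNIV 0 (\<lambda>\<sigma>. z \<sigma> p)" for p
        by (auto simp: chain_def z_def)
      have "z \<sigma> \<in> N" "form (Suc e) (z \<sigma> p)" for \<sigma> p
        using Suc.prems N(1) by (auto simp: z_def graded_submodule_def)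
      with False chain_z obtain w where w: "\<And>\<sigma>. w \<sigma> \<in> N" "\<And>p \<sigma>. koszul_diff (\<lambda>\<sigma>. w \<sigma> p) \<sigma> = z \<sigma> p"
        using koszul_linearD[OF N(2), of "Suc e" z 0] by (metis bd_chain_0)
      have "u p = (\<Sum>x\<in>UNIV. (incidence_sign x {} * poly_of_mon (var x)) * hom_component e (w {x} p))" for p
      proof -
        have "u p = hom_component (Suc e) (koszul_diff (\<lambda>\<sigma>. w \<sigma> p) {})"
          using Suc.prems(2) hom_component_form[of "Suc e" "u p" "Suc e"] by (simp add: w z_def)
        also have "\<dots> = koszul_diff (\<lambda>\<sigma>. hom_component e (w \<sigma> p)) {}"
          by (rule hom_component_koszul_diff)
        finally show ?thesis
          by (simp add: koszul_bd_def)
      qed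
      then have "u = (\<lambda>p. \<Sum>x\<in>UNIV. (incidence_sign x {} * poly_of_mon (var x)) * hom_component e (w {x} p))"
        by blast
      moreover have "\<dots> \<in> mat_image r M"
      proof (intro im_sum im_scale Suc.IH)
        show "(\<lambda>p. hom_component e (w {x} p)) \<in> N" for x
          using N(1) w(1) by (auto simp: graded_submodule_def)
      qed (simp add: form_hom_component)
      ultimately show ?thesis
        by simp
    qed (use Suc.prems gen in auto)
  qed
  define E where "E = (\<Union>p<R. mon_degree ` Poly_Mapping.keys (v p))"
  have "finite E"
    by (simp add: E_def)
  have "v p = (\<Sum>e\<in>E. hom_component e (v p))" for p
  proof (cases "p < R")
    case True
    then show ?thesis
      by (intro hom_component_decomp[OF \<open>finite E\<close>]) (auto simp: E_def)
  next
    case False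
    then have "v p = 0"
      using N(1) v by (auto simp: graded_submodule_def)
    then show ?thesis
      by simp
  qed
  then have "v = (\<lambda>p. \<Sum>e\<in>E. hom_component e (v p))"
    by blast
  moreover have "\<dots> \<in> mat_image r M"
  proof (rule im_sum)
    fix e
    show "(\<lambda>p. hom_component e (v p)) \<in> mat_image r M"
      using graded_submoduleD(4)[OF N(1) v] by (rule homog[of _ e]) (simp add: form_hom_component)
  qed
  ultimately show ?thesis
    by simp
qed

lemma graded_submodule_kernel:
  assumes "\<And>p q. q < r \<Longrightarrow> form d (M p q)"
  shows "graded_submodule r (mat_kernel r M)"
proof -
  have "mat_apply r M (\<lambda>q. hom_component e (u q)) p = 0" if "\<forall>p. mat_apply r M u p = 0" for e u p
    using hom_component_mat_apply[where r = r and d = d and M = M and e = "e + d" and u = u and p = p, OF assms]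
      that by simp
  then show ?thesis
    by (auto simp: graded_submodule_def mat_kernel_def mat_apply_add mat_apply_scale)
qed

text \<open>One step of the resolution, with linearity inherited by dimension shifting. A cycle
  \<open>z\<close> of syzygies of degree \<open>e\<close> bounds some \<open>y\<close> in the free
  module, and \<open>M\<close> maps \<open>y\<close> to a cycle of \<open>N\<close> of degree
  \<open>d + e - 1\<close>. Something in \<open>N\<close> bounds that cycle; lifting it and
  subtracting the boundary of the lift from \<open>y\<close> gives syzygies that still bound
  \<open>z\<close>.\<close>

lemma linear_presentation:
  fixes N :: "(nat \<Rightarrow> ('x::finite, 'k::field) polyring) set"
  assumes N: "graded_submodule R N" "koszul_linear d N"
  shows "\<exists>r M. mat_image r M = N \<and> (\<forall>p q. q < r \<longrightarrow> form d (M p q)) \<and>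
    koszul_linear 1 (mat_kernel r M)"
proof -
  note ND = graded_submoduleD[OF N(1)]
  have "\<exists>r M. (\<forall>q<r. (\<lambda>p. M p q) \<in> {v \<in> N. vec_form d v}) \<and>
    (\<forall>v\<in>{v \<in> N. vec_form d v}. \<exists>c. v = mat_apply r M (\<lambda>q. Poly_Mapping.single 0 (c q))) \<and>
    (\<forall>c. (\<forall>p. mat_apply r M (\<lambda>q. Poly_Mapping.single 0 (c q)) p = 0) \<longrightarrow> (\<forall>q<r. c q = 0))"
    by (rule form_space_basis[where R = R]) (auto intro: ND)
  then obtain r M where M: "\<forall>q<r. (\<lambda>p. M p q) \<in> {v \<in> N. vec_form d v}"
      "\<forall>v\<in>{v \<in> N. vec_form d v}. \<exists>c. v = mat_apply r M (\<lambda>q. Poly_Mapping.single 0 (c q))"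
      "\<forall>c. (\<forall>p. mat_apply r M (\<lambda>q. Poly_Mapping.single 0 (c q)) p = 0) \<longrightarrow> (\<forall>q<r. c q = 0)"
    by (elim exE conjE)
  have col: "\<And>q. q < r \<Longrightarrow> (\<lambda>p. M p q) \<in> N" "\<And>p q. q < r \<Longrightarrow> form d (M p q)"
    using M(1) by simp_all
  have gen: "\<exists>c. v = mat_apply r M (\<lambda>q. Poly_Mapping.single 0 (c q))"
    if "v \<in> N" "vec_form d v" for v
    using M(2) that by simp
  have ind: "c q = 0" if "\<And>p. mat_apply r M (\<lambda>q. Poly_Mapping.single 0 (c q)) p = 0" "q < r" for c q
    using M(3) that by simp
  have "mat_apply r M u \<in> N" for u
  proof -
    have "mat_apply r M u = (\<lambda>p. \<Sum>q<r. u q * M p q)"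
      by (simp add: mat_apply_def fun_eq_iff mult.commute)
    moreover have "\<dots> \<in> N"
      by (intro graded_submodule_sum[OF N(1)] ND(2)) (simp add: col)
    ultimately show ?thesis
      by simp
  qed
  moreover have "v \<in> mat_image r M" if "v \<in> N" for v
    using gen by (intro koszul_linear_generated[OF N _ that]) blast
  ultimately have image: "mat_image r M = N"
    by blast
  have "koszul_linear 1 (mat_kernel r M)"
    unfolding koszul_linear_def
  proof (intro allI impI)
    fix i e and z :: "'x set \<Rightarrow> nat \<Rightarrow> ('x, 'k) polyring"
    assume e: "e \<noteq> 1" and z: "\<forall>\<sigma>. z \<sigma> \<in> mat_kernel r M \<and> vec_form e (z \<sigma>)"
      and chain_z: "\<forall>p. chain UNIV i (\<lambda>\<sigma>. z \<sigma> p)"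
      and cyc: "\<forall>p \<tau>. koszul_diff (\<lambda>\<sigma>. z \<sigma> p) \<tau> = 0"
    have ker: "mat_apply r M (z \<sigma>) p = 0" "q \<ge> r \<Longrightarrow> z \<sigma> q = 0" for \<sigma> p q
      using z by (auto simp: mat_kernel_def)
    \<comment> \<open>Only \<open>e = 0\<close> could obstruct: a constant syzygy is a linear
      relation over the field among the columns, which \<open>ind\<close> excludes.\<close>
    have const: "Poly_Mapping.lookup (z {} q) 0 = 0" for q
    proof (cases "e = 0 \<and> q < r")
      case True
      have zc: "z {} q = Poly_Mapping.single 0 (Poly_Mapping.lookup (z {} q) 0)" for q
      proof (rule poly_mapping_eqI)
        fix m
        show "Poly_Mapping.lookup (z {} q) m =
            Poly_Mapping.lookup (Poly_Mapping.single 0 (Poly_Mapping.lookup (z {} q) 0)) m"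
          using z True
          by (force simp: lookup_single when_def form_def in_keys_iff mon_degree_eq_0_iff)
      qed
      have "mat_apply r M (\<lambda>q. Poly_Mapping.single 0 (Poly_Mapping.lookup (z {} q) 0)) p = 0" for p
      proof -
        have "(\<lambda>q. Poly_Mapping.single 0 (Poly_Mapping.lookup (z {} q) 0)) = z {}"
          by (rule ext) (rule zc[symmetric])
        then show ?thesis
          by (simp only: ker(1))
      qed
      then show ?thesis
        using ind[of "\<lambda>q. Poly_Mapping.lookup (z {} q) 0" q] True by simp
    next
      case False
      then show ?thesis
        using z ker(2)[of q "{}"] by (force simp: form_def in_keys_iff not_less)
    qed
    have "\<exists>y. chain UNIV (Suc i) y \<and> (\<forall>\<tau>. koszul_diff y \<tau> = z \<tau> q)" for q
      using chain_z cyc const by (intro koszul_exact) auto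
    then obtain y0 where y0: "\<And>q. chain UNIV (Suc i) (y0 q)" "\<And>q \<tau>. koszul_diff (y0 q) \<tau> = z \<tau> q"
      by metis
    show "\<exists>w. (\<forall>\<sigma>. w \<sigma> \<in> mat_kernel r M) \<and> (\<forall>p. chain UNIV (Suc i) (\<lambda>\<sigma>. w \<sigma> p)) \<and>
        (\<forall>p \<sigma>. koszul_diff (\<lambda>\<sigma>. w \<sigma> p) \<sigma> = z \<sigma> p)"
    proof (cases e)
      case 0
      have "z \<sigma> q = 0" for \<sigma> q
        using hom_component_0_koszul_diff[of "y0 q" \<sigma>] z hom_component_form[of e "z \<sigma> q" e] 0
        by (simp add: y0(2))
      then show ?thesis
        by (intro exI[of _ z]) (use z in \<open>auto simp: chain_def koszul_bd_def\<close>)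
    next
      case (Suc e')
      \<comment> \<open>Cutting \<open>y0\<close> down to degree \<open>e'\<close> makes its image
        under \<open>M\<close> homogeneous of degree \<open>d + e'\<close>, which is not
        \<open>d\<close> because \<open>e \<noteq> 1\<close>. Clearing the coordinates from
        \<open>r\<close> on keeps \<open>y\<close> in the free module of rank
        \<open>r\<close>.\<close>
      define y where "y \<sigma> q = (if q < r then hom_component e' (y0 q \<sigma>) else 0)" for \<sigma> q
      have chain_y: "chain UNIV (Suc i) (\<lambda>\<sigma>. y \<sigma> q)" for q
        using y0(1)[of q] unfolding chain_def y_def by (metis hom_component_zero)
      have bd_y: "koszul_diff (\<lambda>\<sigma>. y \<sigma> q) \<tau> = z \<tau> q" for q \<tau>
      proof (cases "q < r")
        case True
        have "koszul_diff (\<lambda>\<sigma>. y \<sigma> q) \<tau> = hom_component e (koszul_diff (y0 q) \<tau>)"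
          using True by (simp add: y_def Suc hom_component_koszul_diff)
        then show ?thesis
          using z hom_component_form[of e "z \<tau> q" e] by (simp add: y0(2))
      qed (simp add: y_def ker koszul_bd_def)
      obtain w where w: "\<And>\<sigma>. w \<sigma> \<in> N" "\<And>p. chain UNIV (Suc (Suc i)) (\<lambda>\<sigma>. w \<sigma> p)"
        "\<And>p \<sigma>. koszul_diff (\<lambda>\<sigma>. w \<sigma> p) \<sigma> = mat_apply r M (y \<sigma>) p"
      proof (rule koszul_linearD[OF N(2), of "d + e'" "\<lambda>\<sigma>. mat_apply r M (y \<sigma>)" "Suc i"])
        show "d + e' \<noteq> d"
          using e Suc by simp
        show "mat_apply r M (y \<sigma>) \<in> N" for \<sigma>
          using image by blast
        show "form (d + e') (mat_apply r M (y \<sigma>) p)" for \<sigma> p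
          by (rule form_mat_apply) (auto simp: col y_def form_hom_component)
        show "chain UNIV (Suc i) (\<lambda>\<sigma>. mat_apply r M (y \<sigma>) p)" for p
          by (rule chain_mat_apply[OF chain_y])
        show "koszul_diff (\<lambda>\<sigma>. mat_apply r M (y \<sigma>) p) \<tau> = 0" for p \<tau>
          using mat_apply_koszul_diff[of r M y \<tau> p] ker(1) by (simp add: bd_y)
      qed blast
      have "\<exists>u. w \<sigma> = mat_apply r M u \<and> (\<forall>q\<ge>r. u q = 0) \<and> ((\<forall>p. w \<sigma> p = 0) \<longrightarrow> u = (\<lambda>_. 0))" for \<sigma>
      proof (cases "\<forall>p. w \<sigma> p = 0")
        case True
        then show ?thesis
          by (intro exI[of _ "\<lambda>_. 0"]) (simp add: fun_eq_iff)
      next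
        case False
        from w(1)[of \<sigma>] image obtain u where "w \<sigma> = mat_apply r M u"
          by blast
        also have "\<dots> = mat_apply r M (\<lambda>q. if q < r then u q else 0)"
          by (rule ext, rule mat_apply_cong) simp
        finally show ?thesis
          using False by (intro exI[of _ "\<lambda>q. if q < r then u q else 0"]) auto
      qed
      then obtain u where u: "\<And>\<sigma>. w \<sigma> = mat_apply r M (u \<sigma>)" "\<And>\<sigma> q. q \<ge> r \<Longrightarrow> u \<sigma> q = 0"
        "\<And>\<sigma>. (\<forall>p. w \<sigma> p = 0) \<Longrightarrow> u \<sigma> = (\<lambda>_. 0)"
        by metis
      have chain_u: "chain UNIV (Suc (Suc i)) (\<lambda>\<sigma>. u \<sigma> q)" for q
        by (rule chain_vec_lift[OF w(2) u(3)])
      define v where "v \<sigma> q = y \<sigma> q - koszul_diff (\<lambda>\<sigma>. u \<sigma> q) \<sigma>" for \<sigma> q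
      have "v \<sigma> \<in> mat_kernel r M" for \<sigma>
      proof -
        have "mat_apply r M (v \<sigma>) p = mat_apply r M (y \<sigma>) p - koszul_diff (\<lambda>\<sigma>. w \<sigma> p) \<sigma>" for p
          unfolding u(1) by (simp add: v_def[abs_def] mat_apply_diff flip: mat_apply_koszul_diff)
        then show ?thesis
          by (simp add: w(3) mat_kernel_def v_def y_def u(2) koszul_bd_def)
      qed
      moreover have "chain UNIV (Suc i) (\<lambda>\<sigma>. v \<sigma> q)" for q
        using chain_y[of q] chain_bd[OF chain_u[of q], of "\<lambda>x. poly_of_mon (var x)"]
        unfolding chain_def v_def down_closed_def by (metis UNIV_I diff_zero)
      moreover have "koszul_diff (\<lambda>\<sigma>. v \<sigma> q) \<tau> = z \<tau> q" for q \<tau>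
        by (simp add: v_def koszul_bd_diff koszul_bd_bd bd_y)
      ultimately show ?thesis
        by blast
    qed
  qed
  then show ?thesis
    using image col(2) by blast
qed

section \<open>Minimal graded free resolutions in coordinates\<close>

text \<open>An ideal as a submodule of the free module of rank 1, so that ideals and syzygy modules
  fall under the same predicates.\<close>

definition row_module :: "'a::comm_ring_1 set \<Rightarrow> (nat \<Rightarrow> 'a) set" where
  "row_module A = {v. v 0 \<in> A \<and> (\<forall>p>0. v p = 0)}"

section \<open>Dictionary between carrier vectors and zero-padded functions\<close>

definition funs_of_vecs :: "nat \<Rightarrow> 'a::comm_ring_1 vec set \<Rightarrow> (nat \<Rightarrow> 'a) set" where
  "funs_of_vecs n K = {u. (\<forall>q\<ge>n. u q = 0) \<and> vec n u \<in> K}"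

lemma vec_vec_index: "v \<in> carrier_vec n \<Longrightarrow> vec n (\<lambda>i. v $ i) = v"
  by auto

lemma funs_of_vecs_subset:
  assumes "K \<subseteq> carrier_vec n" "funs_of_vecs n K \<subseteq> funs_of_vecs n K'"
  shows "K \<subseteq> K'"
proof
  fix v assume v: "v \<in> K"
  have eq: "vec n (\<lambda>i. if i < n then v $ i else 0) = v"
    using subsetD[OF assms(1) v] by (intro eq_vecI) auto
  with v have "(\<lambda>i. if i < n then v $ i else 0) \<in> funs_of_vecs n K"
    by (simp add: funs_of_vecs_def)
  with assms(2) have "(\<lambda>i. if i < n then v $ i else 0) \<in> funs_of_vecs n K'"
    by blast
  then show "v \<in> K'"
    by (simp add: funs_of_vecs_def eq)
qed

lemma funs_of_vecs_eqD:
  assumes "K \<subseteq> carrier_vec n" "K' \<subseteq> carrier_vec n" "funs_of_vecs n K = funs_of_vecs n K'"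
  shows "K = K'"
  using assms funs_of_vecs_subset[of K n K'] funs_of_vecs_subset[of K' n K] by auto

definition represents :: "(nat \<Rightarrow> nat \<Rightarrow> 'a::comm_ring_1) \<Rightarrow> nat \<Rightarrow> nat \<Rightarrow> 'a mat \<Rightarrow> bool" where
  "represents E n m D \<longleftrightarrow> D \<in> carrier_mat n m \<and>
     (\<forall>p q. q < m \<longrightarrow> E p q = (if p < n then D $$ (p, q) else 0))"

lemma represents_mult_vec:
  assumes "represents E n m D"
  shows "D *\<^sub>v vec m u = vec n (mat_apply m E u)"
  using assms
  by (intro eq_vecI)
    (auto simp: represents_def scalar_prod_def mat_apply_def lessThan_atLeast0 intro!: sum.cong)

lemma represents_apply_zero: "represents E n m D \<Longrightarrow> p \<ge> n \<Longrightarrow> mat_apply m E u p = 0"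
  by (simp add: represents_def mat_apply_def)

lemma represents_image:
  assumes "represents E n m D"
  shows "mat_image m E = funs_of_vecs n {D *\<^sub>v w |w. w \<in> carrier_vec m}"
proof (intro equalityI subsetI)
  fix v assume "v \<in> mat_image m E"
  then obtain u where u: "v = mat_apply m E u"
    by blast
  then have "vec n v = D *\<^sub>v vec m u"
    by (simp add: represents_mult_vec[OF assms])
  moreover have "vec m u \<in> carrier_vec m"
    by simp
  ultimately show "v \<in> funs_of_vecs n {D *\<^sub>v w |w. w \<in> carrier_vec m}"
    unfolding funs_of_vecs_def using u represents_apply_zero[OF assms] by blast
next
  fix v assume "v \<in> funs_of_vecs n {D *\<^sub>v w |w. w \<in> carrier_vec m}"
  then obtain w where v: "\<forall>q\<ge>n. v q = 0" and w: "vec n v = D *\<^sub>v w" "w \<in> carrier_vec m"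
    by (auto simp: funs_of_vecs_def)
  have eq: "vec n v = vec n (mat_apply m E (\<lambda>i. w $ i))"
    unfolding w(1) represents_mult_vec[OF assms, symmetric] by (simp add: vec_vec_index w(2))
  have "v p = mat_apply m E (\<lambda>i. w $ i) p" for p
  proof (cases "p < n")
    case True
    then show ?thesis
      using arg_cong[OF eq, of "\<lambda>v. v $ p"] by simp
  next
    case False
    then show ?thesis
      using v represents_apply_zero[OF assms] by simp
  qed
  then show "v \<in> mat_image m E"
    by blast
qed

lemma represents_kernel:
  assumes "represents E n m D"
  shows "mat_kernel m E = funs_of_vecs m {v \<in> carrier_vec m. D *\<^sub>v v = 0\<^sub>v n}"
proof -
  have "vec n (mat_apply m E u) = 0\<^sub>v n \<longleftrightarrow> (\<forall>p. mat_apply m E u p = 0)" for u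
  proof
    assume eq: "vec n (mat_apply m E u) = 0\<^sub>v n"
    show "\<forall>p. mat_apply m E u p = 0"
    proof
      fix p show "mat_apply m E u p = 0"
        using arg_cong[OF eq, of "\<lambda>v. v $ p"] represents_apply_zero[OF assms, of p u]
        by (cases "p < n") auto
    qed
  qed auto
  then show ?thesis
    by (auto simp: mat_kernel_def funs_of_vecs_def represents_mult_vec[OF assms])
qed

text \<open>The augmentation onto the ideal, in the format of the differentials, so that it can be
  stage 0 of one uniform sequence of matrices.\<close>

definition row_matrix :: "'a::comm_ring_1 vec \<Rightarrow> nat \<Rightarrow> nat \<Rightarrow> 'a" where
  "row_matrix g p q = (if p = 0 then g $ q else 0)"

lemma row_matrix_apply:
  assumes "g \<in> carrier_vec m"
  shows "mat_apply m (row_matrix g) u p = (if p = 0 then scalar_prod g (vec m u) else 0)"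
  using assms by (simp add: row_matrix_def mat_apply_def scalar_prod_def lessThan_atLeast0)

lemma row_matrix_kernel:
  assumes "g \<in> carrier_vec m"
  shows "mat_kernel m (row_matrix g) = funs_of_vecs m {v \<in> carrier_vec m. scalar_prod g v = 0}"
  by (auto simp: mat_kernel_def funs_of_vecs_def row_matrix_apply[OF assms])

lemma row_matrix_image:
  assumes "g \<in> carrier_vec m"
  shows "mat_image m (row_matrix g) = row_module {scalar_prod g v |v. v \<in> carrier_vec m}"
proof (intro equalityI subsetI)
  fix v assume "v \<in> mat_image m (row_matrix g)"
  then obtain u where "v = mat_apply m (row_matrix g) u"
    by blast
  then have "v 0 = scalar_prod g (vec m u)" "\<forall>p>0. v p = 0"
    by (simp_all add: row_matrix_apply[OF assms])
  then show "v \<in> row_module {scalar_prod g v |v. v \<in> carrier_vec m}"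
    unfolding row_module_def using vec_carrier[of m u] by blast
next
  fix v assume "v \<in> row_module {scalar_prod g v |v. v \<in> carrier_vec m}"
  then obtain w where "v 0 = scalar_prod g w" "w \<in> carrier_vec m" "\<forall>p>0. v p = 0"
    by (auto simp: row_module_def)
  then have "v = mat_apply m (row_matrix g) (\<lambda>i. w $ i)"
    by (auto simp: fun_eq_iff row_matrix_apply[OF assms] vec_vec_index)
  then show "v \<in> mat_image m (row_matrix g)"
    by blast
qed

section \<open>Monomial generators, the maximal ideal and generating degrees\<close>

lemma ideal_gen_monomials:
  "ideal_gen (poly_of_mon ` M) =
    {p :: ('x::finite, 'k::comm_ring_1) polyring. \<forall>m\<in>Poly_Mapping.keys p. \<exists>m0\<in>M. mon_dvd m0 m}"
  (is "_ = ?J")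
proof (rule ring_module.span_subspace)
  show "poly_of_mon ` M \<subseteq> ?J"
    by (auto simp: poly_of_mon_def mon_dvd_iff)
  show "?J \<subseteq> ideal_gen (poly_of_mon ` M)"
  proof
    fix p assume p: "p \<in> ?J"
    have "Poly_Mapping.single m c \<in> ideal_gen (poly_of_mon ` M)" if m: "m \<in> Poly_Mapping.keys p" for m c
    proof -
      obtain m0 u where "m0 \<in> M" "m = m0 + u"
        using p m by (auto simp: mon_dvd_def)
      then have "Poly_Mapping.single m c = Poly_Mapping.single u c * poly_of_mon m0"
        by (simp add: poly_of_mon_def mult_single add.commute)
      with \<open>m0 \<in> M\<close> show ?thesis
        by (auto intro: ring_module.span_scale ring_module.span_base)
    qed
    then have "(\<Sum>m\<in>Poly_Mapping.keys p. Poly_Mapping.single m (Poly_Mapping.lookup p m))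
        \<in> ideal_gen (poly_of_mon ` M)"
      by (intro ring_module.span_sum)
    also have "(\<Sum>m\<in>Poly_Mapping.keys p. Poly_Mapping.single m (Poly_Mapping.lookup p m)) = p"
      by (rule poly_mapping_eqI) (auto simp: lookup_sum lookup_single when_def in_keys_iff)
    finally show "p \<in> ideal_gen (poly_of_mon ` M)" .
  qed
  show "ring_module.subspace ?J"
  proof (rule ring_module.subspaceI)
    show "0 \<in> ?J"
      by simp
  next
    fix p q assume "p \<in> ?J" "q \<in> ?J"
    then show "p + q \<in> ?J"
      using keys_add[of p q] by blast
  next
    fix c p assume p: "p \<in> ?J"
    have "\<exists>m0\<in>M. mon_dvd m0 m" if "m \<in> Poly_Mapping.keys (c * p)" for m
    proof -
      obtain a b where "m = a + b" "b \<in> Poly_Mapping.keys p"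
        using keys_mult[of c p] \<open>m \<in> _\<close> by blast
      moreover obtain m0 u where "m0 \<in> M" "b = m0 + u"
        using p \<open>b \<in> _\<close> by (auto simp: mon_dvd_def)
      ultimately have "m = m0 + (u + a)"
        by (simp add: ac_simps)
      with \<open>m0 \<in> M\<close> show ?thesis
        unfolding mon_dvd_def by blast
    qed
    then show "c * p \<in> ?J"
      by simp
  qed
qed

lemma max_ideal_iff:
  fixes p :: "('x::finite, 'k::comm_ring_1) polyring"
  shows "p \<in> max_ideal \<longleftrightarrow> Poly_Mapping.lookup p 0 = 0"
proof -
  have "range (\<lambda>x :: 'x. poly_of_mon (var x) :: ('x, 'k) polyring) = poly_of_mon ` range var"
    by auto
  then have "p \<in> max_ideal \<longleftrightarrow> p \<in> ideal_gen (poly_of_mon ` range var)"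
    by (simp only: max_ideal_def)
  also have "\<dots> \<longleftrightarrow> (\<forall>m\<in>Poly_Mapping.keys p. \<exists>x. x \<in> Poly_Mapping.keys m)"
    unfolding ideal_gen_monomials by (simp add: mon_dvd_var_iff)
  also have "\<dots> \<longleftrightarrow> (\<forall>m\<in>Poly_Mapping.keys p. m \<noteq> 0)"
    by (metis all_not_in_conv keys_eq_empty)
  finally show ?thesis
    by (auto simp: in_keys_iff)
qed

lemma lookup_times_0:
  "Poly_Mapping.lookup p 0 = 0 \<Longrightarrow> Poly_Mapping.lookup (p * q) 0 = 0"
  for p :: "('x::finite, 'k::comm_ring_1) polyring"
  using ring_module.subspace_scale[OF ring_module.subspace_span, of p _ q]
  by (simp add: max_ideal_def flip: max_ideal_iff) (simp add: mult.commute)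

lemma generated_in_degree_ge:
  assumes "generated_in_degree d A" "p \<in> A" "m \<in> Poly_Mapping.keys p"
  shows "d \<le> mon_degree m"
proof -
  obtain H where H: "\<forall>p\<in>H. form d p" "A = ideal_gen H"
    using assms(1) by (auto simp: generated_in_degree_def)
  have "ring_module.subspace {p :: ('a, 'b) polyring. \<forall>m\<in>Poly_Mapping.keys p. d \<le> mon_degree m}"
  proof (rule ring_module.subspaceI)
    fix p q :: "('a, 'b) polyring"
    assume "p \<in> {p. \<forall>m\<in>Poly_Mapping.keys p. d \<le> mon_degree m}"
      "q \<in> {p. \<forall>m\<in>Poly_Mapping.keys p. d \<le> mon_degree m}"
    then show "p + q \<in> {p. \<forall>m\<in>Poly_Mapping.keys p. d \<le> mon_degree m}"
      using keys_add[of p q] by auto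
  next
    fix c p :: "('a, 'b) polyring"
    assume p: "p \<in> {p. \<forall>m\<in>Poly_Mapping.keys p. d \<le> mon_degree m}"
    have "d \<le> mon_degree m" if m: "m \<in> Poly_Mapping.keys (c * p)" for m
    proof -
      obtain a b where "m = a + b" "b \<in> Poly_Mapping.keys p"
        using keys_mult[of c p] m by blast
      with p show ?thesis
        by (auto simp: mon_degree_add intro: trans_le_add2)
    qed
    then show "c * p \<in> {p. \<forall>m\<in>Poly_Mapping.keys p. d \<le> mon_degree m}"
      by simp
  qed simp
  moreover have "H \<subseteq> {p. \<forall>m\<in>Poly_Mapping.keys p. d \<le> mon_degree m}"
    using H(1) by (auto simp: form_def)
  ultimately show ?thesis
    using ring_module.span_minimal assms(2,3) H(2) by blast
qed

text \<open>A nonzero generator from one system contains a monomial, whose degree is at least the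
  generating degree of the other; then symmetry. This identifies the degree that
  \<open>linear_resolution\<close> binds existentially.\<close>

lemma generated_in_degree_unique:
  assumes "generated_in_degree d A" "generated_in_degree e A" "A \<noteq> {0}"
  shows "d = e"
proof -
  have "b \<le> a" if "generated_in_degree a A" "generated_in_degree b A" for a b
  proof -
    obtain H where H: "\<forall>p\<in>H. form a p" "A = ideal_gen H"
      using \<open>generated_in_degree a A\<close> unfolding generated_in_degree_def by blast
    have "\<not> H \<subseteq> {0}"
      using assms(3) H(2) ring_module.span_minimal[OF _ ring_module.subspace_single_0]
        ring_module.span_zero[of H] by blast
    then obtain p where p: "p \<in> H" "p \<noteq> 0"
      by blast
    then obtain m where "m \<in> Poly_Mapping.keys p"
      by (metis ex_in_conv keys_eq_empty)
    with p H that(2) show ?thesis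
      using generated_in_degree_ge[of b A p m] ring_module.span_base by (auto simp: form_def)
  qed
  with assms show ?thesis
    by (simp add: le_antisym)
qed

text \<open>Used with \<open>P\<close> as membership in a kernel. A unit vector in the kernel would
  lie in the image of the next map, whose entries have no constant term, although its coordinate
  \<open>q\<close> is 1. So minimality makes every column of the map nonzero.\<close>

lemma minimal_column_nonzero:
  assumes K: "{v \<in> carrier_vec m. P v} \<subseteq> {D *\<^sub>v w |w. w \<in> carrier_vec l}"
    and D: "D \<in> carrier_mat m l" "\<And>p q. p < m \<Longrightarrow> q < l \<Longrightarrow> D $$ (p, q) \<in> max_ideal"
    and q: "q < m"
  shows "\<not> P (unit_vec m q :: ('x::finite, 'k::field) polyring vec)"
proof
  assume "P (unit_vec m q)"
  then have "unit_vec m q \<in> {v \<in> carrier_vec m. P v}"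
    by simp
  with K obtain w where w: "w \<in> carrier_vec l" "unit_vec m q = D *\<^sub>v w"
    by blast
  have "(1 :: ('x, 'k) polyring) = (D *\<^sub>v w) $ q"
    using q by (simp flip: w(2))
  also have "\<dots> = (\<Sum>i\<in>{0..<l}. D $$ (q, i) * w $ i)"
    using D(1) w(1) q by (auto simp: scalar_prod_def)
  finally have one: "(\<Sum>i\<in>{0..<l}. D $$ (q, i) * w $ i) = 1"
    by (rule sym)
  have "Poly_Mapping.lookup (\<Sum>i\<in>{0..<l}. D $$ (q, i) * w $ i) 0 = 0"
    unfolding lookup_sum
    using D(2) q by (intro sum.neutral ballI lookup_times_0) (auto simp: max_ideal_iff)
  then show False
    unfolding one by simp
qed

lemma mat_mult_unit_vec_index:
  fixes D :: "'a::comm_ring_1 mat"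
  assumes "D \<in> carrier_mat n m" "q < m" "p < n"
  shows "(D *\<^sub>v unit_vec m q) $ p = D $$ (p, q)"
  using assms by (simp add: scalar_prod_right_unit)

text \<open>Minimality bounds the shifts from below and regularity from above. They are therefore
  all \<open>d + i\<close>, the differentials consist of linear forms, and dimension shifting along
  the resolution applies.\<close>

lemma koszul_linear_of_linear_resolution:
  assumes lin: "linear_resolution A" and gen: "generated_in_degree d A" and A: "A \<noteq> {0}"
  shows "koszul_linear d (row_module (A :: ('x::finite, 'k::field) polyring set))"
proof -
  obtain d' where d': "generated_in_degree d' A" "has_regularity A (int d')"
    using lin A by (auto simp: linear_resolution_def)
  then have reg: "has_regularity A (int d)"
    using generated_in_degree_unique[OF gen d'(1) A] by simp
  then obtain r a g D where res: "minimal_graded_free_resolution A r a g D"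
    and le: "\<And>i p. p < r i \<Longrightarrow> int (a i p) - int i \<le> int d"
    unfolding has_regularity_def by blast
  have g: "g \<in> carrier_vec (r 0)" and D: "\<And>i. D i \<in> carrier_mat (r i) (r (Suc i))"
    and form_g: "\<And>p. p < r 0 \<Longrightarrow> form (a 0 p) (g $ p)"
    and deg_D: "\<And>i p q m. p < r i \<Longrightarrow> q < r (Suc i) \<Longrightarrow> m \<in> Poly_Mapping.keys (D i $$ (p, q)) \<Longrightarrow>
        a i p + mon_degree m = a (Suc i) q"
    and img: "A = {scalar_prod g v |v. v \<in> carrier_vec (r 0)}"
    and ker_g: "{v \<in> carrier_vec (r 0). scalar_prod g v = 0} =
        {D 0 *\<^sub>v w |w. w \<in> carrier_vec (r 1)}"
    and ker_D: "\<And>i. {v \<in> carrier_vec (r (Suc i)). D i *\<^sub>v v = 0\<^sub>v (r i)} =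
        {D (Suc i) *\<^sub>v w |w. w \<in> carrier_vec (r (Suc (Suc i)))}"
    and min: "\<And>i p q. p < r i \<Longrightarrow> q < r (Suc i) \<Longrightarrow> D i $$ (p, q) \<in> max_ideal"
    using res unfolding minimal_graded_free_resolution_def by auto
  have shift: "a i p = d + i" if "p < r i" for i p
    using that
  proof (induction i arbitrary: p)
    case (0 p)
    have "scalar_prod g (unit_vec (r 0) p) \<noteq> 0"
      by (rule minimal_column_nonzero[where P = "\<lambda>v. scalar_prod g v = 0" and D = "D 0" and l = "r 1"])
        (use ker_g D[of 0] min 0 in auto)
    then have "g $ p \<noteq> 0"
      by (simp add: scalar_prod_right_unit[OF 0])
    then obtain m where m: "m \<in> Poly_Mapping.keys (g $ p)"
      by (metis ex_in_conv keys_eq_empty)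
    have "g $ p \<in> A"
      unfolding img mem_Collect_eq
      by (intro exI[of _ "unit_vec (r 0) p"] conjI) (simp_all add: scalar_prod_right_unit[OF 0])
    with m generated_in_degree_ge[OF gen] have "d \<le> mon_degree m"
      by blast
    with m form_g[OF 0] le[OF 0] show ?case
      by (auto simp: form_def)
  next
    case (Suc i q)
    have "D i *\<^sub>v unit_vec (r (Suc i)) q \<noteq> 0\<^sub>v (r i)"
      by (rule minimal_column_nonzero[where P = "\<lambda>v. D i *\<^sub>v v = 0\<^sub>v (r i)" and
            D = "D (Suc i)" and l = "r (Suc (Suc i))"])
        (use ker_D D[of "Suc i"] min Suc.prems in auto)
    moreover have "D i *\<^sub>v unit_vec (r (Suc i)) q = 0\<^sub>v (r i)" if "\<forall>p<r i. D i $$ (p, q) = 0"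
      using that D[of i] Suc.prems mat_mult_unit_vec_index[OF D[of i] Suc.prems]
      by (intro eq_vecI) auto
    ultimately obtain p where p: "p < r i" "D i $$ (p, q) \<noteq> 0"
      by blast
    then obtain m where m: "m \<in> Poly_Mapping.keys (D i $$ (p, q))"
      by (metis ex_in_conv keys_eq_empty)
    \<comment> \<open>An entry in the maximal ideal has positive degree, so each step raises the
      shift by at least 1, and \<open>le\<close> permits no more.\<close>
    then have "mon_degree m \<noteq> 0"
      using min[OF p(1) Suc.prems] by (auto simp: max_ideal_iff mon_degree_eq_0_iff in_keys_iff)
    with deg_D[OF p(1) Suc.prems m] Suc.IH[OF p(1)] le[OF Suc.prems] show ?case
      by simp
  qed
  \<comment> \<open>The augmentation becomes stage 0, with entries of degree \<open>d\<close>; the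
    differentials become the later stages, with linear entries and rows padded by zero.\<close>
  define M where "M s = (case s of 0 \<Rightarrow> row_matrix g
    | Suc i \<Rightarrow> (\<lambda>p q. if p < r i then D i $$ (p, q) else 0))" for s
  define \<delta> where "\<delta> s = (case s of 0 \<Rightarrow> d | Suc i \<Rightarrow> 1)" for s :: nat
  have rep: "represents (M (Suc i)) (r i) (r (Suc i)) (D i)" for i
    by (simp add: represents_def M_def D)
  have M_0: "M 0 = row_matrix g"
    by (simp add: M_def)
  have "koszul_linear (\<delta> 0) (mat_image (r 0) (M 0))"
  proof (rule koszul_linear_of_resolution)
    show "form (\<delta> s) (M s p q)" if q: "q < r s" for s p q
    proof (cases s)
      case 0
      then show ?thesis
        using form_g shift[of q 0] q by (auto simp: M_def \<delta>_def row_matrix_def)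
    next
      case (Suc i)
      have "form 1 (D i $$ (p, q))" if "p < r i"
        using deg_D[OF that, of q] shift[OF that] shift[of q "Suc i"] q Suc by (auto simp: form_def)
      then show ?thesis
        by (simp add: Suc M_def \<delta>_def)
    qed
    show "\<delta> (Suc s) = 1" for s
      by (simp add: \<delta>_def)
    show "mat_kernel (r s) (M s) = mat_image (r (Suc s)) (M (Suc s))" for s
    proof (cases s)
      case 0
      then show ?thesis
        using ker_g by (simp add: represents_image[OF rep] row_matrix_kernel[OF g] M_0)
    next
      case (Suc i)
      then show ?thesis
        by (simp add: represents_image[OF rep] represents_kernel[OF rep] ker_D)
    qed
  qed
  then show ?thesis
    by (simp add: M_def \<delta>_def row_matrix_image[OF g] flip: img)
qed

text \<open>\<open>linear_presentation\<close> reproduces its hypotheses for the syzygies, with 1 in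
  place of \<open>d\<close>, so it can be iterated indefinitely. The matrices form a resolution with
  shifts \<open>d + i\<close>, minimal because linear forms have no constant term.\<close>

lemma linear_resolution_of_koszul_linear:
  fixes A :: "('x::finite, 'k::field) polyring set"
  assumes lin: "koszul_linear d (row_module A)" and gen: "generated_in_degree d A"
    and ideal: "ring_module.subspace A" and homog: "\<And>p e. p \<in> A \<Longrightarrow> hom_component e p \<in> A"
  shows "linear_resolution A"
proof (cases "A = {0}")
  case False
  define \<delta> where "\<delta> s = (case s of 0 \<Rightarrow> d | Suc i \<Rightarrow> 1)" for s :: nat
  define good where "good s x \<longleftrightarrow> (case x of (r, M) \<Rightarrow> (\<forall>p q. q < r \<longrightarrow> form (\<delta> s) (M p q)) \<and>
    koszul_linear 1 (mat_kernel r M) \<and> (s = 0 \<longrightarrow> mat_image r M = row_module A))"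
    for s and x :: "nat \<times> (nat \<Rightarrow> nat \<Rightarrow> ('x, 'k) polyring)"
  define nxt where "nxt x y \<longleftrightarrow> (case x of (r, M) \<Rightarrow> case y of (r', M') \<Rightarrow>
    mat_image r' M' = mat_kernel r M)"
    for x y :: "nat \<times> (nat \<Rightarrow> nat \<Rightarrow> ('x, 'k) polyring)"
  \<comment> \<open>Dependent choice over pairs of a rank and a matrix: only stage 0 refers to
    \<open>A\<close>, each later stage only to the kernel of its predecessor.\<close>
  have "\<exists>f. \<forall>s. good s (f s) \<and> nxt (f s) (f (Suc s))"
  proof (rule dependent_nat_choice)
    have "graded_submodule 1 (row_module A)"
      using ideal homog
      by (auto simp: graded_submodule_def row_module_def ring_module.subspace_def)
    from linear_presentation[OF this lin] show "\<exists>x. good 0 x"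
      by (auto simp: good_def \<delta>_def)
  next
    fix x s assume x: "good s x"
    obtain r M where rM: "x = (r, M)"
      by fastforce
    have "graded_submodule r (mat_kernel r M)"
      by (rule graded_submodule_kernel[where d = "\<delta> s"]) (use x rM in \<open>auto simp: good_def\<close>)
    moreover have "koszul_linear 1 (mat_kernel r M)"
      using x rM by (simp add: good_def)
    ultimately obtain r' M' where
      "mat_image r' M' = mat_kernel r M" "\<forall>p q. q < r' \<longrightarrow> form 1 (M' p q)"
      "koszul_linear 1 (mat_kernel r' M')"
      using linear_presentation[of r "mat_kernel r M" 1] by blast
    then show "\<exists>y. good (Suc s) y \<and> nxt x y"
      by (intro exI[of _ "(r', M')"]) (simp add: good_def nxt_def rM \<delta>_def)
  qed
  then obtain f where f: "\<And>s. good s (f s)" "\<And>s. nxt (f s) (f (Suc s))"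
    by blast
  define r where "r s = fst (f s)" for s
  define M where "M s = snd (f s)" for s
  have forms: "form (\<delta> s) (M s p q)" if "q < r s" for s p q
    using f(1)[of s] that by (auto simp: good_def r_def M_def split: prod.splits)
  have image: "mat_image (r 0) (M 0) = row_module A"
    using f(1)[of 0] by (auto simp: good_def r_def M_def split: prod.splits)
  have exact: "mat_kernel (r s) (M s) = mat_image (r (Suc s)) (M (Suc s))" for s
    using f(2)[of s] by (auto simp: nxt_def r_def M_def split: prod.splits)
  have column: "(\<lambda>p. M s p q) \<in> mat_image (r s) (M s)" if "q < r s" for s q
  proof -
    have "(\<lambda>p. M s p q) = mat_apply (r s) (M s) (\<lambda>i. if i = q then 1 else 0)"
      using that
      by (simp add: mat_apply_def fun_eq_iff if_distrib[of "\<lambda>x. _ * x"] cong: if_cong)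
    then show ?thesis
      by blast
  qed
  define g where "g = vec (r 0) (\<lambda>q. M 0 0 q)"
  define D where "D i = mat (r i) (r (Suc i)) (\<lambda>(p, q). M (Suc i) p q)" for i
  have g: "g \<in> carrier_vec (r 0)"
    by (simp add: g_def)
  have D: "D i \<in> carrier_mat (r i) (r (Suc i))" for i
    by (simp add: D_def)
  \<comment> \<open>The columns of \<open>M 0\<close> lie in \<open>row_module A\<close>, so its
    rows after the first vanish and \<open>g\<close> determines the map.\<close>
  have row: "mat_apply (r 0) (row_matrix g) = mat_apply (r 0) (M 0)"
  proof (intro ext)
    fix u p
    have "M 0 p q = row_matrix g p q" if "q < r 0" for q
      using column[OF that] that by (auto simp: row_matrix_def g_def image row_module_def)
    then show "mat_apply (r 0) (row_matrix g) u p = mat_apply (r 0) (M 0) u p"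
      by (simp add: mat_apply_def)
  qed
  have ker_row: "mat_kernel (r 0) (row_matrix g) = mat_kernel (r 0) (M 0)"
    by (simp add: mat_kernel_def row)
  have rep: "represents (M (Suc i)) (r i) (r (Suc i)) (D i)" for i
    unfolding represents_def
  proof (intro conjI allI impI)
    fix p q assume q: "q < r (Suc i)"
    then have "(\<lambda>p. M (Suc i) p q) \<in> mat_kernel (r i) (M i)"
      using column exact by blast
    then show "M (Suc i) p q = (if p < r i then D i $$ (p, q) else 0)"
      using q by (simp add: mat_kernel_def D_def)
  qed (simp add: D_def)
  have form_D: "form 1 (D i $$ (p, q))" if "p < r i" "q < r (Suc i)" for i p q
    using forms[of q "Suc i" p] that by (simp add: D_def \<delta>_def)
  have row_A: "row_module A = row_module {scalar_prod g v |v. v \<in> carrier_vec (r 0)}"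
    using image by (simp add: row flip: row_matrix_image[OF g])
  have "minimal_graded_free_resolution A r (\<lambda>i p. d + i) g D"
    unfolding minimal_graded_free_resolution_def
  proof (intro conjI allI impI ballI)
    show "g \<in> carrier_vec (r 0)" "D i \<in> carrier_mat (r i) (r (Suc i))" for i
      by (rule g D)+
    show "form (d + 0) (g $ p)" if "p < r 0" for p
      using forms[of p 0 0] that by (simp add: g_def \<delta>_def)
    show "d + i + mon_degree m = d + Suc i"
      if "p < r i" "q < r (Suc i)" "m \<in> Poly_Mapping.keys (D i $$ (p, q))" for i p q m
      using form_D[OF that(1,2)] that(3) by (simp add: form_def)
    show "D i $$ (p, q) \<in> max_ideal" if "p < r i" "q < r (Suc i)" for i p q
      using form_D[OF that] by (force simp: max_ideal_iff form_def in_keys_iff)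
    show "A = {scalar_prod g v |v. v \<in> carrier_vec (r 0)}"
    proof -
      have "x \<in> A \<longleftrightarrow> x \<in> {scalar_prod g v |v. v \<in> carrier_vec (r 0)}" for x
      proof -
        have "x \<in> B \<longleftrightarrow> (\<lambda>p. if p = 0 then x else 0) \<in> row_module B" for B
          by (simp add: row_module_def)
        then show ?thesis
          using row_A by blast
      qed
      then show ?thesis
        by blast
    qed
    show "{v \<in> carrier_vec (r 0). scalar_prod g v = 0} = {D 0 *\<^sub>v w |w. w \<in> carrier_vec (r 1)}"
    proof (rule funs_of_vecs_eqD)
      show "funs_of_vecs (r 0) {v \<in> carrier_vec (r 0). scalar_prod g v = 0} =
          funs_of_vecs (r 0) {D 0 *\<^sub>v w |w. w \<in> carrier_vec (r 1)}"
        using exact[of 0] represents_image[OF rep[of 0]]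
        by (simp flip: row_matrix_kernel[OF g] ker_row)
    qed (auto intro: mult_mat_vec_carrier[OF D])
    show "{v \<in> carrier_vec (r (Suc i)). D i *\<^sub>v v = 0\<^sub>v (r i)} =
        {D (Suc i) *\<^sub>v w |w. w \<in> carrier_vec (r (Suc (Suc i)))}" for i
    proof (rule funs_of_vecs_eqD)
      show "funs_of_vecs (r (Suc i)) {v \<in> carrier_vec (r (Suc i)). D i *\<^sub>v v = 0\<^sub>v (r i)} =
          funs_of_vecs (r (Suc i)) {D (Suc i) *\<^sub>v w |w. w \<in> carrier_vec (r (Suc (Suc i)))}"
        using exact[of "Suc i"]
        by (simp flip: represents_image[OF rep] represents_kernel[OF rep])
    qed (auto intro: mult_mat_vec_carrier[OF D])
  qed
  \<comment> \<open>\<open>has_regularity\<close> demands that the bound be attained; a nonzero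
    ideal has a generator, which attains it in homological degree 0.\<close>
  moreover have "0 < r 0"
  proof (rule ccontr)
    assume "\<not> 0 < r 0"
    then have zero: "u 0 = 0" if "u \<in> row_module A" for u
      using that by (auto simp: mat_apply_def simp flip: image)
    have "p = 0" if "p \<in> A" for p
      using zero[of "\<lambda>i. if i = 0 then p else 0"] that by (simp add: row_module_def)
    with False ring_module.subspace_0[OF ideal] show False
      by blast
  qed
  ultimately have "has_regularity A (int d)"
    unfolding has_regularity_def
    by (intro exI[of _ r] exI[of _ "\<lambda>i p. d + i"] exI[of _ g] exI[of _ D] conjI exI[of _ 0]) auto
  with gen show ?thesis
    by (auto simp: linear_resolution_def)
qed (simp add: linear_resolution_def)

section \<open>Monomial ideals\<close>

definition upward_closed :: "'x mon set \<Rightarrow> bool" where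
  "upward_closed U \<longleftrightarrow> (\<forall>m\<in>U. \<forall>m'. mon_dvd m m' \<longrightarrow> m' \<in> U)"

definition upward_closure :: "'x mon set \<Rightarrow> 'x mon set" where
  "upward_closure M = {m. \<exists>m0\<in>M. mon_dvd m0 m}"

definition monomials :: "('x, 'k::comm_ring_1) polyring set \<Rightarrow> 'x mon set" where
  "monomials I = {m. poly_of_mon m \<in> I}"

abbreviation ideal_of :: "'x mon set \<Rightarrow> ('x, 'k::comm_ring_1) polyring set" where
  "ideal_of U \<equiv> {p. Poly_Mapping.keys p \<subseteq> U}"

abbreviation degree_part :: "'x::finite mon set \<Rightarrow> nat \<Rightarrow> 'x mon set" where
  "degree_part U d \<equiv> {m \<in> U. mon_degree m = d}"

lemma mon_dvd_refl: "mon_dvd m m"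
  by (simp add: mon_dvd_iff)

lemma mon_dvd_trans: "mon_dvd a b \<Longrightarrow> mon_dvd b c \<Longrightarrow> mon_dvd a c"
  unfolding mon_dvd_iff using le_trans by blast

lemma mon_dvd_add_right: "mon_dvd a b \<Longrightarrow> mon_dvd a (b + c)"
  by (auto simp: mon_dvd_iff lookup_add intro: trans_le_add1)

lemma upward_closedD: "upward_closed U \<Longrightarrow> m \<in> U \<Longrightarrow> mon_dvd m m' \<Longrightarrow> m' \<in> U"
  by (auto simp: upward_closed_def)

lemma upward_closed_closure: "upward_closed (upward_closure M)"
  unfolding upward_closed_def upward_closure_def using mon_dvd_trans by blast

lemma upward_closure_eq: "upward_closed U \<Longrightarrow> upward_closure U = U"
  unfolding upward_closed_def upward_closure_def using mon_dvd_refl by blast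

lemma ideal_gen_eq_ideal_of:
  "ideal_gen (poly_of_mon ` M) = (ideal_of (upward_closure M) :: ('x::finite, 'k::comm_ring_1) polyring set)"
  unfolding ideal_gen_monomials upward_closure_def by blast

lemma monomials_ideal_of: "monomials (ideal_of U :: ('x, 'k::comm_ring_1) polyring set) = U"
  by (simp add: monomials_def poly_of_mon_def)

lemma monomial_ideal_monomials:
  assumes "monomial_ideal (I :: ('x::finite, 'k::comm_ring_1) polyring set)"
  shows "I = ideal_of (monomials I)" "upward_closed (monomials I)"
proof -
  obtain M where "I = ideal_gen (poly_of_mon ` M)"
    using assms unfolding monomial_ideal_def by blast
  then have I: "I = ideal_of (upward_closure M)"
    by (simp only: ideal_gen_eq_ideal_of)
  then have mon: "monomials I = upward_closure M"
    by (simp only: monomials_ideal_of)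
  show "I = ideal_of (monomials I)"
    unfolding mon by (rule I)
  show "upward_closed (monomials I)"
    unfolding mon by (rule upward_closed_closure)
qed

lemma component_ideal_of:
  "component (ideal_of U) j =
    (ideal_of (upward_closure (degree_part U j)) :: ('x::finite, 'k::comm_ring_1) polyring set)"
proof -
  let ?H = "{p :: ('x, 'k) polyring. p \<in> ideal_of U \<and> form j p}"
  have "ideal_gen ?H = ideal_gen (poly_of_mon ` degree_part U j)"
  proof (intro equalityI ring_module.span_minimal ring_module.subspace_span)
    show "?H \<subseteq> ideal_gen (poly_of_mon ` degree_part U j)"
      unfolding ideal_gen_monomials form_def using mon_dvd_refl by blast
    have "poly_of_mon ` degree_part U j \<subseteq> ?H"
      by (auto simp: form_def poly_of_mon_def)
    then show "poly_of_mon ` degree_part U j \<subseteq> ideal_gen ?H"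
      using ring_module.span_superset by blast
  qed
  then show ?thesis
    unfolding component_def ideal_gen_eq_ideal_of .
qed

text \<open>The field is an argument because the homology of a simplicial complex depends on its
  characteristic.\<close>

definition mon_linear :: "'k::field itself \<Rightarrow> nat \<Rightarrow> 'x::finite mon set \<Rightarrow> bool" where
  "mon_linear _ d U \<longleftrightarrow>
     (\<forall>b i. mon_degree b \<noteq> i + d \<longrightarrow> acyclic_at TYPE('k) (koszul_complex U b) i)"

lemma koszul_complex_card: "\<sigma> \<in> koszul_complex U b \<Longrightarrow> card \<sigma> \<le> mon_degree b"
  by (auto simp: koszul_complex_def mon_degree_add mon_degree_indicator_mon)

lemma down_closed_koszul_complex:
  assumes "upward_closed U"
  shows "down_closed (koszul_complex U b)"
  unfolding down_closed_def
proof (intro ballI allI impI)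
  fix \<sigma> \<tau> assume "\<sigma> \<in> koszul_complex U b" "\<tau> \<subseteq> \<sigma>"
  then obtain m where m: "m \<in> U" "b = m + indicator_mon \<sigma>"
    by (auto simp: koszul_complex_def)
  have "b = (m + indicator_mon (\<sigma> - \<tau>)) + indicator_mon \<tau>"
    using \<open>\<tau> \<subseteq> \<sigma>\<close> by (intro poly_mapping_eqI) (auto simp: m lookup_add lookup_indicator_mon)
  moreover have "m + indicator_mon (\<sigma> - \<tau>) \<in> U"
    using assms m(1) by (rule upward_closedD) (auto simp: mon_dvd_def)
  ultimately show "\<tau> \<in> koszul_complex U b"
    unfolding koszul_complex_def by blast
qed

text \<open>A simplicial cycle is planted in the single multidegree \<open>b\<close> by attaching
  the monomial \<open>b - indicator_mon \<sigma>\<close> to its value at \<open>\<sigma>\<close>. Of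
  a Koszul chain bounding the result, the component in multidegree \<open>b\<close> bounds the given
  cycle.\<close>

lemma mon_linear_of_koszul_linear:
  assumes lin: "koszul_linear d (row_module (ideal_of U :: ('x::finite, 'k::field) polyring set))"
    and U: "upward_closed U"
  shows "mon_linear TYPE('k) d U"
  unfolding mon_linear_def acyclic_at_def
proof (intro allI impI)
  fix b i and c :: "'x set \<Rightarrow> 'k"
  let ?K = "koszul_complex U b"
  assume b: "mon_degree b \<noteq> i + d" and c: "chain ?K i c" and cyc: "\<forall>\<tau>\<in>?K. simplicial_bd c \<tau> = 0"
  show "\<exists>e. chain ?K (Suc i) e \<and> (\<forall>\<sigma>\<in>?K. simplicial_bd e \<sigma> = c \<sigma>)"
  proof (cases "i \<le> mon_degree b")
    \<comment> \<open>Faces have at most \<open>mon_degree b\<close> elements, so this range has no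
      nonzero chains. Settling it first keeps \<open>mon_degree b - i\<close> from being
      truncated.\<close>
    case False
    have "c \<sigma> = 0" for \<sigma>
      using c koszul_complex_card[of \<sigma> U b] False by (auto simp: chain_def)
    then show ?thesis
      by (intro exI[of _ "\<lambda>_. 0"]) (auto simp: chain_def koszul_bd_def)
  next
    case True
    have cyc': "simplicial_bd c \<tau> = 0" for \<tau>
    proof (cases "\<tau> \<in> ?K \<or> i = 0")
      case True
      then show ?thesis
        using cyc c bd_chain_0 by blast
    next
      case False
      then obtain i' where "i = Suc i'"
        by (cases i) auto
      with False c show ?thesis
        using chain_zero[OF chain_bd[OF _ down_closed_koszul_complex[OF U]]] by blast
    qed
    define z where "z \<sigma> = (if mon_dvd (indicator_mon \<sigma>) b
      then Poly_Mapping.single (b - indicator_mon \<sigma>) (c \<sigma>) else 0)" for \<sigma>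
    define Z where "Z \<sigma> p = (if p = 0 then z \<sigma> else 0)" for \<sigma> and p :: nat
    have comp_z: "mdeg_component b' z = (if b' = b then c else (\<lambda>_. 0))" for b'
    proof
      fix \<sigma>
      have "b' = b" if "mon_dvd (indicator_mon \<sigma>) b'" "mon_dvd (indicator_mon \<sigma>) b"
        "b - indicator_mon \<sigma> = b' - indicator_mon \<sigma>"
        using that by (metis mon_dvd_add_diff)
      then show "mdeg_component b' z \<sigma> = (if b' = b then c else (\<lambda>_. 0)) \<sigma>"
        using chain_zero[OF c, of \<sigma>] koszul_complexD[of \<sigma> U b] chain_zero[OF c] koszul_complexD
        by (auto simp: mdeg_component_def z_def lookup_single when_def)
    qed
    have z_nz: "\<exists>m\<in>U. b = m + indicator_mon \<sigma> \<and> z \<sigma> = Poly_Mapping.single m (c \<sigma>) \<and> card \<sigma> = i"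
      if "z \<sigma> \<noteq> 0" for \<sigma>
    proof -
      have "c \<sigma> \<noteq> 0"
        using that by (auto simp: z_def split: if_splits)
      with chainD[OF c] obtain m where "m \<in> U" "b = m + indicator_mon \<sigma>" "card \<sigma> = i"
        by (auto simp: koszul_complex_def)
      moreover have "mon_dvd (indicator_mon \<sigma>) b"
        unfolding \<open>b = _\<close> by (auto simp: mon_dvd_def add.commute)
      ultimately show ?thesis
        by (auto simp: z_def)
    qed
    obtain w where w: "\<And>\<sigma>. w \<sigma> \<in> row_module (ideal_of U)" "\<And>p. chain UNIV (Suc i) (\<lambda>\<sigma>. w \<sigma> p)"
      "\<And>p \<sigma>. koszul_diff (\<lambda>\<sigma>. w \<sigma> p) \<sigma> = Z \<sigma> p"
    proof (rule koszul_linearD[OF lin, of "mon_degree b - i" Z i])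
      show "mon_degree b - i \<noteq> d"
        using b True by simp
      show "Z \<sigma> \<in> row_module (ideal_of U)" for \<sigma>
        using z_nz[of \<sigma>] by (cases "z \<sigma> = 0") (auto simp: row_module_def Z_def split: if_splits)
      show "form (mon_degree b - i) (Z \<sigma> p)" for \<sigma> p
        using z_nz[of \<sigma>]
        by (cases "z \<sigma> = 0") (auto simp: Z_def form_def mon_degree_add mon_degree_indicator_mon split: if_splits)
      show "chain UNIV i (\<lambda>\<sigma>. Z \<sigma> p)" for p
        using z_nz unfolding chain_def Z_def by (metis UNIV_I)
      show "koszul_diff (\<lambda>\<sigma>. Z \<sigma> p) \<tau> = 0" for p \<tau>
      proof (cases "p = 0")
        case True
        have "koszul_diff z \<tau> = 0"
          by (rule poly_mapping_eqI)
            (simp add: lookup_eq_mdeg_component[of "koszul_diff z"] mdeg_component_koszul_diff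
              comp_z cyc' koszul_bd_def[of _ "\<lambda>_. 0"])
        with True show ?thesis
          by (simp add: Z_def)
      qed (simp add: Z_def koszul_bd_def)
    qed blast
    define e where "e = mdeg_component b (\<lambda>\<sigma>. w \<sigma> 0)"
    have "chain ?K (Suc i) e"
      unfolding e_def using w(1) by (intro chain_mdeg_component[OF w(2)]) (simp add: row_module_def)
    moreover have "simplicial_bd e \<sigma> = c \<sigma>" for \<sigma>
    proof -
      have "koszul_diff (\<lambda>\<sigma>. w \<sigma> 0) = z"
        by (rule ext) (simp add: w(3) Z_def)
      then show ?thesis
        using mdeg_component_koszul_diff[of b "\<lambda>\<sigma>. w \<sigma> 0" \<sigma>] by (simp add: e_def comp_z)
    qed
    ultimately show ?thesis
      by blast
  qed
qed

text \<open>A Koszul cycle of degree \<open>e\<close> in homological degree \<open>i\<close> lives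
  only in multidegrees of total degree \<open>i + e\<close>. As \<open>e \<noteq> d\<close>, the
  complexes there are acyclic in degree \<open>i\<close>, and \<open>koszul_diff_lift\<close> glues
  the preimages.\<close>

lemma koszul_linear_of_mon_linear:
  assumes lin: "mon_linear TYPE('k::field) d U" and U: "upward_closed U"
  shows "koszul_linear d (row_module (ideal_of U :: ('x::finite, 'k) polyring set))"
  unfolding koszul_linear_def
proof (intro allI impI)
  fix i e and z :: "'x set \<Rightarrow> nat \<Rightarrow> ('x, 'k) polyring"
  assume e: "e \<noteq> d" and z: "\<forall>\<sigma>. z \<sigma> \<in> row_module (ideal_of U) \<and> vec_form e (z \<sigma>)"
    and chain_z: "\<forall>p. chain UNIV i (\<lambda>\<sigma>. z \<sigma> p)"
    and cyc: "\<forall>p \<tau>. koszul_diff (\<lambda>\<sigma>. z \<sigma> p) \<tau> = 0"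
  let ?z = "\<lambda>\<sigma>. z \<sigma> 0"
  have "\<exists>f. chain (koszul_complex U b) (Suc i) f \<and>
      (\<forall>\<sigma>. simplicial_bd f \<sigma> = mdeg_component b ?z \<sigma>)" for b
  proof (cases "mon_degree b = i + e")
    case True
    show ?thesis
    proof (rule acyclic_at_boundary)
      show "acyclic_at TYPE('k) (koszul_complex U b) i"
        using lin True e by (simp add: mon_linear_def)
      show "down_closed (koszul_complex U b)"
        by (rule down_closed_koszul_complex[OF U])
      show "chain (koszul_complex U b) i (mdeg_component b ?z)"
        using z chain_z by (intro chain_mdeg_component) (simp_all add: row_module_def)
      show "simplicial_bd (mdeg_component b ?z) \<tau> = 0" for \<tau>
      proof -
        have "mdeg_component b (koszul_diff ?z) \<tau> = 0"
          using cyc by (simp add: mdeg_component_def)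
        then show ?thesis
          by (simp only: mdeg_component_koszul_diff)
      qed
    qed
  next
    case False
    have "mdeg_component b ?z \<sigma> = 0" for \<sigma>
    proof (rule ccontr)
      assume "mdeg_component b ?z \<sigma> \<noteq> 0"
      then have dvd: "mon_dvd (indicator_mon \<sigma>) b" and
        key: "b - indicator_mon \<sigma> \<in> Poly_Mapping.keys (?z \<sigma>)"
        by (auto simp: mdeg_component_def in_keys_iff split: if_splits)
      from key have "?z \<sigma> \<noteq> 0"
        by auto
      then have "card \<sigma> = i"
        using chain_z by (auto simp: chain_def)
      moreover have "mon_degree (b - indicator_mon \<sigma>) = e"
        using z key by (auto simp: form_def)
      moreover have "mon_degree b = mon_degree (b - indicator_mon \<sigma>) + card \<sigma>"
        using mon_dvd_diff_add[OF dvd] by (metis mon_degree_add mon_degree_indicator_mon)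
      ultimately show False
        using False by simp
    qed
    then show ?thesis
      by (intro exI[of _ "\<lambda>_. 0"]) (auto simp: chain_def koszul_bd_def)
  qed
  from koszul_diff_lift[OF this] obtain w where w: "chain UNIV (Suc i) w"
    "\<And>\<sigma>. Poly_Mapping.keys (w \<sigma>) \<subseteq> U" "\<And>\<sigma>. koszul_diff w \<sigma> = ?z \<sigma>"
    by blast
  define W where "W \<sigma> p = (if p = 0 then w \<sigma> else 0)" for \<sigma> and p :: nat
  have "koszul_diff (\<lambda>\<sigma>. W \<sigma> p) \<sigma> = z \<sigma> p" for p \<sigma>
    using z by (cases "p = 0") (simp_all add: W_def w(3) row_module_def koszul_bd_def[of _ "\<lambda>_. 0"])
  moreover have "W \<sigma> \<in> row_module (ideal_of U)" for \<sigma>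
    using w(2) by (simp add: W_def row_module_def)
  moreover have "chain UNIV (Suc i) (\<lambda>\<sigma>. W \<sigma> p)" for p
    using w(1) by (auto simp: W_def chain_def)
  ultimately show "\<exists>w. (\<forall>\<sigma>. w \<sigma> \<in> row_module (ideal_of U)) \<and>
      (\<forall>p. chain UNIV (Suc i) (\<lambda>\<sigma>. w \<sigma> p)) \<and> (\<forall>p \<sigma>. koszul_diff (\<lambda>\<sigma>. w \<sigma> p) \<sigma> = z \<sigma> p)"
    by blast
qed

lemma linear_component_iff:
  assumes "I = (ideal_of U :: ('x::finite, 'k::field) polyring set)"
  shows "linear_resolution (component I d) \<longleftrightarrow>
    mon_linear TYPE('k) d (upward_closure (degree_part U d))"
proof -
  let ?U = "upward_closure (degree_part U d)"
  have comp: "component I d = ideal_of ?U"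
    unfolding assms by (rule component_ideal_of)
  have gen: "generated_in_degree d (component I d)"
    unfolding generated_in_degree_def component_def by (intro exI[of _ "{p \<in> I. form d p}"]) simp
  have up: "upward_closed ?U"
    by (rule upward_closed_closure)
  show ?thesis
  proof
    assume lin: "linear_resolution (component I d)"
    show "mon_linear TYPE('k) d ?U"
    \<comment> \<open>The zero ideal is linear by convention but has no regularity, so it is treated
      apart: its complexes are empty.\<close>
    proof (cases "component I d = {0}")
      case True
      then have "monomials (component I d) = {}"
        by (auto simp: monomials_def poly_of_mon_def simp flip: keys_eq_empty)
      then have "?U = {}"
        unfolding comp monomials_ideal_of .
      then show ?thesis
        by (simp add: mon_linear_def koszul_complex_def acyclic_at_empty)
    next
      case False
      with lin gen have "koszul_linear d (row_module (component I d))"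
        by (rule koszul_linear_of_linear_resolution)
      then show ?thesis
        unfolding comp by (rule mon_linear_of_koszul_linear[OF _ up])
    qed
  next
    assume "mon_linear TYPE('k) d ?U"
    then have lin: "koszul_linear d (row_module (component I d))"
      unfolding comp by (rule koszul_linear_of_mon_linear[OF _ up])
    show "linear_resolution (component I d)"
    proof (rule linear_resolution_of_koszul_linear[OF lin gen])
      show "ring_module.subspace (component I d)"
        unfolding component_def by (rule ring_module.subspace_span)
      show "hom_component e p \<in> component I d" if "p \<in> component I d" for p e
        using that unfolding comp by (auto simp: in_keys_iff lookup_hom_component split: if_splits)
    qed
  qed
qed

section \<open>Filtration of the sum\<close>

text \<open>Only the first step of the path matters: each later entry is a multiple of its
  predecessor, so the second entry already divides \<open>g\<close>.\<close>

lemma full_path_step: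
  assumes path: "full_path L f g gs" and "f \<noteq> g"
  shows "\<exists>z. var z + f \<in> L \<and> mon_dvd (var z + f) g"
proof -
  have gs: "gs \<noteq> []" "set gs \<subseteq> L" "hd gs = f" "last gs = g"
    and step: "\<And>j. Suc j < length gs \<Longrightarrow> \<exists>z. gs ! Suc j = var z + gs ! j"
    using path by (auto simp: full_path_def)
  have len: "1 < length gs"
    using gs \<open>f \<noteq> g\<close> by (cases gs) (auto split: if_splits)
  have "mon_dvd (gs ! 1) (gs ! j)" if "1 \<le> j" "j < length gs" for j
    using that
  proof (induction j rule: dec_induct)
    case (step j)
    then show ?case
      using mon_dvd_add_right[of "gs ! 1" "gs ! j"] \<open>\<And>j. Suc j < length gs \<Longrightarrow> _\<close>[of j]
      by (auto simp: add.commute)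
  qed (simp add: mon_dvd_refl)
  from this[of "length gs - 1"] len gs have "mon_dvd (gs ! 1) g"
    by (simp add: last_conv_nth)
  moreover have "gs ! 1 \<in> L"
    using len gs(2) by auto
  moreover obtain z where "gs ! 1 = var z + f"
    using step[of 0] len gs(1,3) by (auto simp: hd_conv_nth)
  ultimately show ?thesis
    by auto
qed

lemma mon_dvd_lcm: "mon_dvd f (mon_lcm f g)" "mon_dvd g (mon_lcm f g)"
  by (simp_all add: mon_dvd_iff mon_lcm.rep_eq)

lemma mon_lcm_dvd: "mon_dvd f m \<Longrightarrow> mon_dvd g m \<Longrightarrow> mon_dvd (mon_lcm f g) m"
  by (simp add: mon_dvd_iff mon_lcm.rep_eq)

text \<open>
  \<open>U f\<close> is the set of monomials of \<open>I\<^sub>f\<close>; \<open>sum_monomials j L\<close> is the set of monomials of the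
  degree \<open>j\<close> component of the sum of the \<open>f I\<^sub>f\<close>.
\<close>

locale full_family =
  fixes L :: "'x::finite mon set" and U :: "'x mon \<Rightarrow> 'x mon set" and k :: "'k::field itself"
  assumes full: "full_set L"
    and up: "f \<in> L \<Longrightarrow> upward_closed (U f)"
    and drop_var: "f \<in> L \<Longrightarrow> m \<in> U f \<Longrightarrow> x \<notin> Poly_Mapping.keys f \<Longrightarrow> x \<in> Poly_Mapping.keys m \<Longrightarrow>
      m - var x \<in> U f"
    and into_max: "f \<in> L \<Longrightarrow> var z + f \<in> L \<Longrightarrow> m \<in> U f \<Longrightarrow>
      \<exists>x\<in>Poly_Mapping.keys m. m - var x \<in> U (var z + f)"
    and linear: "f \<in> L \<Longrightarrow> mon_linear k d (upward_closure (degree_part (U f) d))"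
begin

text \<open>The degree condition is a sum so that the set is empty when \<open>mon_degree f\<close>
  exceeds \<open>j\<close>; a truncated difference would select degree 0 there.\<close>

definition piece :: "nat \<Rightarrow> 'x mon \<Rightarrow> 'x mon set" where
  "piece j f = upward_closure {v \<in> U f. mon_degree f + mon_degree v = j}"

definition sum_monomials :: "nat \<Rightarrow> 'x mon set \<Rightarrow> 'x mon set" where
  "sum_monomials j T = {f + v |f v. f \<in> T \<and> v \<in> piece j f}"

text \<open>The stages of the filtration. Closure under multiples inside \<open>L\<close> puts the
  lcm of a member of \<open>T\<close> and any element of \<open>L\<close> back into
  \<open>T\<close>.\<close>

definition up_set :: "'x mon set \<Rightarrow> bool" where
  "up_set T \<longleftrightarrow> T \<subseteq> L \<and> (\<forall>f\<in>T. \<forall>g\<in>L. mon_dvd f g \<longrightarrow> g \<in> T)"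

lemma new_var: "var z + f \<in> L \<Longrightarrow> z \<notin> Poly_Mapping.keys f"
proof -
  assume "var z + f \<in> L"
  then have "Poly_Mapping.lookup (var z + f) z \<le> 1"
    using full unfolding full_set_def squarefree_mon_def by blast
  then show "z \<notin> Poly_Mapping.keys f"
    by (simp add: lookup_add lookup_var in_keys_iff)
qed

lemma upward_closed_piece: "upward_closed (piece j f)"
  unfolding piece_def by (rule upward_closed_closure)

lemma upward_closed_sum_monomials: "upward_closed (sum_monomials j T)"
  unfolding upward_closed_def
proof (intro ballI allI impI)
  fix m m' assume "m \<in> sum_monomials j T" "mon_dvd m m'"
  then obtain f v t where *: "f \<in> T" "v \<in> piece j f" "m' = f + (v + t)"
    by (auto simp: sum_monomials_def mon_dvd_def add.assoc)
  then have "v + t \<in> piece j f"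
    using upward_closedD[OF upward_closed_piece] by (auto simp: mon_dvd_def)
  with * show "m' \<in> sum_monomials j T"
    by (auto simp: sum_monomials_def)
qed

text \<open>The factor \<open>z\<close> moves from the cofactor into the index, while the generator
  \<open>v0\<close> has to lose exactly one degree. If \<open>z\<close> divides the excess
  \<open>v1\<close>, the loss is provided by \<open>into_max\<close>. Otherwise \<open>z\<close>
  divides \<open>v0\<close> and is itself removed, which \<open>drop_var\<close> permits because
  \<open>z\<close> does not divide \<open>f\<close>.\<close>

lemma piece_step:
  assumes f: "f \<in> L" "var z + f \<in> L" and v: "v \<in> piece j f" "z \<in> Poly_Mapping.keys v"
  shows "\<exists>w\<in>piece j (var z + f). f + v = (var z + f) + w"
proof -
  obtain v0 v1 where v0: "v0 \<in> U f" "mon_degree f + mon_degree v0 = j" and vv: "v = v0 + v1"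
    using v(1) by (auto simp: piece_def upward_closure_def mon_dvd_def)
  have w: "w \<in> piece j (var z + f)"
    if "w0 \<in> U (var z + f)" "Suc (mon_degree f + mon_degree w0) = j" "mon_dvd w0 w" for w w0
    using that by (auto simp: piece_def upward_closure_def mon_degree_add)
  show ?thesis
  proof (cases "z \<in> Poly_Mapping.keys v1")
    case True
    then have v1: "v1 = var z + (v1 - var z)"
      by (simp add: mon_dvd_add_diff mon_dvd_var_iff)
    obtain x where x: "x \<in> Poly_Mapping.keys v0" "v0 - var x \<in> U (var z + f)"
      using into_max[OF f v0(1)] by blast
    have v0x: "v0 = var x + (v0 - var x)"
      using x(1) by (simp add: mon_dvd_add_diff mon_dvd_var_iff)
    then have "mon_degree v0 = Suc (mon_degree (v0 - var x))"
      by (metis mon_degree_add mon_degree_var plus_1_eq_Suc)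
    moreover have "mon_dvd (v0 - var x) (v0 + (v1 - var z))"
      by (subst v0x) (auto simp: mon_dvd_def add.assoc add.left_commute intro: exI[of _ "var x + (v1 - var z)"])
    ultimately have "v0 + (v1 - var z) \<in> piece j (var z + f)"
      using x(2) v0(2) by (intro w[of "v0 - var x"]) auto
    moreover have "f + v = (var z + f) + (v0 + (v1 - var z))"
      unfolding vv by (subst v1) (simp add: ac_simps)
    ultimately show ?thesis
      by blast
  next
    case False
    then have z: "z \<in> Poly_Mapping.keys v0"
      using v(2) by (auto simp: vv lookup_add in_keys_iff)
    then have v0z: "v0 = var z + (v0 - var z)"
      by (simp add: mon_dvd_add_diff mon_dvd_var_iff)
    have "v0 - var z \<in> U f"
      using drop_var[OF f(1) v0(1) new_var[OF f(2)] z] .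
    then obtain x where x: "x \<in> Poly_Mapping.keys (v0 - var z)" "v0 - var z - var x \<in> U (var z + f)"
      using into_max[OF f] by blast
    \<comment> \<open>From \<open>into_max\<close> only the inclusion of \<open>U f\<close> in
      \<open>U (var z + f)\<close> is extracted here; removing \<open>z\<close> has already lowered
      the degree.\<close>
    have "mon_dvd (v0 - var z - var x) (v0 - var z)"
      unfolding mon_dvd_iff lookup_minus by (intro allI diff_le_self)
    then have "v0 - var z \<in> U (var z + f)"
      using upward_closedD[OF up[OF f(2)] x(2)] by blast
    moreover have "mon_degree v0 = Suc (mon_degree (v0 - var z))"
      using v0z by (metis mon_degree_add mon_degree_var plus_1_eq_Suc)
    ultimately have "(v0 - var z) + v1 \<in> piece j (var z + f)"
      using v0(2) by (intro w[of "v0 - var z"]) (auto simp: mon_dvd_def)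
    moreover have "f + v = (var z + f) + ((v0 - var z) + v1)"
      unfolding vv by (subst v0z) (simp add: ac_simps)
    ultimately show ?thesis
      by blast
  qed
qed

text \<open>A cofactor divisible by such a \<open>z\<close> is absorbed by the stage
  \<open>z g\<close>, which lies in \<open>T\<close>. Conversely, a monomial that also comes from
  some \<open>f\<close> in \<open>T\<close> is a multiple of \<open>mon_lcm f g\<close>. This lcm is
  in \<open>T\<close>, hence differs from \<open>g\<close>, and the first variable on a full path
  towards it divides the cofactor.\<close>

lemma sum_monomials_quotient:
  assumes T: "up_set T" "up_set (insert g T)" and g: "g \<notin> T"
  shows "sum_monomials j (insert g T) - sum_monomials j T =
    {g + v |v. v \<in> piece j g \<and> (\<forall>z\<in>Poly_Mapping.keys v. var z + g \<notin> L)}"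
proof (intro equalityI subsetI)
  have gL: "g \<in> L"
    using T(2) by (auto simp: up_set_def)
  {
    fix m assume m: "m \<in> sum_monomials j (insert g T) - sum_monomials j T"
    then obtain v where v: "v \<in> piece j g" "m = g + v"
      by (auto simp: sum_monomials_def)
    have "var z + g \<notin> L" if z: "z \<in> Poly_Mapping.keys v" for z
    proof
      assume zg: "var z + g \<in> L"
      have "var z + g \<in> insert g T"
        using T(2) zg unfolding up_set_def by (metis add.commute insertI1 mon_dvd_def)
      moreover have "var z + g \<noteq> g"
        by (metis mon_degree_add mon_degree_var add_eq_self_zero add.commute zero_neq_one)
      ultimately have "var z + g \<in> T"
        by simp
      with piece_step[OF gL zg v(1) z] m v(2) show False
        by (auto simp: sum_monomials_def)
    qed
    with v show "m \<in> {g + v |v. v \<in> piece j g \<and> (\<forall>z\<in>Poly_Mapping.keys v. var z + g \<notin> L)}"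
      by blast
  next
    fix m assume "m \<in> {g + v |v. v \<in> piece j g \<and> (\<forall>z\<in>Poly_Mapping.keys v. var z + g \<notin> L)}"
    then obtain v where v: "m = g + v" "v \<in> piece j g"
      "\<And>z. z \<in> Poly_Mapping.keys v \<Longrightarrow> var z + g \<notin> L"
      by blast
    have "m \<notin> sum_monomials j T"
    proof
      assume "m \<in> sum_monomials j T"
      then obtain f w where f: "f \<in> T" "m = f + w"
        by (auto simp: sum_monomials_def)
      have fL: "f \<in> L"
        using f(1) T(1) by (auto simp: up_set_def)
      have dvd: "mon_dvd f m" "mon_dvd g m"
        unfolding mon_dvd_def using f(2) v(1) by blast+
      have lcm: "mon_lcm f g \<in> L"
        using full fL gL by (simp add: full_set_def lcm_closed_def)
      have "mon_lcm f g \<in> T"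
        using T(1) f(1) lcm mon_dvd_lcm(1) unfolding up_set_def by blast
      then have "g \<noteq> mon_lcm f g"
        using g by auto
      moreover obtain gs where "full_path L g (mon_lcm f g) gs"
        using full gL lcm mon_dvd_lcm(2) unfolding full_set_def by blast
      ultimately obtain z where z: "var z + g \<in> L" "mon_dvd (var z + g) (mon_lcm f g)"
        using full_path_step by blast
      then have "mon_dvd (var z + g) m"
        using mon_dvd_trans mon_lcm_dvd[OF dvd] by blast
      \<comment> \<open>At \<open>z\<close> the monomial \<open>m\<close> has a larger exponent than
        \<open>g\<close>, and the excess can only come from \<open>v\<close>.\<close>
      then have "Poly_Mapping.lookup (var z + g) z \<le> Poly_Mapping.lookup m z"
        by (simp add: mon_dvd_iff)
      then have "z \<in> Poly_Mapping.keys v"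
        by (simp add: v(1) lookup_add lookup_var in_keys_iff)
      with v(3) z(1) show False
        by blast
    qed
    with v(1,2) show "m \<in> sum_monomials j (insert g T) - sum_monomials j T"
      by (auto simp: sum_monomials_def)
  }
qed

text \<open>
  The quotient is \<open>g\<close> times the image of an ideal modulo the variables \<open>z\<close> with \<open>z g \<in> L\<close>. In a
  fixed multidegree such a \<open>z\<close> has exponent at most 1, and every face of the Koszul complex contains
  exactly those \<open>z\<close> that have exponent 1.
\<close>

lemma koszul_complex_quotient:
  assumes b: "mon_dvd g b" and le1: "\<And>z. var z + g \<in> L \<Longrightarrow> Poly_Mapping.lookup (b - g) z \<le> 1"
  defines "\<zeta> \<equiv> {z. var z + g \<in> L \<and> z \<in> Poly_Mapping.keys (b - g)}"
  shows "koszul_complex {g + v |v. v \<in> V \<and> (\<forall>z\<in>Poly_Mapping.keys v. var z + g \<notin> L)} b =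
    (\<lambda>\<sigma>. \<sigma> \<union> \<zeta>) ` koszul_complex V (b - g - indicator_mon \<zeta>)"
    and "\<sigma> \<in> koszul_complex V (b - g - indicator_mon \<zeta>) \<Longrightarrow> \<sigma> \<inter> \<zeta> = {}"
    and "mon_degree b = mon_degree g + card \<zeta> + mon_degree (b - g - indicator_mon \<zeta>)"
proof -
  define c where "c = b - g - indicator_mon \<zeta>"
  have zeta_dvd: "mon_dvd (indicator_mon \<zeta>) (b - g)"
    by (auto simp: mon_dvd_indicator_mon_iff \<zeta>_def)
  have bg: "b - g = c + indicator_mon \<zeta>"
    unfolding c_def by (rule mon_dvd_diff_add[OF zeta_dvd, symmetric])
  have bc: "b = g + (c + indicator_mon \<zeta>)"
    by (metis bg b mon_dvd_add_diff)
  \<comment> \<open>Removing \<open>indicator_mon \<zeta>\<close> uses up every \<open>z\<close>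
    with \<open>z g\<close> in \<open>L\<close>, so in multidegree \<open>c\<close> the restriction
    on \<open>v\<close> holds automatically and all of \<open>V\<close> may be used.\<close>
  have c_zero: "Poly_Mapping.lookup c z = 0" if "var z + g \<in> L" for z
    using le1[OF that] that by (auto simp: c_def \<zeta>_def lookup_minus lookup_indicator_mon in_keys_iff)
  show "mon_degree b = mon_degree g + card \<zeta> + mon_degree (b - g - indicator_mon \<zeta>)"
    using arg_cong[OF bc, of mon_degree]
    by (simp add: mon_degree_add mon_degree_indicator_mon flip: c_def)
  have disj: "\<sigma> \<inter> \<zeta> = {}" if "\<sigma> \<in> koszul_complex V c" for \<sigma>
    using koszul_complexD[OF that] c_zero by (auto simp: mon_dvd_indicator_mon_iff \<zeta>_def in_keys_iff)
  then show "\<sigma> \<in> koszul_complex V (b - g - indicator_mon \<zeta>) \<Longrightarrow> \<sigma> \<inter> \<zeta> = {}"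
    by (simp flip: c_def)
  have Un: "indicator_mon (\<sigma> \<union> \<zeta>) = indicator_mon \<sigma> + indicator_mon \<zeta>" if "\<sigma> \<inter> \<zeta> = {}" for \<sigma>
    using that by (intro poly_mapping_eqI) (auto simp: lookup_add lookup_indicator_mon)
  show "koszul_complex {g + v |v. v \<in> V \<and> (\<forall>z\<in>Poly_Mapping.keys v. var z + g \<notin> L)} b =
    (\<lambda>\<sigma>. \<sigma> \<union> \<zeta>) ` koszul_complex V (b - g - indicator_mon \<zeta>)"
    unfolding c_def[symmetric]
  proof (intro equalityI subsetI)
    fix \<sigma> assume "\<sigma> \<in> koszul_complex {g + v |v. v \<in> V \<and> (\<forall>z\<in>Poly_Mapping.keys v. var z + g \<notin> L)} b"
    then obtain v where v: "v \<in> V" "\<And>z. z \<in> Poly_Mapping.keys v \<Longrightarrow> var z + g \<notin> L"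
      and b_eq: "b = g + v + indicator_mon \<sigma>"
      by (auto simp: koszul_complex_def)
    have sum: "c + indicator_mon \<zeta> = v + indicator_mon \<sigma>"
      using bc b_eq by (simp add: add.assoc)
    have sub: "\<zeta> \<subseteq> \<sigma>"
    proof
      fix z assume z: "z \<in> \<zeta>"
      then have "z \<notin> Poly_Mapping.keys v"
        using v(2) by (auto simp: \<zeta>_def)
      with z arg_cong[OF sum, of "\<lambda>m. Poly_Mapping.lookup m z"] show "z \<in> \<sigma>"
        by (auto simp: lookup_add lookup_indicator_mon in_keys_iff split: if_splits)
    qed
    then have \<sigma>: "\<sigma> = (\<sigma> - \<zeta>) \<union> \<zeta>"
      by blast
    have "indicator_mon \<sigma> = indicator_mon (\<sigma> - \<zeta>) + indicator_mon \<zeta>"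
      by (subst \<sigma>) (rule Un, blast)
    with sum have "c = v + indicator_mon (\<sigma> - \<zeta>)"
      by (simp flip: add.assoc)
    with v(1) have "\<sigma> - \<zeta> \<in> koszul_complex V c"
      by (auto simp: koszul_complex_def)
    with \<sigma> show "\<sigma> \<in> (\<lambda>\<sigma>. \<sigma> \<union> \<zeta>) ` koszul_complex V c"
      by blast
  next
    fix \<tau> assume "\<tau> \<in> (\<lambda>\<sigma>. \<sigma> \<union> \<zeta>) ` koszul_complex V c"
    then obtain \<sigma> v where \<sigma>: "\<tau> = \<sigma> \<union> \<zeta>" "\<sigma> \<in> koszul_complex V c" and v: "v \<in> V" "c = v + indicator_mon \<sigma>"
      by (auto simp: koszul_complex_def)
    have "var z + g \<notin> L" if "z \<in> Poly_Mapping.keys v" for z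
      using that c_zero[of z] by (auto simp: v(2) lookup_add in_keys_iff)
    moreover have "b = g + v + indicator_mon \<tau>"
      unfolding bc \<sigma>(1) Un[OF disj[OF \<sigma>(2)]] v(2) by (simp add: add.assoc)
    ultimately show "\<tau> \<in> koszul_complex {g + v |v. v \<in> V \<and> (\<forall>z\<in>Poly_Mapping.keys v. var z + g \<notin> L)} b"
      unfolding koszul_complex_def using v(1) by blast
  qed
qed

text \<open>The shifts match: by \<open>deg_b\<close>, removing \<open>g\<close> and
  \<open>\<zeta>\<close> from \<open>b\<close> turns \<open>mon_degree b \<noteq> i + j\<close> into
  \<open>mon_degree c \<noteq> (i - card \<zeta>) + (j - mon_degree g)\<close>, the range in which
  linearity at \<open>g\<close> gives acyclicity.\<close>

lemma acyclic_at_quotient: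
  assumes "g \<in> L" "mon_degree b \<noteq> i + j"
  shows "acyclic_at TYPE('k)
    (koszul_complex {g + v |v. v \<in> piece j g \<and> (\<forall>z\<in>Poly_Mapping.keys v. var z + g \<notin> L)} b) i"
    (is "acyclic_at _ (koszul_complex ?Q b) i")
proof (cases "mon_dvd g b \<and> (\<forall>z. var z + g \<in> L \<longrightarrow> Poly_Mapping.lookup (b - g) z \<le> 1)")
  case False
  \<comment> \<open>\<open>v\<close> contains no such \<open>z\<close> and a face contributes it at
    most once, so no face exists if its exponent in \<open>b - g\<close> exceeds 1.\<close>
  have "koszul_complex ?Q b = {}"
  proof (rule ccontr)
    assume "koszul_complex ?Q b \<noteq> {}"
    then obtain v \<sigma> where v: "\<forall>z\<in>Poly_Mapping.keys v. var z + g \<notin> L" "b = g + v + indicator_mon \<sigma>"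
      by (auto simp: koszul_complex_def)
    have "mon_dvd g b"
      unfolding v(2) mon_dvd_def by (auto simp: add.assoc)
    moreover have "Poly_Mapping.lookup (b - g) z \<le> 1" if "var z + g \<in> L" for z
      using v(1) that by (auto simp: v(2) lookup_minus lookup_add lookup_indicator_mon in_keys_iff)
    ultimately show False
      using False by blast
  qed
  then show ?thesis
    by (simp add: acyclic_at_empty)
next
  case True
  define \<zeta> where "\<zeta> = {z. var z + g \<in> L \<and> z \<in> Poly_Mapping.keys (b - g)}"
  define c where "c = b - g - indicator_mon \<zeta>"
  have b: "mon_dvd g b" and le1: "\<And>z. var z + g \<in> L \<Longrightarrow> Poly_Mapping.lookup (b - g) z \<le> 1"
    using True by auto
  have complex: "koszul_complex ?Q b = (\<lambda>\<sigma>. \<sigma> \<union> \<zeta>) ` koszul_complex (piece j g) c"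
    unfolding c_def \<zeta>_def by (rule koszul_complex_quotient(1)[OF b le1])
  have disj: "\<sigma> \<inter> \<zeta> = {}" if "\<sigma> \<in> koszul_complex (piece j g) c" for \<sigma>
    using that koszul_complex_quotient(2)[where V = "piece j g" and \<sigma> = \<sigma>, OF b le1]
    unfolding c_def \<zeta>_def by blast
  have deg_b: "mon_degree b = mon_degree g + card \<zeta> + mon_degree c"
    unfolding c_def \<zeta>_def by (rule koszul_complex_quotient(3)[OF b le1])
  show ?thesis
  proof (cases "mon_degree g \<le> j")
    case True
    then have "mon_degree g + mon_degree v = j \<longleftrightarrow> mon_degree v = j - mon_degree g" for v :: "'x mon"
      by auto
    then have "piece j g = upward_closure (degree_part (U g) (j - mon_degree g))"
      by (simp add: piece_def)
    then have lin: "mon_linear TYPE('k) (j - mon_degree g) (piece j g)"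
      using linear[OF assms(1)] by (simp add: mon_linear_def)
    show ?thesis
      unfolding complex
    proof (rule acyclic_at_translate)
      show "acyclic_at TYPE('k) (koszul_complex (piece j g) c) (i - card \<zeta>)" if "card \<zeta> \<le> i"
        using lin that assms(2) True deg_b by (auto simp: mon_linear_def)
    qed (rule disj)
  next
    case False
    then have "piece j g = {}"
      by (auto simp: piece_def upward_closure_def)
    then show ?thesis
      by (simp add: koszul_complex_def acyclic_at_empty)
  qed
qed

section \<open>Induction along the filtration\<close>

lemma koszul_complex_diff:
  "koszul_complex (M - N) b = koszul_complex M b - koszul_complex N b"
  by (auto simp: koszul_complex_def)

lemma koszul_complex_mono: "M \<subseteq> N \<Longrightarrow> koszul_complex M b \<subseteq> koszul_complex N b"
  by (auto simp: koszul_complex_def)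

lemma finite_L: "finite L"
proof (rule finite_subset)
  show "L \<subseteq> (\<Union>d\<le>card (UNIV :: 'x set). {m. mon_degree m = d})"
  proof
    fix f assume "f \<in> L"
    then have "Poly_Mapping.lookup f x \<le> 1" for x
      using full by (auto simp: full_set_def squarefree_mon_def)
    then have "mon_degree f \<le> (\<Sum>x\<in>(UNIV :: 'x set). 1)"
      unfolding mon_degree_def by (intro sum_mono)
    then show "f \<in> (\<Union>d\<le>card (UNIV :: 'x set). {m. mon_degree m = d})"
      by simp
  qed
  show "finite (\<Union>d\<le>card (UNIV :: 'x set). {m :: 'x mon. mon_degree m = d})"
    by (simp add: finite_mon_degree)
qed

text \<open>An element \<open>g\<close> of least degree is peeled off. No other member of
  \<open>T\<close> divides it, so the remainder is again an up-set; its sum and the quotient at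
  \<open>g\<close> are both acyclic in the forbidden degrees.\<close>

lemma sum_monomials_linear:
  assumes "up_set T"
  shows "mon_linear TYPE('k) j (sum_monomials j T)"
proof -
  have "finite T"
    using assms finite_L finite_subset by (auto simp: up_set_def)
  then show ?thesis
    using assms
  proof (induction "card T" arbitrary: T)
    case 0
    then show ?case
      by (simp add: mon_linear_def sum_monomials_def koszul_complex_def acyclic_at_empty)
  next
    case (Suc n T)
    then have "T \<noteq> {}"
      by auto
    then obtain g where g: "g \<in> T" "\<And>f. f \<in> T \<Longrightarrow> mon_degree g \<le> mon_degree f"
      using ex_has_least_nat[of "\<lambda>f. f \<in> T" _ mon_degree] by blast
    define T' where "T' = T - {g}"
    have T: "T = insert g T'" "g \<notin> T'"
      using g(1) by (auto simp: T'_def)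
    have up': "up_set T'"
      unfolding up_set_def
    proof (intro conjI ballI impI)
      show "T' \<subseteq> L"
        using Suc.prems(2) by (auto simp: up_set_def T'_def)
      fix f h assume f: "f \<in> T'" "h \<in> L" "mon_dvd f h"
      then have "h \<in> T" "f \<in> T" "f \<noteq> g"
        using Suc.prems(2) by (auto simp: up_set_def T'_def)
      moreover have "f = h" if "h = g"
      proof -
        obtain t where t: "h = f + t"
          using f(3) by (auto simp: mon_dvd_def)
        have "mon_degree h = mon_degree f + mon_degree t"
          by (simp add: t mon_degree_add)
        with that g(2)[OF \<open>f \<in> T\<close>] have "mon_degree t = 0"
          by simp
        with t show ?thesis
          by (simp add: mon_degree_eq_0_iff)
      qed
      ultimately show "h \<in> T'"
        by (auto simp: T'_def)
    qed
    have IH: "mon_linear TYPE('k) j (sum_monomials j T')"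
      using Suc.hyps Suc.prems up' g(1) by (intro Suc.hyps(1)) (auto simp: T'_def)
    show ?case
      unfolding mon_linear_def
    proof (intro allI impI)
      fix b :: "'x mon" and i assume b: "mon_degree b \<noteq> i + j"
      have diff_eq: "sum_monomials j T - sum_monomials j T' =
          {g + v |v. v \<in> piece j g \<and> (\<forall>z\<in>Poly_Mapping.keys v. var z + g \<notin> L)}"
        unfolding T(1) by (rule sum_monomials_quotient) (use up' Suc.prems(2) T in auto)
      have gL: "g \<in> L"
        using g(1) Suc.prems(2) by (auto simp: up_set_def)
      have quot: "acyclic_at TYPE('k)
          (koszul_complex (sum_monomials j T) b - koszul_complex (sum_monomials j T') b) i"
        unfolding koszul_complex_diff[symmetric] diff_eq by (rule acyclic_at_quotient[OF gL b])
      have "sum_monomials j T' \<subseteq> sum_monomials j T"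
        by (auto simp: sum_monomials_def T'_def)
      then have sub: "koszul_complex (sum_monomials j T') b \<subseteq> koszul_complex (sum_monomials j T) b"
        by (rule koszul_complex_mono)
      have "acyclic_at TYPE('k) (koszul_complex (sum_monomials j T') b) i"
        using IH b by (simp add: mon_linear_def)
      from acyclic_at_extension[OF down_closed_koszul_complex down_closed_koszul_complex sub this quot]
      show "acyclic_at TYPE('k) (koszul_complex (sum_monomials j T) b) i"
        by (simp add: upward_closed_sum_monomials)
    qed
  qed
qed

end

section \<open>From hypotheses on ideals to sets of monomials\<close>

lemma min_mon_gens_dvd:
  fixes m :: "'x::finite mon"
  assumes "m \<in> monomials I"
  shows "\<exists>m0\<in>min_mon_gens I. mon_dvd m0 m"
proof -
  obtain m0 where m0: "m0 \<in> monomials I \<and> mon_dvd m0 m"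
    and least: "\<And>m'. m' \<in> monomials I \<and> mon_dvd m' m \<Longrightarrow> mon_degree m0 \<le> mon_degree m'"
    using ex_has_least_nat[of "\<lambda>m0. m0 \<in> monomials I \<and> mon_dvd m0 m" m mon_degree]
      assms mon_dvd_refl by blast
  have "m' = m0" if m': "m' \<in> monomials I" "mon_dvd m' m0" for m'
  proof -
    obtain t where t: "m0 = m' + t"
      using m'(2) by (auto simp: mon_dvd_def)
    have "mon_degree m0 \<le> mon_degree m'"
      using least m' m0 mon_dvd_trans by blast
    then have "t = 0"
      by (simp add: t mon_degree_add mon_degree_eq_0_iff)
    with t show ?thesis
      by simp
  qed
  with m0 show ?thesis
    by (auto simp: min_mon_gens_def monomials_def)
qed

text \<open>A member of the maximal ideal has no constant term, so every monomial of a product with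
  it has a nontrivial factor from which a variable splits off. Hence the product ideal lies in the
  one generated by the monomials \<open>var x + u\<close> with \<open>u\<close> in
  \<open>U\<close>.\<close>

lemma monomial_in_max_ideal_mult:
  assumes U: "upward_closed U"
    and m: "poly_of_mon m \<in> ideal_mult max_ideal (ideal_of U :: ('x::finite, 'k::comm_ring_1) polyring set)"
  shows "\<exists>x\<in>Poly_Mapping.keys m. m - var x \<in> U"
proof -
  let ?G = "{var x + u |x u. u \<in> U}"
  have "ideal_mult max_ideal (ideal_of U :: ('x, 'k) polyring set) \<subseteq> ideal_gen (poly_of_mon ` ?G)"
    unfolding ideal_mult_def
  proof (intro ring_module.span_minimal ring_module.subspace_span subsetI)
    fix p assume "p \<in> {a * b |a b. a \<in> max_ideal \<and> b \<in> (ideal_of U :: ('x, 'k) polyring set)}"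
    then obtain a b where p: "p = a * b" "a \<in> max_ideal" "b \<in> ideal_of U"
      by blast
    have "\<exists>m0\<in>?G. mon_dvd m0 t" if t: "t \<in> Poly_Mapping.keys p" for t
    proof -
      obtain s u where su: "t = s + u" "s \<in> Poly_Mapping.keys a" "u \<in> Poly_Mapping.keys b"
        using keys_mult[of a b] t p(1) by blast
      have "s \<noteq> 0"
        using p(2) su(2) by (auto simp: max_ideal_iff in_keys_iff)
      then obtain x where "x \<in> Poly_Mapping.keys s"
        by (metis all_not_in_conv keys_eq_empty)
      then have "t = (var x + u) + (s - var x)"
        using mon_dvd_add_diff[of "var x" s] by (simp add: su(1) mon_dvd_var_iff ac_simps)
      then have "mon_dvd (var x + u) t"
        unfolding mon_dvd_def by blast
      with su(3) p(3) show ?thesis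
        by blast
    qed
    then show "p \<in> ideal_gen (poly_of_mon ` ?G)"
      unfolding ideal_gen_monomials by blast
  qed
  with m have "m \<in> monomials (ideal_gen (poly_of_mon ` ?G) :: ('x, 'k) polyring set)"
    unfolding monomials_def by blast
  then obtain x u t where "u \<in> U" "m = var x + u + t"
    unfolding ideal_gen_eq_ideal_of monomials_ideal_of by (auto simp: upward_closure_def mon_dvd_def)
  then have "x \<in> Poly_Mapping.keys m" "m - var x = u + t"
    by (auto simp: in_keys_iff lookup_add lookup_var add.assoc)
  moreover have "u + t \<in> U"
    using upward_closedD[OF U \<open>u \<in> U\<close>] by (auto simp: mon_dvd_def)
  ultimately show ?thesis
    by metis
qed

lemma ideal_sum_scale_monomial_ideals:
  fixes I :: "'x::finite mon \<Rightarrow> ('x, 'k::comm_ring_1) polyring set"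
  assumes I: "\<And>f. f \<in> L \<Longrightarrow> monomial_ideal (I f)"
  shows "ideal_sum L (\<lambda>f. scale_ideal (poly_of_mon f) (I f)) =
    ideal_gen (poly_of_mon ` {f + v |f v. f \<in> L \<and> v \<in> monomials (I f)})"
    (is "_ = ideal_gen (poly_of_mon ` ?G)")
  unfolding ideal_sum_def
proof (intro equalityI ring_module.span_minimal ring_module.subspace_span subsetI)
  fix p assume "p \<in> (\<Union>f\<in>L. scale_ideal (poly_of_mon f) (I f))"
  then obtain f q where f: "f \<in> L" "q \<in> I f" "p = poly_of_mon f * q"
    by (auto simp: scale_ideal_def)
  have "t \<in> ?G" if t: "t \<in> Poly_Mapping.keys p" for t
  proof -
    obtain v where "t = f + v" "v \<in> Poly_Mapping.keys q"
      using keys_mult[of "poly_of_mon f" q] t unfolding f(3)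
      by (auto simp: poly_of_mon_def split: if_splits)
    moreover have "Poly_Mapping.keys q \<subseteq> monomials (I f)"
      using monomial_ideal_monomials(1)[OF I[OF f(1)]] f(2) by blast
    ultimately show ?thesis
      using f(1) by blast
  qed
  then show "p \<in> ideal_gen (poly_of_mon ` ?G)"
    unfolding ideal_gen_monomials using mon_dvd_refl by blast
next
  fix p :: "('x, 'k) polyring" assume "p \<in> poly_of_mon ` ?G"
  then obtain f v where f: "f \<in> L" "v \<in> monomials (I f)" "p = poly_of_mon (f + v)"
    by blast
  have "(poly_of_mon (f + v) :: ('x, 'k) polyring) = poly_of_mon f * poly_of_mon v"
    by (simp add: poly_of_mon_def mult_single)
  then have "p \<in> scale_ideal (poly_of_mon f) (I f)"
    unfolding f(3) scale_ideal_def using f(2) by (simp add: monomials_def)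
  with f(1) show "p \<in> ideal_gen (\<Union>f\<in>L. scale_ideal (poly_of_mon f) (I f))"
    by (intro ring_module.span_base) blast
qed

theorem theorem1p1:
  fixes L :: "'x::finite mon set"
    and I :: "'x mon \<Rightarrow> ('x, 'k::field) polyring set"
  assumes "infinite (UNIV :: 'k set)"
    and "full_set L"
    and "\<And>f. f \<in> L \<Longrightarrow> monomial_ideal (I f) \<and> componentwise_linear (I f)"
    and "\<And>f m. f \<in> L \<Longrightarrow> m \<in> min_mon_gens (I f) \<Longrightarrow>
           Poly_Mapping.keys m \<subseteq> Poly_Mapping.keys f"
    and "\<And>f z. f \<in> L \<Longrightarrow> var z + f \<in> L \<Longrightarrow>
           I f \<subseteq> ideal_mult max_ideal (I (var z + f))"
  shows "componentwise_linear (ideal_sum L (\<lambda>f. scale_ideal (poly_of_mon f) (I f)))"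
proof -
  define U where "U f = monomials (I f)" for f
  have I: "I f = ideal_of (U f)" and up: "upward_closed (U f)" if "f \<in> L" for f
    using monomial_ideal_monomials[of "I f"] assms(3)[OF that] by (simp_all add: U_def)
  interpret full_family L U "TYPE('k)"
  proof
    show "full_set L"
      by fact
    show "upward_closed (U f)" if "f \<in> L" for f
      by (rule up[OF that])
    \<comment> \<open>Condition (1): a minimal generator dividing \<open>m\<close> avoids
      \<open>x\<close>, so it still divides after one factor \<open>x\<close> is removed.\<close>
    show "m - var x \<in> U f"
      if f: "f \<in> L" "m \<in> U f" "x \<notin> Poly_Mapping.keys f" "x \<in> Poly_Mapping.keys m" for f m x
    proof -
      obtain m0 where m0: "m0 \<in> min_mon_gens (I f)" "mon_dvd m0 m"
        using min_mon_gens_dvd f(2) unfolding U_def by blast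
      with assms(4)[OF f(1)] f(3) have "x \<notin> Poly_Mapping.keys m0"
        by blast
      then have "mon_dvd m0 (m - var x)"
        using m0(2) by (auto simp: mon_dvd_iff lookup_minus lookup_var in_keys_iff)
      moreover have "m0 \<in> U f"
        using m0(1) by (simp add: min_mon_gens_def U_def monomials_def)
      ultimately show ?thesis
        using upward_closedD[OF up[OF f(1)]] by blast
    qed
    show "\<exists>x\<in>Poly_Mapping.keys m. m - var x \<in> U (var z + f)"
      if f: "f \<in> L" "var z + f \<in> L" "m \<in> U f" for f z m
    proof (rule monomial_in_max_ideal_mult[OF up[OF f(2)]])
      have "poly_of_mon m \<in> I f"
        using f(3) by (simp add: U_def monomials_def)
      with assms(5)[OF f(1,2)] show "(poly_of_mon m :: ('x, 'k) polyring) \<in> ideal_mult max_ideal (ideal_of (U (var z + f)))"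
        by (simp flip: I[OF f(2)]) blast
    qed
    show "mon_linear TYPE('k) d (upward_closure (degree_part (U f) d))" if "f \<in> L" for f d
      using assms(3)[OF that] linear_component_iff[OF I[OF that]]
      by (simp add: componentwise_linear_def)
  qed
  let ?J = "ideal_sum L (\<lambda>f. scale_ideal (poly_of_mon f) (I f))"
  let ?G = "{f + v |f v. f \<in> L \<and> v \<in> U f}"
  have J: "?J = ideal_gen (poly_of_mon ` ?G)"
    unfolding U_def by (rule ideal_sum_scale_monomial_ideals) (simp add: assms(3))
  have J': "?J = ideal_of ?G"
  proof -
    have "upward_closed ?G"
      unfolding upward_closed_def
    proof (intro ballI allI impI)
      fix m m' assume "m \<in> ?G" "mon_dvd m m'"
      then obtain f v t where *: "f \<in> L" "v \<in> U f" "m' = f + (v + t)"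
        by (auto simp: mon_dvd_def add.assoc)
      then have "v + t \<in> U f"
        using upward_closedD[OF up] by (auto simp: mon_dvd_def)
      with * show "m' \<in> ?G"
        by blast
    qed
    then show ?thesis
      unfolding J ideal_gen_eq_ideal_of by (simp add: upward_closure_eq)
  qed
  \<comment> \<open>Degrees add, so \<open>f + v\<close> has degree \<open>j\<close> exactly when
    \<open>v\<close> has the degree selected in \<open>piece j f\<close>; taking multiples commutes
    with multiplication by \<open>f\<close>.\<close>
  have pieces: "upward_closure (degree_part ?G j) = sum_monomials j L" for j
  proof (intro equalityI subsetI)
    fix m assume "m \<in> upward_closure (degree_part ?G j)"
    then obtain f v t where *: "f \<in> L" "v \<in> U f" "mon_degree f + mon_degree v = j" "m = f + (v + t)"
      by (auto simp: upward_closure_def mon_dvd_def mon_degree_add add.assoc)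
    then have "v + t \<in> piece j f"
      by (auto simp: piece_def upward_closure_def mon_dvd_def)
    with * show "m \<in> sum_monomials j L"
      by (auto simp: sum_monomials_def)
  next
    fix m assume "m \<in> sum_monomials j L"
    then obtain f v t where *: "f \<in> L" "v \<in> U f" "mon_degree (f + v) = j" "m = (f + v) + t"
      by (auto simp: sum_monomials_def piece_def upward_closure_def mon_dvd_def mon_degree_add add.assoc)
    then have "f + v \<in> degree_part ?G j" "mon_dvd (f + v) m"
      by (auto simp: mon_dvd_def)
    then show "m \<in> upward_closure (degree_part ?G j)"
      unfolding upward_closure_def by blast
  qed
  have "homogeneous_ideal ?J"
    unfolding homogeneous_ideal_def J using form_poly_of_mon by blast
  \<comment> \<open>All of \<open>L\<close> is an up-set, the last stage of the filtration.\<close>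
  moreover have "linear_resolution (component ?J j)" for j
    unfolding linear_component_iff[OF J'] pieces
    by (rule sum_monomials_linear) (simp add: up_set_def)
  ultimately show ?thesis
    unfolding componentwise_linear_def by blast
qed

end
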